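(* Let $n\ge1$ and let $f\in\mathcal R^0(\mathbb R^n)$ be non-negative on $\mathbb R^n$. Then there exist $f_1,\dots,f_m\in\mathcal R^0(\mathbb R^n)$ such that $f=\sum_{i=1}^m f_i^2$.
   Context: $\mathcal R^0(\mathbb R^n)$ denotes the ring of regulous functions: continuous functions $f:\mathbb R^n\to\mathbb R$ for which there exist a nonempty Zariski open set $U\subseteq\mathbb R^n$ and polynomials $p,q$ with $q$ nonvanishing on $U$ and $f=p/q$ on $U$. *)

theory Defs
  imports "HOL-Analysis.Analysis"
begin

inductive_set polyfun_set :: "(real ^ 'n \<Rightarrow> real) set" where
  const: "(\<lambda>x. c) \<in> polyfun_set"
| coord: "(\<lambda>x. x $ i) \<in> polyfun_set"
| add: "p \<in> polyfun_set \<Longrightarrow> q \<in> polyfun_set \<Longrightarrow> (\<lambda>x. p x + q x) \<in> polyfun_set"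
| mult: "p \<in> polyfun_set \<Longrightarrow> q \<in> polyfun_set \<Longrightarrow> (\<lambda>x. p x * q x) \<in> polyfun_set"

definition zariski_open :: "(real ^ 'n) set \<Rightarrow> bool" where
  "zariski_open U \<longleftrightarrow> (\<exists>G. finite G \<and> G \<subseteq> polyfun_set \<and>
      U = UNIV - {x. \<forall>g\<in>G. g x = 0})"

definition regulous :: "(real ^ 'n \<Rightarrow> real) \<Rightarrow> bool" where
  "regulous f \<longleftrightarrow> continuous_on UNIV f \<and>
     (\<exists>U p q. zariski_open U \<and> U \<noteq> {} \<and> p \<in> polyfun_set \<and> q \<in> polyfun_set \<and>
        (\<forall>x\<in>U. q x \<noteq> 0 \<and> f x = p x / q x))"

end

theory Submission
  imports Defs
    "HOL-Algebra.Algebraic_Closure_Type"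
    "HOL-Computational_Algebra.Fraction_Field"
    "HOL-Library.Multiset"
begin

text \<open>Suppose that \<open>f\<close> lies in every prime cone of the ring of regulous functions. Then the formal
  Positivstellensatz gives \<open>f * g = f ^ (2 * N) + h\<close> with sums of squares \<open>g\<close> and \<open>h\<close>. With
  \<open>D = f ^ (2 * N) + h\<close> and \<open>g * D = (\<Sum>i. (e i)\<^sup>2)\<close> this means \<open>f = (\<Sum>i. (f * e i / D)\<^sup>2)\<close>; here \<open>D\<close>
  is positive off the zeros of \<open>f\<close>, and the summands are bounded by \<open>f\<close>, so that each
  \<open>f * e i / D\<close> extends continuously by \<open>0\<close> to the zeros of \<open>f\<close>.

  A prime cone amounts to a homomorphism \<open>\<psi>\<close> to a real closed field, and one has to show
  \<open>0 \<le> \<psi> f\<close>. On polynomials, sign conditions that hold for \<open>\<psi>\<close> hold at some real point (Artin-Lang);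
  this follows from the elimination procedure of Cohen and Hoermander, run simultaneously in both
  real closed fields. To reduce to polynomials, one finds polynomials \<open>a\<close>, \<open>b\<close>, \<open>r\<close> with
  \<open>\<psi> r = 0\<close>, \<open>\<psi> b \<noteq> 0\<close> and \<open>f * b = a\<close> on the zeros of \<open>r\<close>. By the Lojasiewicz inequality some
  power of \<open>f * b - a\<close> is a regulous multiple of \<open>r\<^sup>2\<close>, hence \<open>\<psi> f * \<psi> b = \<psi> a\<close>.\<close>

hide_const (open) Polynomials.degree up_ring.coeff module.smult up_ring.monom Coset.order
  Polynomials.lead_coeff
no_notation fps_nth (infixl "$" 75)

section \<open>Polynomials over real closed fields\<close>

text \<open>The even power of \<open>f\<close> takes the place of the \<open>1\<close> in a strict
  Positivstellensatz because \<open>f\<close> may vanish: an identity \<open>f * g = 1 + h\<close>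
  with sums of squares would leave \<open>f\<close> without zeros. The obstacle is that a prime cone
  need not come from a point. A denominator of \<open>f\<close> can lie in the support of the cone,
  and then the sign that the cone gives to \<open>f\<close> cannot be read off from one fixed
  quotient \<open>p / q\<close>; hence the search for another quotient, valid on the zeros of
  \<open>r\<close>. The elimination does not handle formulas. All coefficients live in one common
  ring, the regulous functions themselves, and the two fields enter through homomorphisms out of it,
  so that evaluation at a point and \<open>\<psi>\<close> are on the same footing. Agreement of
  signs on finitely many elements of the coefficient ring then lets the roots be matched in order.
  This is used twice: with the reals against a real closed field for Artin-Lang, and with the reals
  on both sides for the Lojasiewicz inequality.\<close>

class real_closed_field = linordered_field +
  assumes ivt_sum: "a < b \<Longrightarrow> (\<Sum>k\<le>n. f k * a ^ k) < 0 \<Longrightarrow> (\<Sum>k\<le>n. f k * b ^ k) > 0 \<Longrightarrow>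
    \<exists>x. a < x \<and> x < b \<and> (\<Sum>k\<le>n. f k * x ^ k) = 0"

text \<open>The axiom speaks of coefficient sequences and of an upward sign change; negating
  \<open>p\<close> covers the downward one.\<close>

lemma rcf_ivt:
  fixes p :: "'a::real_closed_field poly"
  assumes "a < b" "poly p a * poly p b < 0"
  shows "\<exists>x. a < x \<and> x < b \<and> poly p x = 0"
proof (cases "poly p a < 0")
  case True
  then have "poly p b > 0" using assms by (simp add: mult_less_0_iff)
  then show ?thesis
    using ivt_sum[of a b "coeff p" "degree p"] True assms(1) by (simp add: poly_altdef)
next
  case False
  then have "poly (-p) a < 0" "poly (-p) b > 0" using assms by (auto simp: mult_less_0_iff)
  then show ?thesis
    using ivt_sum[of a b "coeff (-p)" "degree (-p)"] assms(1)
    by (simp only: poly_altdef[symmetric]) simp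
qed

lemma rcf_const_sign:
  fixes p :: "'a::real_closed_field poly"
  assumes "a \<le> b" "\<And>x. a \<le> x \<Longrightarrow> x \<le> b \<Longrightarrow> poly p x \<noteq> 0"
  shows "0 < poly p a * poly p b"
proof (cases "a = b")
  case True
  then show ?thesis using assms(2)[of a] by (auto simp: zero_less_mult_iff linorder_neq_iff)
next
  case False
  then have "a < b" using assms(1) by simp
  moreover have "poly p a \<noteq> 0" "poly p b \<noteq> 0" using assms by auto
  moreover have "\<not> poly p a * poly p b < 0"
    using rcf_ivt[OF \<open>a < b\<close>, of p] assms(2) less_imp_le by blast
  ultimately show ?thesis by (metis linorder_neqE_linordered_idom mult_eq_0_iff)
qed

lemma rcf_rolle:
  fixes p :: "'a::real_closed_field poly"
  assumes "a < b" "poly p a = 0" "poly p b = 0"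
  shows "\<exists>x. a < x \<and> x < b \<and> poly (pderiv p) x = 0"
proof (cases "p = 0")
  case True
  then show ?thesis using dense[OF assms(1)] by auto
next
  case False
  define R where "R = {x. poly p x = 0 \<and> a < x \<and> x \<le> b}"
  have fin: "finite R" unfolding R_def using poly_roots_finite[OF False]
    by (rule rev_finite_subset) auto
  have "b \<in> R" using assms by (simp add: R_def)
  \<comment> \<open>The next root after \<open>a\<close>; a root in between would spoil the constant
    sign of \<open>g\<close>.\<close>
  define c where "c = Min R"
  have c: "c \<in> R" and cmin: "\<And>x. x \<in> R \<Longrightarrow> c \<le> x"
    using fin \<open>b \<in> R\<close> by (auto simp: c_def intro: Min_in)
  have ac: "a < c" "c \<le> b" "poly p c = 0" using c by (auto simp: R_def)
  obtain m g1 where g1: "p = [:- a, 1:] ^ Suc m * g1" "poly g1 a \<noteq> 0"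
    using order_decomp[OF False, of a] assms(2) False
    by (metis order_root poly_eq_0_iff_dvd not0_implies_Suc)
  have "g1 \<noteq> 0" using g1 False by auto
  have g1c: "poly g1 c = 0" using g1(1) ac by simp
  obtain n g where g: "g1 = [:- c, 1:] ^ Suc n * g" "poly g c \<noteq> 0"
    using order_decomp[OF \<open>g1 \<noteq> 0\<close>, of c] g1c \<open>g1 \<noteq> 0\<close>
    by (metis order_root poly_eq_0_iff_dvd not0_implies_Suc)
  have ga: "poly g a \<noteq> 0" using g1 g by auto
  have gsgn: "0 < poly g a * poly g c"
  proof (rule rcf_const_sign)
    fix x assume x: "a \<le> x" "x \<le> c"
    show "poly g x \<noteq> 0"
    proof
      assume "poly g x = 0"
      then have "poly p x = 0" using g1 g by simp
      moreover have "a < x" using x ga \<open>poly g x = 0\<close> by (metis order_le_less)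
      ultimately have "x \<in> R" using x ac by (auto simp: R_def)
      then show False using cmin x g(2) \<open>poly g x = 0\<close> by force
    qed
  qed (use ac in auto)
  define h where "h = smult (of_nat (Suc m)) ([:- c, 1:] * g)
     + smult (of_nat (Suc n)) ([:- a, 1:] * g) + [:- a, 1:] * [:- c, 1:] * pderiv g"
  have pd: "pderiv p = [:- a, 1:] ^ m * [:- c, 1:] ^ n * h"
  proof -
    have "pderiv (A ^ Suc m * (C ^ Suc n * g)) = A ^ m * C ^ n *
        (smult (of_nat (Suc m)) (C * g) + smult (of_nat (Suc n)) (A * g) + A * C * pderiv g)"
      if "pderiv A = 1" "pderiv C = 1" for A C :: "'a poly"
      unfolding pderiv_mult pderiv_power_Suc that
      by (simp add: algebra_simps del: of_nat_Suc)
    from this[of "[:- a, 1:]" "[:- c, 1:]"] show ?thesis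
      by (simp add: g1 g h_def pderiv_pCons del: of_nat_Suc)
  qed
  \<comment> \<open>One of the three summands of \<open>h\<close> survives at each end, and the two
    survivors carry the opposite factors \<open>a - c\<close> and \<open>c - a\<close>.\<close>
  have "poly h a * poly h c =
      - (of_nat (Suc m) * of_nat (Suc n) * (c - a)^2 * (poly g a * poly g c))"
    by (simp add: h_def power2_eq_square algebra_simps)
  also have "\<dots> < 0" using gsgn ac by (simp add: zero_less_mult_iff del: of_nat_Suc)
  finally obtain x where "a < x" "x < c" "poly h x = 0" using rcf_ivt[OF ac(1), of h] by auto
  then show ?thesis using pd ac by (intro exI[of _ x]) auto
qed

text \<open>Without critical points inside, \<open>r\<close> is a simple root and by Rolle the only
  one on the closed interval, so the cofactor of the linear factor at \<open>r\<close> keeps its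
  sign.\<close>

lemma rcf_sign_change_of_root:
  fixes q :: "'a::real_closed_field poly"
  assumes r: "a < r" "r < b" "poly q r = 0"
    and nz: "\<And>x. a < x \<Longrightarrow> x < b \<Longrightarrow> poly (pderiv q) x \<noteq> 0"
  shows "poly q a * poly q b < 0"
proof -
  obtain g where g: "q = [:- r, 1:] * g" using r(3) by (metis poly_eq_0_iff_dvd dvdE)
  have "pderiv q = g + [:- r, 1:] * pderiv g"
    by (simp only: g pderiv_mult pderiv_pCons pderiv_0) (simp add: algebra_simps)
  then have gr: "poly g r \<noteq> 0" using nz[OF r(1,2)] by auto
  have "0 < poly g a * poly g b"
  proof (rule rcf_const_sign)
    fix x assume x: "a \<le> x" "x \<le> b"
    show "poly g x \<noteq> 0"
    proof
      assume 0: "poly g x = 0"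
      then have "poly q x = 0" "x \<noteq> r" using g gr by auto
      then consider "x < r" | "r < x" by fastforce
      then show False
      proof cases
        case 1
        then show ?thesis using rcf_rolle[OF 1 \<open>poly q x = 0\<close> r(3)] nz x r by force
      next
        case 2
        then show ?thesis using rcf_rolle[OF 2 r(3) \<open>poly q x = 0\<close>] nz x r by force
      qed
    qed
  qed (use r in auto)
  moreover have "poly q a * poly q b = - ((r - a) * (b - r) * (poly g a * poly g b))"
    by (simp add: g algebra_simps)
  ultimately show ?thesis using r by (simp add: zero_less_mult_iff)
qed

text \<open>The bound \<open>\<bar>lead_coeff p\<bar>\<close>, stronger than positivity, carries the
  induction: multiplied by a large \<open>x\<close> it outweighs the next constant
  coefficient.\<close>

lemma poly_sign_at_top:
  fixes p :: "'a::linordered_field poly"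
  shows "\<exists>B. \<forall>x\<ge>B. poly p x * sgn (lead_coeff p) \<ge> \<bar>lead_coeff p\<bar>"
proof (induction p)
  case (pCons c p)
  show ?case
  proof (cases "p = 0")
    case True
    then show ?thesis by (auto simp: abs_sgn)
  next
    case False
    obtain B where B: "\<And>x. x \<ge> B \<Longrightarrow> poly p x * sgn (lead_coeff p) \<ge> \<bar>lead_coeff p\<bar>"
      using pCons.IH by blast
    define l where "l = lead_coeff p"
    have l: "\<bar>l\<bar> > 0" using False by (simp add: l_def)
    have "\<bar>l\<bar> \<le> poly (pCons c p) x * sgn l" if x: "x \<ge> max B (1 + \<bar>c\<bar> / \<bar>l\<bar>)" for x
    proof -
      have "\<bar>c\<bar> / \<bar>l\<bar> \<ge> 0" by simp
      then have x1: "x \<ge> 1 + \<bar>c\<bar> / \<bar>l\<bar>" "x \<ge> 0" using x by linarith+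
      have "\<bar>l\<bar> + \<bar>c\<bar> = (1 + \<bar>c\<bar> / \<bar>l\<bar>) * \<bar>l\<bar>" using l by (simp add: field_simps)
      also have "\<dots> \<le> x * \<bar>l\<bar>" using x1 by (intro mult_right_mono) auto
      also have "\<dots> \<le> x * (poly p x * sgn l)" using B[of x] x x1
        by (intro mult_left_mono) (auto simp: l_def)
      finally have "\<bar>l\<bar> + \<bar>c\<bar> \<le> x * (poly p x * sgn l)" .
      moreover have "- \<bar>c\<bar> \<le> c * sgn l" by (cases "l > 0"; cases "l = 0") (auto simp: sgn_if abs_if)
      ultimately show ?thesis by (simp add: algebra_simps)
    qed
    then show ?thesis using False by (auto simp: l_def intro!: exI[of _ "max B (1 + \<bar>c\<bar> / \<bar>l\<bar>)"])
  qed
qed simp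

lemma poly_sign_at_bot:
  fixes p :: "'a::linordered_field poly"
  shows "\<exists>B. \<forall>x\<le>-B. poly p x * sgn (lead_coeff p) * (-1) ^ degree p \<ge> \<bar>lead_coeff p\<bar>"
proof -
  define q where "q = pcompose p [:0, -1:]"
  have lq: "lead_coeff q = lead_coeff p * (-1) ^ degree p"
    unfolding q_def by (subst lead_coeff_comp) auto
  obtain B where B: "\<And>x. x \<ge> B \<Longrightarrow> poly q x * sgn (lead_coeff q) \<ge> \<bar>lead_coeff q\<bar>"
    using poly_sign_at_top by blast
  have "poly p x * sgn (lead_coeff p) * (-1) ^ degree p \<ge> \<bar>lead_coeff p\<bar>" if "x \<le> -B" for x
  proof -
    have "poly q (-x) = poly p x" by (simp add: q_def poly_pcompose)
    moreover have "sgn (lead_coeff q) = sgn (lead_coeff p) * (-1) ^ degree p"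
      "\<bar>lead_coeff q\<bar> = \<bar>lead_coeff p\<bar>"
      unfolding lq by (auto simp: sgn_mult power_sgn abs_mult power_abs)
    ultimately show ?thesis using B[of "-x"] that by (simp add: mult.assoc)
  qed
  then show ?thesis by blast
qed

instance real :: real_closed_field
proof
  fix a b :: real and f :: "nat \<Rightarrow> real" and n
  assume *: "a < b" "(\<Sum>k\<le>n. f k * a ^ k) < 0" "(\<Sum>k\<le>n. f k * b ^ k) > 0"
  define g where "g = (\<lambda>x. \<Sum>k\<le>n. f k * x ^ k)"
  have "continuous_on {a..b} g" unfolding g_def by (intro continuous_intros)
  then obtain x where "a \<le> x" "x \<le> b" "g x = 0"
    using IVT'[of g a 0 b] * by (auto simp: g_def)
  moreover have "x \<noteq> a" "x \<noteq> b" using * \<open>g x = 0\<close> by (auto simp: g_def)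
  ultimately show "\<exists>x>a. x < b \<and> (\<Sum>k\<le>n. f k * x ^ k) = 0" unfolding g_def by force
qed

section \<open>Matching the roots of polynomials over two real closed fields\<close>

definition same_sign :: "'a::linordered_idom \<Rightarrow> 'b::linordered_idom \<Rightarrow> bool" where
  "same_sign a b \<longleftrightarrow> (0 < a \<longleftrightarrow> 0 < b) \<and> (a < 0 \<longleftrightarrow> b < 0)"

text \<open>\<open>t\<close> and \<open>u\<close> sit in corresponding places with respect to the
  pairs of \<open>Z\<close>: both on one pair, or in corresponding gaps.\<close>

definition same_cut :: "('a::linorder \<times> 'b::linorder) set \<Rightarrow> 'a \<Rightarrow> 'b \<Rightarrow> bool" where
  "same_cut Z t u \<longleftrightarrow> (\<forall>(x, y)\<in>Z. (x < t \<longleftrightarrow> y < u) \<and> (t < x \<longleftrightarrow> u < y))"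

text \<open>An order isomorphism between two finite sets, kept as its graph so that
  \<open>Z\<inverse>\<close> exchanges the two fields.\<close>

definition order_match :: "('a::linorder \<times> 'b::linorder) set \<Rightarrow> bool" where
  "order_match Z \<longleftrightarrow> finite Z \<and> (\<forall>(x, y)\<in>Z. same_cut Z x y)"

lemma same_sign_sym: "same_sign a b \<longleftrightarrow> same_sign b a"
  by (auto simp: same_sign_def)

lemma same_sign_zero: "same_sign a b \<Longrightarrow> a = 0 \<longleftrightarrow> b = 0"
  unfolding same_sign_def by (metis less_irrefl linorder_neqE_linordered_idom)

lemma same_sign_mult: "same_sign a b \<Longrightarrow> same_sign c d \<Longrightarrow> same_sign (a * c) (b * d)"
  using same_sign_zero[of a b] same_sign_zero[of c d]
  by (auto simp: same_sign_def zero_less_mult_iff mult_less_0_iff)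

lemma same_sign_trans_pos: "same_sign a b \<Longrightarrow> 0 < a * c \<Longrightarrow> 0 < b * d \<Longrightarrow> same_sign c d"
  by (auto simp: same_sign_def zero_less_mult_iff)

lemma same_cut_converse: "same_cut (Z\<inverse>) u t \<longleftrightarrow> same_cut Z t u"
  unfolding same_cut_def by fast

lemma order_match_converse: "order_match (Z\<inverse>) \<longleftrightarrow> order_match Z"
  unfolding order_match_def finite_converse
  using same_cut_converse[of Z] by blast

lemma same_cut_subset: "same_cut Z t u \<Longrightarrow> Y \<subseteq> Z \<Longrightarrow> same_cut Y t u"
  unfolding same_cut_def by blast

lemma order_match_subset: "order_match Z \<Longrightarrow> Y \<subseteq> Z \<Longrightarrow> order_match Y"
  unfolding order_match_def using finite_subset[of Y Z] same_cut_subset[of Z _ _ Y] by blast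

lemma order_matchI:
  assumes "finite Z" "\<And>x y s v. (x, y) \<in> Z \<Longrightarrow> (s, v) \<in> Z \<Longrightarrow> x < s \<longleftrightarrow> y < v"
  shows "order_match Z"
  unfolding order_match_def same_cut_def
proof (intro conjI ballI case_prodI2)
  fix z x y z' s v
  assume "z \<in> Z" "z = (x, y)" "z' \<in> Z" "z' = (s, v)"
  then have "(x, y) \<in> Z" "(s, v) \<in> Z" by auto
  then show "s < x \<longleftrightarrow> v < y" "x < s \<longleftrightarrow> y < v" using assms(2) by simp_all
qed (rule assms(1))

lemma order_matchD: "order_match Z \<Longrightarrow> (x, y) \<in> Z \<Longrightarrow> same_cut Z x y"
  unfolding order_match_def by blast

lemma same_cutD:
  assumes "same_cut Z t u" "(x, y) \<in> Z"
  shows "x < t \<longleftrightarrow> y < u" "t < x \<longleftrightarrow> u < y" "x = t \<longleftrightarrow> y = u" "x \<le> t \<longleftrightarrow> y \<le> u" "t \<le> x \<longleftrightarrow> u \<le> y"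
proof -
  show *: "x < t \<longleftrightarrow> y < u" "t < x \<longleftrightarrow> u < y" using assms by (auto simp: same_cut_def)
  show "x = t \<longleftrightarrow> y = u" using * by (metis less_irrefl neqE)
  show "x \<le> t \<longleftrightarrow> y \<le> u" "t \<le> x \<longleftrightarrow> u \<le> y" using * by (auto simp: not_less[symmetric])
qed

lemma between_finite:
  fixes L U :: "'a::linordered_field set"
  assumes "finite L" "finite U" "\<And>l u. l \<in> L \<Longrightarrow> u \<in> U \<Longrightarrow> l < u"
  shows "\<exists>m. (\<forall>l\<in>L. l < m) \<and> (\<forall>u\<in>U. m < u)"
proof -
  have L: "\<exists>m. \<forall>l\<in>L. l < m"
  proof (cases "L = {}")
    case False
    obtain m where "Max L < m" using gt_ex by blast
    then show ?thesis using False assms(1) by (intro exI[of _ m]) auto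
  qed auto
  have U: "\<exists>m. \<forall>u\<in>U. m < u"
  proof (cases "U = {}")
    case False
    obtain m where "m < Min U" using lt_ex by blast
    then show ?thesis using False assms(2) by (intro exI[of _ m]) auto
  qed auto
  show ?thesis
  proof (cases "L = {} \<or> U = {}")
    case True
    then show ?thesis using L U by auto
  next
    case False
    then have "Max L < Min U" using assms by simp
    then obtain m where "Max L < m" "m < Min U" using dense by blast
    then show ?thesis using assms False by (intro exI[of _ m]) auto
  qed
qed

text \<open>An ordered field is dense and has no end points, so every place relative to
  \<open>Z\<close> is occupied on the other side.\<close>

lemma same_cut_ex:
  fixes Z :: "('a::linorder \<times> 'b::linordered_field) set"
  assumes "order_match Z"
  shows "\<exists>u. same_cut Z t u"
proof (cases "t \<in> fst ` Z")
  case True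
  then show ?thesis using order_matchD[OF assms] by force
next
  case False
  define L where "L = snd ` {z \<in> Z. fst z < t}"
  define U where "U = snd ` {z \<in> Z. t < fst z}"
  have fin: "finite Z" using assms by (simp add: order_match_def)
  then have "finite L" "finite U" by (auto simp: L_def U_def)
  moreover have "l < u" if lu: "l \<in> L" "u \<in> U" for l u
  proof -
    from lu obtain x x' where *: "(x, l) \<in> Z" "x < t" "(x', u) \<in> Z" "t < x'"
      unfolding L_def U_def by auto
    then show ?thesis using same_cutD(1)[OF order_matchD[OF assms *(3)] *(1)] less_trans by blast
  qed
  ultimately obtain m where m: "\<forall>l\<in>L. l < m" "\<forall>u\<in>U. m < u" using between_finite by blast
  have lt: "y < m" if "(x, y) \<in> Z" "x < t" for x y using m(1) that by (force simp: L_def)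
  have gt: "m < y" if "(x, y) \<in> Z" "t < x" for x y using m(2) that by (force simp: U_def)
  have "same_cut Z t m"
    unfolding same_cut_def
  proof (intro ballI case_prodI2 conjI)
    fix z x y assume z: "z \<in> Z" "z = (x, y)"
    then have xy: "(x, y) \<in> Z" by simp
    then have "x \<noteq> t" using False by force
    then consider "x < t" | "t < x" by (rule linorder_neqE)
    then have "x < t \<and> y < m \<or> t < x \<and> m < y" using lt[OF xy] gt[OF xy] by cases simp_all
    then show "x < t \<longleftrightarrow> y < m" "t < x \<longleftrightarrow> m < y" by auto
  qed
  then show ?thesis ..
qed

lemma nearest_below:
  fixes Z :: "('a::linorder \<times> 'b) set"
  assumes "finite Z" "z \<in> Z" "fst z < t"
  obtains x y where "(x, y) \<in> Z" "x < t" "\<And>x' y'. (x', y') \<in> Z \<Longrightarrow> x' \<le> x \<or> t \<le> x'"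
proof -
  define M where "M = {x \<in> fst ` Z. x < t}"
  have "finite M" "M \<noteq> {}" using assms by (auto simp: M_def)
  then have M: "Max M \<in> M" "\<And>x. x \<in> M \<Longrightarrow> x \<le> Max M" by (rule Max_in) (simp add: \<open>finite M\<close>)
  then obtain y where y: "(Max M, y) \<in> Z" by (auto simp: M_def)
  show ?thesis
  proof (rule that[OF y])
    show "Max M < t" using M(1) by (simp add: M_def)
    show "x' \<le> Max M \<or> t \<le> x'" if "(x', y') \<in> Z" for x' y'
    proof (cases "x' < t")
      case True
      then have "x' \<in> M" using that by (force simp: M_def)
      then show ?thesis using M(2) by blast
    qed (simp add: not_less)
  qed
qed

lemma nearest_above:
  fixes Z :: "('a::linorder \<times> 'b) set"
  assumes "finite Z" "z \<in> Z" "t < fst z"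
  obtains x y where "(x, y) \<in> Z" "t < x" "\<And>x' y'. (x', y') \<in> Z \<Longrightarrow> x \<le> x' \<or> x' \<le> t"
proof -
  define M where "M = {x \<in> fst ` Z. t < x}"
  have "finite M" "M \<noteq> {}" using assms by (auto simp: M_def)
  then have M: "Min M \<in> M" "\<And>x. x \<in> M \<Longrightarrow> Min M \<le> x" by (rule Min_in) (simp add: \<open>finite M\<close>)
  then obtain y where y: "(Min M, y) \<in> Z" by (auto simp: M_def)
  show ?thesis
  proof (rule that[OF y])
    show "t < Min M" using M(1) by (simp add: M_def)
    show "Min M \<le> x' \<or> x' \<le> t" if "(x', y') \<in> Z" for x' y'
    proof (cases "t < x'")
      case True
      then have "x' \<in> M" using that by (force simp: M_def)
      then show ?thesis using M(2) by blast
    qed (simp add: not_less)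
  qed
qed

text \<open>The conditions are symmetric in the two fields,
  so that each statement about \<open>q\<close> yields the one
  about \<open>r\<close> by passing to \<open>Z\<inverse>\<close>. The last two make the outermost points of \<open>Z\<close> enclose all
  roots, so that only bounded intervals have to be considered.\<close>

definition critical_match ::
    "('a::real_closed_field \<times> 'b::real_closed_field) set \<Rightarrow> 'a poly \<Rightarrow> 'b poly \<Rightarrow> bool" where
  "critical_match Z q r \<longleftrightarrow> order_match Z
     \<and> (\<forall>(x, y)\<in>Z. same_sign (poly q x) (poly r y))
     \<and> (\<forall>x. poly (pderiv q) x = 0 \<longrightarrow> x \<in> fst ` Z)
     \<and> (\<forall>y. poly (pderiv r) y = 0 \<longrightarrow> y \<in> snd ` Z)
     \<and> (\<exists>(x, y)\<in>Z. (\<forall>t\<le>x. poly q t \<noteq> 0) \<and> (\<forall>u\<le>y. poly r u \<noteq> 0))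
     \<and> (\<exists>(x, y)\<in>Z. (\<forall>t\<ge>x. poly q t \<noteq> 0) \<and> (\<forall>u\<ge>y. poly r u \<noteq> 0))"

lemma critical_match_converseI:
  assumes "critical_match Z q r"
  shows "critical_match (Z\<inverse>) r q"
proof -
  have img: "fst ` (Z\<inverse>) = snd ` Z" "snd ` (Z\<inverse>) = fst ` Z" by force+
  have ss: "(x, y) \<in> Z\<inverse> \<Longrightarrow> same_sign (poly r x) (poly q y)" for x y
    using assms same_sign_sym[of "poly r x" "poly q y"] by (auto simp: critical_match_def)
  have lo: "\<exists>(x, y)\<in>Z\<inverse>. (\<forall>t\<le>x. poly r t \<noteq> 0) \<and> (\<forall>u\<le>y. poly q u \<noteq> 0)"
    and hi: "\<exists>(x, y)\<in>Z\<inverse>. (\<forall>t\<ge>x. poly r t \<noteq> 0) \<and> (\<forall>u\<ge>y. poly q u \<noteq> 0)"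
    using assms unfolding critical_match_def by blast+
  show ?thesis
    unfolding critical_match_def img order_match_converse
    using assms ss lo hi unfolding critical_match_def by blast
qed

lemma critical_match_converse: "critical_match (Z\<inverse>) r q \<longleftrightarrow> critical_match Z q r"
  using critical_match_converseI[of Z q r] critical_match_converseI[of "Z\<inverse>" r q] by auto

text \<open>Between the neighbours of \<open>t\<close> in \<open>Z\<close> there is no critical
  point, so \<open>q\<close> changes sign across the root. The signs at the neighbours are matched,
  hence \<open>r\<close> changes sign in the corresponding gap.\<close>

lemma critical_match_root:
  assumes cm: "critical_match Z q r" and root: "poly q t = 0"
  obtains u where "poly r u = 0" "same_cut Z t u"
proof (cases "t \<in> fst ` Z")
  case True
  then obtain y where y: "(t, y) \<in> Z" by auto
  with cm have "same_sign (poly q t) (poly r y)" "same_cut Z t y"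
    by (auto simp: critical_match_def order_match_def)
  then show ?thesis using that same_sign_zero root by blast
next
  case False
  have om: "order_match Z" and ss: "\<And>x y. (x, y) \<in> Z \<Longrightarrow> same_sign (poly q x) (poly r y)"
    and cr: "\<And>x. poly (pderiv q) x = 0 \<Longrightarrow> x \<in> fst ` Z"
    using cm by (auto simp: critical_match_def)
  have fin: "finite Z" using om by (simp add: order_match_def)
  obtain l l' where l: "(l, l') \<in> Z" "\<forall>t\<le>l. poly q t \<noteq> 0" using cm
    by (auto simp: critical_match_def)
  obtain h h' where h: "(h, h') \<in> Z" "\<forall>t\<ge>h. poly q t \<noteq> 0" using cm
    by (auto simp: critical_match_def)
  have "l < t" "t < h" using l(2) h(2) root by (meson not_le)+
  obtain a a' where a: "(a, a') \<in> Z" "a < t" "\<And>x y. (x, y) \<in> Z \<Longrightarrow> x \<le> a \<or> t \<le> x"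
    using nearest_below[OF fin l(1), of t] \<open>l < t\<close> by auto
  obtain b b' where b: "(b, b') \<in> Z" "t < b" "\<And>x y. (x, y) \<in> Z \<Longrightarrow> b \<le> x \<or> x \<le> t"
    using nearest_above[OF fin h(1), of t] \<open>t < h\<close> by auto
  have gap: "x \<le> a \<or> b \<le> x" if "(x, y) \<in> Z" for x y
    using a(3)[OF that] b(3)[OF that] that False by force
  have "poly q a * poly q b < 0"
    using cr gap by (intro rcf_sign_change_of_root[OF a(2) b(2) root]) force
  then have neg: "poly r a' * poly r b' < 0"
    using same_sign_mult[OF ss[OF a(1)] ss[OF b(1)]] by (simp add: same_sign_def)
  have "a' < b'" using same_cutD(1)[OF order_matchD[OF om b(1)] a(1)] a b by simp
  then obtain u where u: "a' < u" "u < b'" "poly r u = 0" using rcf_ivt neg by blast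
  have "same_cut Z t u"
    unfolding same_cut_def
  proof (intro ballI case_prodI2 conjI)
    fix z x y assume z: "z \<in> Z" "z = (x, y)"
    then have xy: "(x, y) \<in> Z" by simp
    have "x \<le> a \<longleftrightarrow> y \<le> a'" "b \<le> x \<longleftrightarrow> b' \<le> y"
      using same_cutD[OF order_matchD[OF om a(1)] xy] same_cutD[OF order_matchD[OF om b(1)] xy]
        by auto
    then have "x < t \<and> y < u \<or> t < x \<and> u < y" using gap[OF xy] a b u by auto
    then show "x < t \<longleftrightarrow> y < u" "t < x \<longleftrightarrow> u < y" by auto
  qed
  then show ?thesis using that u by blast
qed

text \<open>Rolle puts a critical point between two roots of \<open>q\<close>; it belongs to
  \<open>Z\<close> and therefore separates their partners as well.\<close>

lemma critical_match_mono:
  assumes cm: "critical_match Z q r" and t: "poly q t = 0" "same_cut Z t u"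
    and s: "poly q s = 0" "same_cut Z s v" and less: "t < s"
  shows "u < v"
proof -
  obtain x where x: "t < x" "x < s" "poly (pderiv q) x = 0" using rcf_rolle[OF less t(1) s(1)]
    by blast
  then obtain y where "(x, y) \<in> Z" using cm by (force simp: critical_match_def)
  then show ?thesis using same_cutD[OF t(2)] same_cutD[OF s(2)] x by force
qed

text \<open>Two roots are paired when they lie in the same gap. This is unambiguous, as critical
  points separate roots and each gap holds at most one.\<close>

definition merge_roots ::
    "('a::real_closed_field \<times> 'b::real_closed_field) set \<Rightarrow> 'a poly \<Rightarrow> 'b poly \<Rightarrow> ('a \<times> 'b) set" where
  "merge_roots Z q r = Z \<union> {(t, u). poly q t = 0 \<and> poly r u = 0 \<and> same_cut Z t u}"

lemma order_match_merge_roots: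
  assumes cm: "critical_match Z q r"
  shows "order_match (merge_roots Z q r)"
proof -
  have om: "order_match Z" using cm by (simp add: critical_match_def)
  obtain l l' where "\<forall>t\<le>l. poly q t \<noteq> 0" "\<forall>u\<le>l'. poly r u \<noteq> 0"
    using cm unfolding critical_match_def by blast
  then have nz: "q \<noteq> 0" "r \<noteq> 0" using poly_0 order_refl by metis+
  let ?N = "{(t, u). poly q t = 0 \<and> poly r u = 0 \<and> same_cut Z t u}"
  have "?N \<subseteq> {t. poly q t = 0} \<times> {u. poly r u = 0}" by auto
  then have "finite ?N" by (rule finite_subset) (intro finite_cartesian_product poly_roots_finite
    nz)
  then have "finite (merge_roots Z q r)" using om by (simp add: merge_roots_def order_match_def)
  moreover have "x < s \<longleftrightarrow> y < v"
    if xy: "(x, y) \<in> merge_roots Z q r" and sv: "(s, v) \<in> merge_roots Z q r" for x y s v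
  proof -
    have cut: "same_cut Z x y" "same_cut Z s v"
      using xy sv order_matchD[OF om] by (auto simp: merge_roots_def)
    consider "(x, y) \<in> Z" | "(s, v) \<in> Z"
      | "poly q x = 0" "poly r y = 0" "poly q s = 0" "poly r v = 0"
      using xy sv by (auto simp: merge_roots_def)
    then show ?thesis
    proof cases
      case 1
      show ?thesis by (rule same_cutD(1)[OF cut(2) 1])
    next
      case 2
      show ?thesis by (rule same_cutD(2)[OF cut(1) 2])
    next
      case 3
      have "x < s \<Longrightarrow> y < v" using critical_match_mono[OF cm 3(1) cut(1) 3(3) cut(2)] .
      moreover have "y < v \<Longrightarrow> x < s"
        using critical_match_mono[of "Z\<inverse>" r q y x v s] cm 3 cut
        by (simp add: critical_match_converse same_cut_converse)
      ultimately show ?thesis by blast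
    qed
  qed
  ultimately show ?thesis by (rule order_matchI)
qed

text \<open>Every root of \<open>q\<close> or of \<open>r\<close> has a partner and so belongs to
  the merged matching. None lies between the neighbour and the given point on either side, and the
  sign at the neighbour propagates.\<close>

lemma critical_match_sign_below:
  assumes cm: "critical_match Z q r" and tu: "same_cut (merge_roots Z q r) t u"
    and ab: "(a, b) \<in> merge_roots Z q r" "a < t" "poly q a \<noteq> 0"
    and gap: "\<And>x y. (x, y) \<in> merge_roots Z q r \<Longrightarrow> x \<le> a \<or> t < x"
  shows "same_sign (poly q t) (poly r u)"
proof -
  have om: "order_match (merge_roots Z q r)" by (rule order_match_merge_roots[OF cm])
  have ab': "(a, b) \<in> Z" using ab by (auto simp: merge_roots_def)
  then have ss: "same_sign (poly q a) (poly r b)" using cm by (auto simp: critical_match_def)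
  have "b < u" using same_cutD(1)[OF tu ab(1)] ab by simp
  have "0 < poly q a * poly q t"
  proof (rule rcf_const_sign)
    fix x assume x: "a \<le> x" "x \<le> t"
    show "poly q x \<noteq> 0"
    proof
      assume 0: "poly q x = 0"
      then obtain y where "(x, y) \<in> merge_roots Z q r"
        using critical_match_root[OF cm 0] by (auto simp: merge_roots_def)
      then show False using gap x ab 0 by fastforce
    qed
  qed (use ab in auto)
  moreover have "0 < poly r b * poly r u"
  proof (rule rcf_const_sign)
    fix y assume y: "b \<le> y" "y \<le> u"
    show "poly r y \<noteq> 0"
    proof
      assume 0: "poly r y = 0"
      obtain x where x: "poly q x = 0" "same_cut (Z\<inverse>) y x"
        using critical_match_root[of "Z\<inverse>" r q y] cm 0 by (auto simp: critical_match_converse)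
      then have xy: "(x, y) \<in> merge_roots Z q r" using 0
        by (simp add: merge_roots_def same_cut_converse)
      then have "x \<le> a \<or> t < x" using gap by blast
      then have "y \<le> b \<or> u < y"
        using same_cutD(2)[OF tu xy] same_cutD(4)[OF order_matchD[OF om ab(1)] xy] by blast
      then have "y = b" using y by auto
      then show False using 0 ss ab same_sign_zero by blast
    qed
  qed (use \<open>b < u\<close> in auto)
  ultimately show ?thesis using same_sign_trans_pos[OF ss] by blast
qed

text \<open>The mirror image, for the cases where the neighbour below is a root of \<open>q\<close>
  or does not exist.\<close>

lemma critical_match_sign_above:
  assumes cm: "critical_match Z q r" and tu: "same_cut (merge_roots Z q r) t u"
    and ab: "(a, b) \<in> merge_roots Z q r" "t < a" "poly q a \<noteq> 0"
    and gap: "\<And>x y. (x, y) \<in> merge_roots Z q r \<Longrightarrow> a \<le> x \<or> x < t"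
  shows "same_sign (poly q t) (poly r u)"
proof -
  have om: "order_match (merge_roots Z q r)" by (rule order_match_merge_roots[OF cm])
  have ab': "(a, b) \<in> Z" using ab by (auto simp: merge_roots_def)
  then have ss: "same_sign (poly q a) (poly r b)" using cm by (auto simp: critical_match_def)
  have "u < b" using same_cutD(2)[OF tu ab(1)] ab by simp
  have "0 < poly q t * poly q a"
  proof (rule rcf_const_sign)
    fix x assume x: "t \<le> x" "x \<le> a"
    show "poly q x \<noteq> 0"
    proof
      assume 0: "poly q x = 0"
      then obtain y where "(x, y) \<in> merge_roots Z q r"
        using critical_match_root[OF cm 0] by (auto simp: merge_roots_def)
      then show False using gap x ab 0 by fastforce
    qed
  qed (use ab in auto)
  moreover have "0 < poly r u * poly r b"
  proof (rule rcf_const_sign)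
    fix y assume y: "u \<le> y" "y \<le> b"
    show "poly r y \<noteq> 0"
    proof
      assume 0: "poly r y = 0"
      obtain x where x: "poly q x = 0" "same_cut (Z\<inverse>) y x"
        using critical_match_root[of "Z\<inverse>" r q y] cm 0 by (auto simp: critical_match_converse)
      then have xy: "(x, y) \<in> merge_roots Z q r" using 0
        by (simp add: merge_roots_def same_cut_converse)
      then have "a \<le> x \<or> x < t" using gap by blast
      then have "b \<le> y \<or> y < u"
        using same_cutD(1)[OF tu xy] same_cutD(5)[OF order_matchD[OF om ab(1)] xy] by blast
      then have "y = b" using y by auto
      then show False using 0 ss ab same_sign_zero by blast
    qed
  qed (use \<open>u < b\<close> in auto)
  ultimately show ?thesis using same_sign_trans_pos[OF ss] by (metis mult.commute)
qed

text \<open>At least one neighbour is not a root of \<open>q\<close>: between two neighbouring roots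
  Rolle would give a critical point, which is itself a point of the matching. Below or above all
  points, the enclosing pairs of \<open>critical_match\<close> help.\<close>

lemma critical_match_same_sign:
  assumes cm: "critical_match Z q r" and tu: "same_cut (merge_roots Z q r) t u"
  shows "same_sign (poly q t) (poly r u)"
proof (cases "t \<in> fst ` merge_roots Z q r")
  case True
  then obtain y where y: "(t, y) \<in> merge_roots Z q r" by auto
  then have "y = u" using same_cutD(3)[OF tu y] by simp
  then show ?thesis using y cm by (auto simp: merge_roots_def critical_match_def same_sign_def)
next
  case False
  let ?M = "merge_roots Z q r"
  have fin: "finite ?M" using order_match_merge_roots[OF cm] by (simp add: order_match_def)
  obtain l l' where l: "(l, l') \<in> Z" "\<forall>t\<le>l. poly q t \<noteq> 0" using cm
    by (auto simp: critical_match_def)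
  obtain h h' where h: "(h, h') \<in> Z" "\<forall>t\<ge>h. poly q t \<noteq> 0" using cm
    by (auto simp: critical_match_def)
  have lM: "(l, l') \<in> ?M" and hM: "(h, h') \<in> ?M" using l h by (auto simp: merge_roots_def)
  have tl: "x \<noteq> t" if "(x, y) \<in> ?M" for x y using False that by force
  show ?thesis
  proof (cases "\<exists>a b. (a, b) \<in> ?M \<and> a < t")
    case True
    then obtain z where z: "z \<in> ?M" "fst z < t" by auto
    obtain a b where ab: "(a, b) \<in> ?M" "a < t" "\<And>x y. (x, y) \<in> ?M \<Longrightarrow> x \<le> a \<or> t \<le> x"
      using nearest_below[OF fin z] by blast
    show ?thesis
    proof (cases "poly q a = 0")
      case False
      then show ?thesis using critical_match_sign_below[OF cm tu ab(1,2)] ab(3) tl by force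
    next
      case True
      then have "a < h" using h by (metis not_le)
      then have "t < h" using ab(3)[OF hM] tl[OF hM] by auto
      then obtain c d where cd: "(c, d) \<in> ?M" "t < c" "\<And>x y. (x, y) \<in> ?M \<Longrightarrow> c \<le> x \<or> x \<le> t"
        using nearest_above[OF fin hM] by auto
      have "poly q c \<noteq> 0"
      proof
        assume "poly q c = 0"
        then obtain x where x: "a < x" "x < c" "poly (pderiv q) x = 0"
          using rcf_rolle[of a c q] ab cd True by auto
        then obtain y where "(x, y) \<in> ?M" using cm
          by (force simp: critical_match_def merge_roots_def)
        then show False using ab(3) cd(3) tl x by force
      qed
      then show ?thesis using critical_match_sign_above[OF cm tu cd(1,2)] cd(3) tl by force
    qed
  next
    case False
    have "t < l" using False lM tl[OF lM] by (meson linorder_neqE)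
    then obtain c d where cd: "(c, d) \<in> ?M" "t < c" "\<And>x y. (x, y) \<in> ?M \<Longrightarrow> c \<le> x \<or> x \<le> t"
      using nearest_above[OF fin lM] by auto
    have "c \<le> l" using cd(3)[OF lM] \<open>t < l\<close> by auto
    then have "poly q c \<noteq> 0" using l by auto
    then show ?thesis using critical_match_sign_above[OF cm tu cd(1,2)] cd(3) tl by force
  qed
qed

section \<open>Elimination of one variable\<close>

definition is_hom :: "('c::comm_ring_1 \<Rightarrow> 'a::comm_ring_1) \<Rightarrow> bool" where
  "is_hom \<phi> \<longleftrightarrow> \<phi> 1 = 1 \<and> (\<forall>x y. \<phi> (x + y) = \<phi> x + \<phi> y) \<and> (\<forall>x y. \<phi> (x * y) = \<phi> x * \<phi> y)"

definition is_subring :: "'c::comm_ring_1 set \<Rightarrow> bool" where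
  "is_subring C \<longleftrightarrow> 1 \<in> C \<and> (\<forall>x\<in>C. \<forall>y\<in>C. x - y \<in> C \<and> x * y \<in> C)"

definition coeffs_in :: "'c::comm_ring_1 set \<Rightarrow> 'c poly \<Rightarrow> bool" where
  "coeffs_in C p \<longleftrightarrow> (\<forall>i. coeff p i \<in> C)"

lemma is_hom_1: "is_hom \<phi> \<Longrightarrow> \<phi> 1 = 1"
  and is_hom_add: "is_hom \<phi> \<Longrightarrow> \<phi> (x + y) = \<phi> x + \<phi> y"
  and is_hom_mult: "is_hom \<phi> \<Longrightarrow> \<phi> (x * y) = \<phi> x * \<phi> y"
  by (auto simp: is_hom_def)

lemma is_hom_0: "is_hom \<phi> \<Longrightarrow> \<phi> 0 = 0"
  using is_hom_add[of \<phi> 0 0] by simp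

lemma is_hom_minus: "is_hom \<phi> \<Longrightarrow> \<phi> (- x) = - \<phi> x"
  using is_hom_add[of \<phi> x "- x"] by (simp add: is_hom_0 eq_neg_iff_add_eq_0 add.commute)

lemma is_hom_diff: "is_hom \<phi> \<Longrightarrow> \<phi> (x - y) = \<phi> x - \<phi> y"
  using is_hom_add[of \<phi> x "- y"] by (simp add: is_hom_minus)

lemma is_hom_of_nat: "is_hom \<phi> \<Longrightarrow> \<phi> (of_nat n) = of_nat n"
  by (induction n) (simp_all add: is_hom_0 is_hom_1 is_hom_add)

lemma is_hom_power: "is_hom \<phi> \<Longrightarrow> \<phi> (x ^ n) = \<phi> x ^ n"
  by (induction n) (simp_all add: is_hom_1 is_hom_mult)

lemma is_hom_sum: "is_hom \<phi> \<Longrightarrow> \<phi> (sum f A) = (\<Sum>i\<in>A. \<phi> (f i))"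
  by (induction A rule: infinite_finite_induct) (simp_all add: is_hom_0 is_hom_add)

lemmas is_hom_simps = is_hom_0 is_hom_1 is_hom_add is_hom_mult is_hom_minus is_hom_diff
  is_hom_of_nat is_hom_power

lemma map_poly_hom_add: "is_hom \<phi> \<Longrightarrow> map_poly \<phi> (p + q) = map_poly \<phi> p + map_poly \<phi> q"
  by (rule poly_eqI) (simp add: coeff_map_poly is_hom_simps)

lemma map_poly_hom_diff: "is_hom \<phi> \<Longrightarrow> map_poly \<phi> (p - q) = map_poly \<phi> p - map_poly \<phi> q"
  by (rule poly_eqI) (simp add: coeff_map_poly is_hom_simps)

lemma map_poly_hom_mult: "is_hom \<phi> \<Longrightarrow> map_poly \<phi> (p * q) = map_poly \<phi> p * map_poly \<phi> q"
  by (rule poly_eqI) (simp add: coeff_map_poly is_hom_simps coeff_mult is_hom_sum)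

lemma map_poly_hom_smult: "is_hom \<phi> \<Longrightarrow> map_poly \<phi> (smult c p) = smult (\<phi> c) (map_poly \<phi> p)"
  by (rule poly_eqI) (simp add: coeff_map_poly is_hom_simps)

lemma map_poly_hom_pderiv: "is_hom \<phi> \<Longrightarrow> map_poly \<phi> (pderiv p) = pderiv (map_poly \<phi> p)"
  by (rule poly_eqI) (simp add: coeff_map_poly is_hom_simps coeff_pderiv del: of_nat_Suc)

lemma is_subring_0: "is_subring C \<Longrightarrow> 0 \<in> C"
  unfolding is_subring_def by (metis diff_self)

lemma is_subring_diff: "is_subring C \<Longrightarrow> x \<in> C \<Longrightarrow> y \<in> C \<Longrightarrow> x - y \<in> C"
  and is_subring_mult: "is_subring C \<Longrightarrow> x \<in> C \<Longrightarrow> y \<in> C \<Longrightarrow> x * y \<in> C"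
  unfolding is_subring_def by blast+

lemma is_subring_add: "is_subring C \<Longrightarrow> x \<in> C \<Longrightarrow> y \<in> C \<Longrightarrow> x + y \<in> C"
  using is_subring_diff[of C x "0 - y"] is_subring_diff[of C 0 y] is_subring_0[of C] by simp

lemma is_subring_sum: "is_subring C \<Longrightarrow> (\<And>i. i \<in> A \<Longrightarrow> f i \<in> C) \<Longrightarrow> sum f A \<in> C"
  by (induction A rule: infinite_finite_induct) (auto simp: is_subring_0 is_subring_add)

lemma is_subring_of_nat: "is_subring C \<Longrightarrow> of_nat n \<in> C"
  by (induction n) (auto simp: is_subring_0 intro: is_subring_add,
    auto simp: is_subring_def intro: is_subring_add)

lemma coeffs_in_add: "is_subring C \<Longrightarrow> coeffs_in C p \<Longrightarrow> coeffs_in C q \<Longrightarrow> coeffs_in C (p + q)"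
  by (simp add: coeffs_in_def is_subring_add)

lemma coeffs_in_diff: "is_subring C \<Longrightarrow> coeffs_in C p \<Longrightarrow> coeffs_in C q \<Longrightarrow> coeffs_in C (p - q)"
  by (simp add: coeffs_in_def is_subring_diff)

lemma coeffs_in_mult: "is_subring C \<Longrightarrow> coeffs_in C p \<Longrightarrow> coeffs_in C q \<Longrightarrow> coeffs_in C (p * q)"
  by (simp add: coeffs_in_def coeff_mult is_subring_sum is_subring_mult)

lemma coeffs_in_smult: "is_subring C \<Longrightarrow> c \<in> C \<Longrightarrow> coeffs_in C q \<Longrightarrow> coeffs_in C (smult c q)"
  by (simp add: coeffs_in_def is_subring_mult)

lemma coeffs_in_monom: "is_subring C \<Longrightarrow> c \<in> C \<Longrightarrow> coeffs_in C (monom c n)"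
  by (simp add: coeffs_in_def is_subring_0)

lemma coeffs_in_pderiv: "is_subring C \<Longrightarrow> coeffs_in C p \<Longrightarrow> coeffs_in C (pderiv p)"
  unfolding coeffs_in_def coeff_pderiv by (blast intro: is_subring_mult is_subring_of_nat)

text \<open>Multiplying by the leading coefficient at each step avoids division, so the remainder
  keeps its coefficients in \<open>C\<close>; the price is a power of that coefficient, whose sign
  is under control later.\<close>

lemma pseudo_remainder:
  fixes p q :: "'c::comm_ring_1 poly"
  assumes C: "is_subring C" "coeffs_in C p" "coeffs_in C q" and q: "degree q > 0"
  shows "\<exists>k a r. smult (lead_coeff q ^ k) p = a * q + r \<and> degree r < degree q \<and> coeffs_in C r"
  using C(2)
proof (induction "degree p" arbitrary: p rule: less_induct)
  case less
  show ?case
  proof (cases "degree p < degree q")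
    case True
    then show ?thesis using less.prems by (intro exI[of _ 0] exI[of _ p]) auto
  next
    case False
    define n m where "n = degree p" and "m = degree q"
    have nm: "m \<le> n" "0 < m" using False q by (auto simp: n_def m_def)
    define t where "t = monom (lead_coeff p) (n - m) * q"
    define p' where "p' = smult (lead_coeff q) p - t"
    have "degree t \<le> (n - m) + m"
      unfolding t_def m_def by (rule order_trans[OF degree_mult_le]) (simp add: degree_monom_le)
    then have "degree p' \<le> n" unfolding p'_def
      using nm by (intro degree_diff_le) (auto simp: n_def degree_smult_le)
    moreover have "coeff p' n = 0"
      using nm by (simp add: p'_def t_def coeff_monom_mult n_def m_def)
    ultimately have "degree p' < degree p"
      using eq_zero_or_degree_less[of p' n] nm by (auto simp: n_def)
    moreover have "coeffs_in C p'"
      unfolding p'_def t_def using C(1,3) less.prems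
      by (intro coeffs_in_diff coeffs_in_smult coeffs_in_mult coeffs_in_monom) (auto simp:
        coeffs_in_def)
    ultimately obtain k a r where kar: "smult (lead_coeff q ^ k) p' = a * q + r"
      "degree r < degree q" "coeffs_in C r"
      using less.hyps by blast
    have "smult (lead_coeff q ^ Suc k) p = smult (lead_coeff q ^ k) p' + smult (lead_coeff q ^ k) t"
      by (simp add: p'_def smult_diff_right mult.commute)
    also have "\<dots> = (a + smult (lead_coeff q ^ k) (monom (lead_coeff p) (n - m))) * q + r"
      by (simp add: kar(1) t_def algebra_simps)
    finally show ?thesis using kar(2,3) by blast
  qed
qed

section \<open>Sign tables shared by two homomorphisms\<close>

definition agree :: "'c::comm_ring_1 set \<Rightarrow> ('c \<Rightarrow> 'a::linordered_idom) \<Rightarrow> ('c \<Rightarrow> 'b::linordered_idom)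
  \<Rightarrow> bool" where
  "agree T \<phi> \<psi> \<longleftrightarrow> (\<forall>c\<in>T. same_sign (\<phi> c) (\<psi> c))"

text \<open>A common sign table of \<open>S\<close>: the pairs of \<open>Z\<close> cut both lines
  into cells, and the signs depend on the cell alone, since each point has a partner in the
  corresponding cell.\<close>

definition sign_match_via ::
    "('a \<times> 'b) set \<Rightarrow> ('c::comm_ring_1 \<Rightarrow> 'a::real_closed_field) \<Rightarrow> ('c \<Rightarrow> 'b::real_closed_field) \<Rightarrow> 'c
      poly set \<Rightarrow> bool" where
  "sign_match_via Z \<phi> \<psi> S \<longleftrightarrow> order_match Z \<and>
     (\<forall>t u. same_cut Z t u \<longrightarrow> (\<forall>p\<in>S. same_sign (poly (map_poly \<phi> p) t) (poly (map_poly \<psi> p) u)))"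

text \<open>A root outside \<open>Z\<close> would share its cell with a whole interval to its left;
  the sign is constant on cells, so \<open>f\<close> would have infinitely many roots.\<close>

lemma root_in_match:
  fixes f :: "'a::linordered_field poly" and Z :: "('a \<times> 'b::linordered_field) set"
  assumes Z: "order_match Z" and s: "\<And>t u. same_cut Z t u \<Longrightarrow> same_sign (poly f t) (g u)"
    and f: "f \<noteq> 0" "poly f z = 0"
  shows "z \<in> fst ` Z"
proof (rule ccontr)
  assume nz: "z \<notin> fst ` Z"
  obtain u where u: "same_cut Z z u" using same_cut_ex[OF Z] by blast
  have "finite {x \<in> fst ` Z. x < z}" using Z by (simp add: order_match_def)
  then obtain m where m: "\<forall>l\<in>{x \<in> fst ` Z. x < z}. l < m" "\<forall>u\<in>{z}. m < u"
    using between_finite[of "{x \<in> fst ` Z. x < z}" "{z}"] by blast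
  have "{m<..<z} \<subseteq> {t. poly f t = 0}"
  proof
    fix t assume t: "t \<in> {m<..<z}"
    have "same_cut Z t u"
      unfolding same_cut_def
    proof (intro ballI case_prodI2)
      fix w x y assume w: "w \<in> Z" "w = (x, y)"
      then have xy: "(x, y) \<in> Z" "x \<in> fst ` Z" by force+
      have c: "x < z \<longleftrightarrow> y < u" "z < x \<longleftrightarrow> u < y" using same_cutD[OF u xy(1)] by auto
      have "x \<noteq> z" using xy nz by auto
      then consider "x < z" | "z < x" by (rule linorder_neqE)
      then show "(x < t \<longleftrightarrow> y < u) \<and> (t < x \<longleftrightarrow> u < y)"
      proof cases
        case 1
        then have "x < m" using m(1) xy by blast
        then have "x < t" using t by simp
        moreover have "y < u" using 1 c by blast
        ultimately show ?thesis by (simp add: less_not_sym)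
      next
        case 2
        then have "t < x" using t by simp
        moreover have "u < y" using 2 c by blast
        ultimately show ?thesis by (simp add: less_not_sym)
      qed
    qed
    then show "t \<in> {t. poly f t = 0}"
      using same_sign_zero[OF s[of t u]] same_sign_zero[OF s[OF u]] f(2) by simp
  qed
  moreover have "infinite {m<..<z}" using m(2) by (simp add: infinite_Ioo)
  ultimately show False using poly_roots_finite[OF f(1)] finite_subset by blast
qed

lemma order_match_insert:
  assumes Z: "order_match Z" and bc: "same_cut Z b c"
  shows "order_match (insert (b, c) Z)"
proof (rule order_matchI)
  show "finite (insert (b, c) Z)" using Z by (simp add: order_match_def)
  fix x y s v assume *: "(x, y) \<in> insert (b, c) Z" "(s, v) \<in> insert (b, c) Z"
  then consider "(x, y) = (b, c)" "(s, v) = (b, c)" | "(x, y) = (b, c)" "(s, v) \<in> Z"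
    | "(x, y) \<in> Z" "(s, v) = (b, c)" | "(x, y) \<in> Z" "(s, v) \<in> Z" by auto
  then show "x < s \<longleftrightarrow> y < v"
  proof cases
    case 2
    then show ?thesis using same_cutD(2)[OF bc] by simp
  next
    case 3
    then show ?thesis using same_cutD(1)[OF bc] by simp
  next
    case 4
    then show ?thesis using same_cutD(1)[OF order_matchD[OF Z]] by blast
  qed simp
qed

lemma poly_sign_bound:
  fixes q :: "'a::linordered_field poly"
  assumes "q \<noteq> 0" "finite F"
  obtains B where "0 < B" "\<And>x. x \<in> F \<Longrightarrow> -B < x \<and> x < B"
    "\<And>t. t \<ge> B \<Longrightarrow> 0 < poly q t * lead_coeff q"
    "\<And>t. t \<le> -B \<Longrightarrow> 0 < poly q t * (lead_coeff q * (-1) ^ degree q)"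
proof -
  have pos: "0 < a * l" if "\<bar>l\<bar> \<le> a * sgn l" "l \<noteq> 0" for a l :: 'a
  proof -
    have "0 < a * sgn l" using that by (metis less_le_trans zero_less_abs_iff)
    then show ?thesis using that(2) by (auto simp: sgn_if zero_less_mult_iff split: if_splits)
  qed
  obtain B1 where B1: "\<And>x. x \<ge> B1 \<Longrightarrow> poly q x * sgn (lead_coeff q) \<ge> \<bar>lead_coeff q\<bar>"
    using poly_sign_at_top[of q] by blast
  obtain B2 where B2: "\<And>x. x \<le> -B2 \<Longrightarrow> poly q x * sgn (lead_coeff q) * (-1) ^ degree q \<ge> \<bar>lead_coeff
    q\<bar>"
    using poly_sign_at_bot[of q] by blast
  define M where "M = {1, B1, B2} \<union> abs ` F"
  have "finite M" using assms(2) by (simp add: M_def)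
  then obtain B where B: "\<forall>m\<in>M. m < B" using between_finite[of M "{}"] by auto
  show ?thesis
  proof
    have "1 < B" "B1 < B" "B2 < B" using B by (auto simp: M_def)
    then show "0 < B" using less_trans zero_less_one by blast
    show "-B < x \<and> x < B" if "x \<in> F" for x using B that by (force simp: M_def abs_less_iff)
    show "0 < poly q t * lead_coeff q" if "t \<ge> B" for t
      using B1[of t] that \<open>B1 < B\<close> assms(1) by (intro pos) auto
    show "0 < poly q t * (lead_coeff q * (-1) ^ degree q)" if "t \<le> -B" for t
    proof -
      have "0 < poly q t * (-1) ^ degree q * lead_coeff q"
        using B2[of t] that \<open>B2 < B\<close> assms(1) by (intro pos) (auto simp: mult_ac)
      then show ?thesis by (simp add: mult_ac)
    qed
  qed
qed

lemma sign_match_via_converse: "sign_match_via (Z\<inverse>) \<psi> \<phi> S \<longleftrightarrow> sign_match_via Z \<phi> \<psi> S"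
  unfolding sign_match_via_def order_match_converse same_cut_converse
  using same_sign_sym by blast

lemma sign_match_viaD:
  assumes "sign_match_via Z \<phi> \<psi> S" "same_cut Z t u" "p \<in> S"
  shows "same_sign (poly (map_poly \<phi> p) t) (poly (map_poly \<psi> p) u)"
  using assms by (simp add: sign_match_via_def)

lemma poly_map_poly_const:
  assumes "degree p = 0"
  shows "poly (map_poly \<phi> p) t = poly (map_poly \<phi> p) s"
proof -
  have "degree (map_poly \<phi> p) = 0" using map_poly_degree_leq[of \<phi> p] assms by simp
  then obtain c where "map_poly \<phi> p = [:c:]" by (rule degree_eq_zeroE)
  then show ?thesis by simp
qed

text \<open>Discards the pairs at which no nonconstant member of \<open>S\<close> vanishes. At those
  pairs no pseudo-remainder would reveal the sign of a new polynomial.\<close>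

lemma sign_match_via_restrict:
  fixes \<phi> :: "'c::idom \<Rightarrow> 'a::real_closed_field" and \<psi> :: "'c \<Rightarrow> 'b::real_closed_field"
  assumes sm: "sign_match_via Z \<phi> \<psi> S"
    and nz: "\<And>p. p \<in> S \<Longrightarrow> degree p > 0 \<Longrightarrow> map_poly \<psi> p \<noteq> 0"
    and Y: "Y = {(x, y) \<in> Z. \<exists>p\<in>S. degree p > 0 \<and> poly (map_poly \<phi> p) x = 0}"
  shows "sign_match_via Y \<phi> \<psi> S"
proof -
  have om: "order_match Z" using sm by (simp add: sign_match_via_def)
  have YZ: "Y \<subseteq> Z" using Y by auto
  have "same_sign (poly (map_poly \<phi> p) t) (poly (map_poly \<psi> p) u)"
    if tu: "same_cut Y t u" and p: "p \<in> S" for t u p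
  proof -
    \<comment> \<open>\<open>v\<close> is a partner of \<open>t\<close> for the finer matching. It
      shares with \<open>u\<close> a cell of \<open>Y\<close>, in which no nonconstant
      \<open>p\<close> has a root, unless \<open>t\<close> itself is in \<open>Y\<close>.\<close>
    obtain v where v: "same_cut Z t v" using same_cut_ex[OF om] by blast
    have ss: "same_sign (poly (map_poly \<phi> p) t) (poly (map_poly \<psi> p) v)"
      by (rule sign_match_viaD[OF sm v p])
    show ?thesis
    proof (cases "degree p = 0")
      case True
      then show ?thesis using ss poly_map_poly_const[of p \<psi> u v] by simp
    next
      case False
      show ?thesis
      proof (cases "t \<in> fst ` Y")
        case True
        then obtain y where y: "(t, y) \<in> Y" by auto
        then have "y = u" "y = v" using same_cutD(3)[OF tu y] same_cutD(3)[OF v] YZ by auto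
        then show ?thesis using ss by simp
      next
        case tY: False
        have noroot: "poly (map_poly \<psi> p) y \<noteq> 0" if y: "min u v \<le> y" "y \<le> max u v" for y
        proof
          assume 0: "poly (map_poly \<psi> p) y = 0"
          have "y \<in> fst ` (Z\<inverse>)"
          proof (rule root_in_match)
            show "order_match (Z\<inverse>)" using om by (simp add: order_match_converse)
            show "same_sign (poly (map_poly \<psi> p) s) (poly (map_poly \<phi> p) r)"
              if "same_cut (Z\<inverse>) s r" for s r
              using sign_match_viaD[OF sm _ p, of r s] that same_sign_sym same_cut_converse by blast
            show "map_poly \<psi> p \<noteq> 0" using nz p False by simp
          qed (rule 0)
          then obtain x where xy: "(x, y) \<in> Z" by auto
          have "same_sign (poly (map_poly \<phi> p) x) (poly (map_poly \<psi> p) y)"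
            by (rule sign_match_viaD[OF sm order_matchD[OF om xy] p])
          then have "poly (map_poly \<phi> p) x = 0" using 0 same_sign_zero by blast
          then have xyY: "(x, y) \<in> Y" using Y xy p False by auto
          then have "x \<noteq> t" using tY by force
          then have "x < t \<and> y < u \<and> y < v \<or> t < x \<and> u < y \<and> v < y"
            using same_cutD[OF tu xyY] same_cutD[OF v xy] by (meson linorder_neqE)
          then show False using y by auto
        qed
        have "0 < poly (map_poly \<psi> p) (min u v) * poly (map_poly \<psi> p) (max u v)"
          by (rule rcf_const_sign) (use noroot in auto)
        then have "0 < poly (map_poly \<psi> p) v * poly (map_poly \<psi> p) u"
          by (cases "u \<le> v") (auto simp: min_def max_def mult.commute)
        then show ?thesis using ss by (auto simp: same_sign_def zero_less_mult_iff)
      qed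
    qed
  qed
  moreover have "order_match Y" by (rule order_match_subset[OF om YZ])
  ultimately show ?thesis by (simp add: sign_match_via_def)
qed

lemma sign_match_via_root:
  assumes sm: "sign_match_via Z \<phi> \<psi> S" and p: "p \<in> S" "degree p > 0" "map_poly \<phi> p \<noteq> 0"
    and x: "poly (map_poly \<phi> p) x = 0"
  shows "x \<in> fst ` {(x, y) \<in> Z. \<exists>p\<in>S. degree p > 0 \<and> poly (map_poly \<phi> p) x = 0}"
proof -
  have "x \<in> fst ` Z"
  proof (rule root_in_match)
    show "order_match Z" using sm by (simp add: sign_match_via_def)
    show "same_sign (poly (map_poly \<phi> p) t) (poly (map_poly \<psi> p) u)" if "same_cut Z t u" for t u
      using sign_match_viaD[OF sm that p(1)] .
  qed (use p x in auto)
  then show ?thesis using p x by force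
qed

lemma same_sign_power: "same_sign a b \<Longrightarrow> same_sign (a ^ k) (b ^ k)"
  by (induction k) (auto intro: same_sign_mult, simp add: same_sign_def)

lemma same_sign_mult_cancel:
  "same_sign (a * c) (b * d) \<Longrightarrow> same_sign a b \<Longrightarrow> a \<noteq> 0 \<Longrightarrow> same_sign c d"
  by (auto simp: same_sign_def zero_less_mult_iff mult_less_0_iff linorder_neq_iff)

text \<open>At a common root of \<open>p\<close> the division identity becomes
  \<open>b ^ k * q = r\<close>, and the signs of the powers of \<open>b\<close> agree.\<close>

lemma pseudo_remainder_sign:
  assumes h: "is_hom \<phi>" "is_hom \<psi>"
    and rem: "smult (b ^ k) q = a * p + r"
    and b: "same_sign (\<phi> b) (\<psi> b)" "\<phi> b \<noteq> 0"
    and 0: "poly (map_poly \<phi> p) x = 0" "poly (map_poly \<psi> p) y = 0"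
    and r: "same_sign (poly (map_poly \<phi> r) x) (poly (map_poly \<psi> r) y)"
  shows "same_sign (poly (map_poly \<phi> q) x) (poly (map_poly \<psi> q) y)"
proof -
  have "\<phi> b ^ k * poly (map_poly \<phi> q) x = poly (map_poly \<phi> r) x"
    using arg_cong[OF rem, of "\<lambda>f. poly (map_poly \<phi> f) x"] h(1) 0
    by (simp add: map_poly_hom_smult map_poly_hom_add map_poly_hom_mult is_hom_power)
  moreover have "\<psi> b ^ k * poly (map_poly \<psi> q) y = poly (map_poly \<psi> r) y"
    using arg_cong[OF rem, of "\<lambda>f. poly (map_poly \<psi> f) y"] h(2) 0
    by (simp add: map_poly_hom_smult map_poly_hom_add map_poly_hom_mult is_hom_power)
  ultimately have "same_sign (\<phi> b ^ k * poly (map_poly \<phi> q) x) (\<psi> b ^ k * poly (map_poly \<psi> q) y)"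
    using r by simp
  then show ?thesis by (rule same_sign_mult_cancel) (use b same_sign_power in auto)
qed

lemma degree_pderiv_le: "degree (pderiv p) \<le> degree p - 1"
  by (rule degree_le) (auto simp: coeff_pderiv coeff_eq_0)

lemma degree_map_poly_hom: "\<phi> (lead_coeff p) \<noteq> 0 \<Longrightarrow> \<phi> 0 = 0 \<Longrightarrow> degree (map_poly \<phi> p) = degree p"
  by (intro antisym map_poly_degree_leq le_degree) (simp add: coeff_map_poly)

lemma lead_coeff_map_poly_hom:
  "\<phi> (lead_coeff p) \<noteq> 0 \<Longrightarrow> \<phi> 0 = 0 \<Longrightarrow> lead_coeff (map_poly \<phi> p) = \<phi> (lead_coeff p)"
  by (simp add: degree_map_poly_hom coeff_map_poly)

text \<open>The induction step of the Cohen-Hoermander procedure: between consecutive roots of the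
  other polynomials and of \<open>pderiv q\<close>, the polynomial \<open>q\<close> is monotone, and its signs
  at these roots are the signs of its pseudo-remainders.\<close>

lemma sign_match_step:
  fixes \<phi> :: "'c::idom \<Rightarrow> 'a::real_closed_field" and \<psi> :: "'c \<Rightarrow> 'b::real_closed_field"
  assumes h: "is_hom \<phi>" "is_hom \<psi>" and q: "degree q > 0"
    and lcq: "same_sign (\<phi> (lead_coeff q)) (\<psi> (lead_coeff q))" "\<phi> (lead_coeff q) \<noteq> 0"
    and lcS: "\<And>p. p \<in> S \<Longrightarrow> degree p > 0 \<Longrightarrow> same_sign (\<phi> (lead_coeff p)) (\<psi> (lead_coeff p)) \<and>
      \<phi> (lead_coeff p) \<noteq> 0"
    and rem: "\<And>p. p \<in> insert (pderiv q) S \<Longrightarrow> degree p > 0 \<Longrightarrow>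
      \<exists>k a. smult (lead_coeff p ^ k) q = a * p + R p"
    and sm: "sign_match_via Z \<phi> \<psi> (insert (pderiv q) S \<union> R ` {p \<in> insert (pderiv q) S. degree p >
      0})"
  shows "\<exists>Z. sign_match_via Z \<phi> \<psi> (insert q S)"
proof -
  let ?D = "insert (pderiv q) S"
  let ?q = "map_poly \<phi> q" and ?r = "map_poly \<psi> q"
  have h0: "\<phi> 0 = 0" "\<psi> 0 = 0" using h is_hom_0 by auto
  have dq: "degree ?q = degree q" "lead_coeff ?q = \<phi> (lead_coeff q)"
    using degree_map_poly_hom lead_coeff_map_poly_hom lcq(2) h0 by blast+
  have lcq': "\<psi> (lead_coeff q) \<noteq> 0" using lcq same_sign_zero by blast
  have dr: "degree ?r = degree q" "lead_coeff ?r = \<psi> (lead_coeff q)"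
    using degree_map_poly_hom lead_coeff_map_poly_hom lcq' h0 by blast+
  have nzq: "?q \<noteq> 0" "?r \<noteq> 0" using dq(1) dr(1) q by auto
  have lc: "same_sign (\<phi> (lead_coeff p)) (\<psi> (lead_coeff p)) \<and> \<phi> (lead_coeff p) \<noteq> 0 \<and>
    \<psi> (lead_coeff p) \<noteq> 0"
    if p: "p \<in> ?D" "degree p > 0" for p
  proof (cases "p = pderiv q")
    case True
    define d where "d = degree q - 1"
    have d: "coeff (pderiv q) d = of_nat (degree q) * lead_coeff q"
      using q by (simp add: coeff_pderiv d_def)
    \<comment> \<open>The degree of \<open>pderiv q\<close> is settled in the ordered field, where
      \<open>of_nat (degree q)\<close> cannot vanish; the characteristic of \<open>'c\<close> is
      left open.\<close>
    have "\<phi> (coeff (pderiv q) d) \<noteq> 0" unfolding d using h(1) lcq(2) q by (simp add: is_hom_simps)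
    then have "coeff (pderiv q) d \<noteq> 0" using h0 by auto
    then have "degree (pderiv q) = d" using degree_pderiv_le[of q] le_degree d_def
      by (metis antisym)
    then have "\<phi> (lead_coeff p) = of_nat (degree q) * \<phi> (lead_coeff q)"
      "\<psi> (lead_coeff p) = of_nat (degree q) * \<psi> (lead_coeff q)"
      using d True h by (simp_all add: is_hom_simps)
    then show ?thesis using lcq lcq' q
      by (auto simp: same_sign_def zero_less_mult_iff mult_less_0_iff)
  next
    case False
    then show ?thesis using lcS[of p] p same_sign_zero by blast
  qed
  have nzD: "map_poly \<phi> p \<noteq> 0" "map_poly \<psi> p \<noteq> 0" if "p \<in> ?D" "degree p > 0" for p
    using lc[OF that] h0 by (metis coeff_map_poly coeff_0)+
  have smD: "sign_match_via Z \<phi> \<psi> ?D" using sm by (auto simp: sign_match_via_def)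
  \<comment> \<open>At each remaining pair some nonconstant \<open>p\<close> vanishes on both sides,
    so that its pseudo-remainder gives the sign of \<open>q\<close> there.\<close>
  define Y where "Y = {(x, y) \<in> Z. \<exists>p\<in>?D. degree p > 0 \<and> poly (map_poly \<phi> p) x = 0}"
  have smY: "sign_match_via Y \<phi> \<psi> ?D" by (rule sign_match_via_restrict[OF smD nzD(2) Y_def])
  have omY: "order_match Y" using smY by (simp add: sign_match_via_def)
  have finY: "finite Y" using omY by (simp add: order_match_def)
  have ssY: "same_sign (poly ?q x) (poly ?r y)" if xy: "(x, y) \<in> Y" for x y
  proof -
    obtain p where p: "p \<in> ?D" "degree p > 0" "poly (map_poly \<phi> p) x = 0" "(x, y) \<in> Z"
      using xy by (auto simp: Y_def)
    have cut: "same_cut Z x y" using p(4) smD by (auto simp: sign_match_via_def order_match_def)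
    have p0: "poly (map_poly \<psi> p) y = 0"
      using sign_match_viaD[OF smD cut p(1)] p(3) same_sign_zero by blast
    have sr: "same_sign (poly (map_poly \<phi> (R p)) x) (poly (map_poly \<psi> (R p)) y)"
      using sign_match_viaD[OF sm cut, of "R p"] p by blast
    obtain k a where ka: "smult (lead_coeff p ^ k) q = a * p + R p" using rem p by blast
    show ?thesis
      using pseudo_remainder_sign[OF h ka _ _ p(3) p0 sr] lc[OF p(1,2)] by blast
  qed
  have dphi: "map_poly \<phi> (pderiv q) = pderiv ?q" "map_poly \<psi> (pderiv q) = pderiv ?r"
    using h map_poly_hom_pderiv by blast+
  have critY: "x \<in> fst ` Y" if 0: "poly (pderiv ?q) x = 0" for x
  proof (cases "degree (pderiv q) > 0")
    case True
    then show ?thesis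
      using sign_match_via_root[OF smD insertI1 True nzD(1)[OF insertI1 True], of x] 0
      by (simp add: dphi Y_def)
  next
    case False
    then have "degree (pderiv ?q) = 0" using map_poly_degree_leq[of \<phi> "pderiv q"] dphi by simp
    then obtain c where "pderiv ?q = [:c:]" by (rule degree_eq_zeroE)
    moreover have "pderiv ?q \<noteq> 0" using dq(1) q by (simp add: pderiv_eq_0_iff)
    ultimately show ?thesis using 0 by simp
  qed
  have critY': "y \<in> snd ` Y" if 0: "poly (pderiv ?r) y = 0" for y
  proof (cases "degree (pderiv q) > 0")
    case True
    have "sign_match_via (Z\<inverse>) \<psi> \<phi> ?D" using smD by (simp add: sign_match_via_converse)
    from sign_match_via_root[OF this insertI1 True nzD(2)[OF insertI1 True], of y] 0
    have "y \<in> fst ` {(y, x) \<in> Z\<inverse>. \<exists>p\<in>?D. degree p > 0 \<and> poly (map_poly \<psi> p) y = 0}"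
      unfolding dphi by blast
    then have "\<exists>x p. (x, y) \<in> Z \<and> p \<in> ?D \<and> degree p > 0 \<and> poly (map_poly \<psi> p) y = 0"
      by (elim imageE) auto
    then obtain x p where xp: "(x, y) \<in> Z" "p \<in> ?D" "degree p > 0" "poly (map_poly \<psi> p) y = 0"
      by blast
    have cut: "same_cut Z x y" using xp(1) smD by (auto simp: sign_match_via_def order_match_def)
    have "poly (map_poly \<phi> p) x = 0"
      using sign_match_viaD[OF smD cut xp(2)] xp(4) same_sign_zero by blast
    then show ?thesis using xp by (force simp: Y_def)
  next
    case False
    then have "degree (pderiv ?r) = 0" using map_poly_degree_leq[of \<psi> "pderiv q"] dphi by simp
    then obtain c where "pderiv ?r = [:c:]" by (rule degree_eq_zeroE)
    moreover have "pderiv ?r \<noteq> 0" using dr(1) q by (simp add: pderiv_eq_0_iff)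
    ultimately show ?thesis using 0 by simp
  qed
  obtain b where b: "0 < b" "\<And>x. x \<in> fst ` Y \<Longrightarrow> -b < x \<and> x < b"
    "\<And>t. t \<ge> b \<Longrightarrow> 0 < poly ?q t * lead_coeff ?q"
    "\<And>t. t \<le> -b \<Longrightarrow> 0 < poly ?q t * (lead_coeff ?q * (-1) ^ degree ?q)"
    using poly_sign_bound[OF nzq(1), of "fst ` Y"] finY by blast
  obtain c where c: "0 < c" "\<And>x. x \<in> snd ` Y \<Longrightarrow> -c < x \<and> x < c"
    "\<And>t. t \<ge> c \<Longrightarrow> 0 < poly ?r t * lead_coeff ?r"
    "\<And>t. t \<le> -c \<Longrightarrow> 0 < poly ?r t * (lead_coeff ?r * (-1) ^ degree ?r)"
    using poly_sign_bound[OF nzq(2), of "snd ` Y"] finY by blast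
  \<comment> \<open>The added end points lie beyond all roots of \<open>q\<close> and all of
    \<open>Y\<close>; the signs there come from the leading coefficient and the parity of the
    degree.\<close>
  define W where "W = insert (-b, -c) (insert (b, c) Y)"
  have bY: "-b < x \<and> x < b" "-c < y \<and> y < c" if "(x, y) \<in> Y" for x y
    using b(2)[of x] c(2)[of y] that by force+
  have "same_cut Y b c" using bY by (auto simp: same_cut_def dest: less_imp_not_less)
  then have "order_match (insert (b, c) Y)" by (rule order_match_insert[OF omY])
  moreover have "same_cut (insert (b, c) Y) (-b) (-c)"
    using bY b(1) c(1) by (auto simp: same_cut_def dest: less_imp_not_less)
  ultimately have omX: "order_match W" unfolding W_def by (rule order_match_insert)
  have YX: "Y \<subseteq> W" by (auto simp: W_def)
  have pm: "same_sign (- 1 :: 'a) (- 1 :: 'b)" by (simp add: same_sign_def)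
  have sb: "same_sign (poly ?q b) (poly ?r c)"
  proof (rule same_sign_trans_pos)
    show "same_sign (lead_coeff ?q) (lead_coeff ?r)" using lcq dq dr by simp
  qed (use b(3)[of b] c(3)[of c] in \<open>simp_all add: mult.commute\<close>)
  have sb': "same_sign (poly ?q (-b)) (poly ?r (-c))"
  proof (rule same_sign_trans_pos)
    show "same_sign (lead_coeff ?q * (-1) ^ degree ?q) (lead_coeff ?r * (-1) ^ degree ?r)"
      unfolding dq(2) dr(2) unfolding dq dr
      by (rule same_sign_mult[OF lcq(1) same_sign_power[OF pm]])
  qed (use b(4)[of "-b"] c(4)[of "-c"] in \<open>simp_all add: mult.commute\<close>)
  have cm: "critical_match W ?q ?r"
    unfolding critical_match_def
  proof (intro conjI)
    show "order_match W" by (rule omX)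
    show "\<forall>(x, y)\<in>W. same_sign (poly ?q x) (poly ?r y)"
      using sb sb' ssY by (auto simp: W_def)
    show "\<forall>x. poly (pderiv ?q) x = 0 \<longrightarrow> x \<in> fst ` W" using critY by (auto simp: W_def)
    show "\<forall>y. poly (pderiv ?r) y = 0 \<longrightarrow> y \<in> snd ` W" using critY' by (auto simp: W_def)
    have "\<forall>t\<le>-b. poly ?q t \<noteq> 0" "\<forall>u\<le>-c. poly ?r u \<noteq> 0" using b(4) c(4) by fastforce+
    then show "\<exists>(x, y)\<in>W. (\<forall>t\<le>x. poly ?q t \<noteq> 0) \<and> (\<forall>u\<le>y. poly ?r u \<noteq> 0)"
      by (intro bexI[of _ "(-b, -c)"]) (auto simp: W_def)
    have "\<forall>t\<ge>b. poly ?q t \<noteq> 0" "\<forall>u\<ge>c. poly ?r u \<noteq> 0" using b(3) c(3) by fastforce+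
    then show "\<exists>(x, y)\<in>W. (\<forall>t\<ge>x. poly ?q t \<noteq> 0) \<and> (\<forall>u\<ge>y. poly ?r u \<noteq> 0)"
      by (intro bexI[of _ "(b, c)"]) (auto simp: W_def)
  qed
  have YM: "Y \<subseteq> merge_roots W ?q ?r" using YX by (auto simp: merge_roots_def)
  have "sign_match_via (merge_roots W ?q ?r) \<phi> \<psi> (insert q S)"
    unfolding sign_match_via_def
  proof (intro conjI allI impI ballI)
    show "order_match (merge_roots W ?q ?r)" by (rule order_match_merge_roots[OF cm])
    fix t u p assume tu: "same_cut (merge_roots W ?q ?r) t u" and p: "p \<in> insert q S"
    show "same_sign (poly (map_poly \<phi> p) t) (poly (map_poly \<psi> p) u)"
    proof (cases "p = q")
      case True
      then show ?thesis using critical_match_same_sign[OF cm tu] by simp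
    next
      case False
      then show ?thesis using sign_match_viaD[OF smY same_cut_subset[OF tu YM]] p by simp
    qed
  qed
  then show ?thesis by blast
qed

text \<open>The termination measure: one polynomial is traded for finitely many of smaller degree,
  however many these are.\<close>

definition degree_mset :: "'c::zero poly set \<Rightarrow> nat multiset" where
  "degree_mset S = image_mset degree (mset_set S)"

lemma degree_mset_less:
  assumes S: "finite S" "q \<in> S" and N: "finite N" "\<And>p. p \<in> N \<Longrightarrow> degree p < degree q"
  shows "(degree_mset ((S - {q}) \<union> N), degree_mset S) \<in> Multiset.mult {(x, y). x < y}"
proof -
  \<comment> \<open>A member of \<open>N\<close> that is already present must not be counted
    twice.\<close>
  have "mset_set ((S - {q}) \<union> N) = mset_set ((S - {q}) \<union> (N - (S - {q})))" by simp
  also have "\<dots> = mset_set (S - {q}) + mset_set (N - (S - {q}))"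
    by (rule mset_set_Union) (use S N in auto)
  finally have 1: "degree_mset ((S - {q}) \<union> N) = degree_mset (S - {q}) + degree_mset (N - (S -
    {q}))"
    by (simp add: degree_mset_def)
  have "S = insert q (S - {q})" using S by auto
  then have "mset_set S = add_mset q (mset_set (S - {q}))"
    using mset_set.insert[of "S - {q}" q] S by simp
  then have 2: "degree_mset S = degree_mset (S - {q}) + {#degree q#}" by (simp add: degree_mset_def)
  show ?thesis
    unfolding 1 2 by (rule one_step_implies_mult) (use N in \<open>auto simp: degree_mset_def\<close>)
qed

lemma map_poly_hom_monom: "is_hom \<phi> \<Longrightarrow> map_poly \<phi> (monom c n) = monom (\<phi> c) n"
  by (simp add: map_poly_monom is_hom_0)

lemma degree_drop_lead:
  fixes p :: "'a::ab_group_add poly"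
  shows "degree p > 0 \<Longrightarrow> degree (p - monom (lead_coeff p) (degree p)) < degree p"
proof -
  assume p: "degree p > 0"
  have "degree (p - monom (lead_coeff p) (degree p)) \<le> degree p"
    by (rule degree_diff_le) (simp_all add: degree_monom_le)
  then show ?thesis
    using eq_zero_or_degree_less[of "p - monom (lead_coeff p) (degree p)" "degree p"] p by auto
qed

text \<open>\<open>T\<close> is collected over all branches before the homomorphisms are known. If a
  leading coefficient is sent to \<open>0\<close>, its term is dropped; otherwise a polynomial
  \<open>q\<close> of largest degree is traded for its derivative and its pseudo-remainders. Either
  way the multiset of degrees falls.\<close>

theorem sign_match_finite:
  fixes C :: "'c::idom set"
  assumes C: "is_subring C" and S: "finite S" "\<And>p. p \<in> S \<Longrightarrow> coeffs_in C p"
  shows "\<exists>T. finite T \<and> T \<subseteq> C \<and>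
    (\<forall>(\<phi> :: 'c \<Rightarrow> 'a::real_closed_field) (\<psi> :: 'c \<Rightarrow> 'b::real_closed_field).
       is_hom \<phi> \<longrightarrow> is_hom \<psi> \<longrightarrow> agree T \<phi> \<psi> \<longrightarrow> (\<exists>Z. sign_match_via Z \<phi> \<psi> S))"
proof -
  define P :: "'c set \<Rightarrow> 'c poly set \<Rightarrow> bool" where "P = (\<lambda>T S. finite T \<and> T \<subseteq> C \<and>
    (\<forall>(\<phi> :: 'c \<Rightarrow> 'a::real_closed_field) (\<psi> :: 'c \<Rightarrow> 'b::real_closed_field).
       is_hom \<phi> \<longrightarrow> is_hom \<psi> \<longrightarrow> agree T \<phi> \<psi> \<longrightarrow> (\<exists>Z. sign_match_via Z \<phi> \<psi> S)))"
  have PI: "P T S" if "finite T" "T \<subseteq> C"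
      "\<And>(\<phi> :: 'c \<Rightarrow> 'a) (\<psi> :: 'c \<Rightarrow> 'b). is_hom \<phi> \<Longrightarrow> is_hom \<psi> \<Longrightarrow> agree T \<phi> \<psi> \<Longrightarrow>
        \<exists>Z. sign_match_via Z \<phi> \<psi> S" for T S
    using that unfolding P_def by blast
  have PD: "finite T" "T \<subseteq> C" if "P T S" for T S using that unfolding P_def by blast+
  have PE: "\<exists>Z. sign_match_via Z \<phi> \<psi> S" if "P T S" "is_hom \<phi>" "is_hom \<psi>" "agree T \<phi> \<psi>"
    for T S and \<phi> :: "'c \<Rightarrow> 'a" and \<psi> :: "'c \<Rightarrow> 'b"
    using that unfolding P_def by blast
  have wf: "wf (inv_image (Multiset.mult {(x :: nat, y). x < y}) degree_mset)"
    by (intro wf_inv_image wf_mult wf)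
  have "\<exists>T. P T S" if "finite S" "\<forall>p\<in>S. coeffs_in C p" for S
    using that
  proof (induction S rule: wf_induct_rule[OF wf])
    case (1 S)
    have IH: "\<exists>T. P T S'" if "(degree_mset S', degree_mset S) \<in> Multiset.mult {(x, y). x < y}"
      "finite S'" "\<forall>p\<in>S'. coeffs_in C p" for S'
      using 1(1)[of S'] that by (simp add: in_inv_image)
    show ?case
    proof (cases "\<exists>p\<in>S. degree p > 0")
      case False
      have "P ((\<lambda>p. coeff p 0) ` S) S"
      proof (rule PI)
        show "finite ((\<lambda>p. coeff p 0) ` S)" using 1 by simp
        show "(\<lambda>p. coeff p 0) ` S \<subseteq> C" using 1 by (auto simp: coeffs_in_def)
        fix \<phi> :: "'c \<Rightarrow> 'a" and \<psi> :: "'c \<Rightarrow> 'b"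
        assume h: "is_hom \<phi>" "is_hom \<psi>" and ag: "agree ((\<lambda>p. coeff p 0) ` S) \<phi> \<psi>"
        have "same_sign (poly (map_poly \<phi> p) t) (poly (map_poly \<psi> p) u)" if p: "p \<in> S" for p t u
        proof -
          have "degree p = 0" using False p by auto
          then obtain c where c: "p = [:c:]" by (rule degree_eq_zeroE)
          then have "same_sign (\<phi> c) (\<psi> c)" using ag p by (force simp: agree_def)
          then show ?thesis using c h by (simp add: map_poly_pCons is_hom_0)
        qed
        then have "sign_match_via {} \<phi> \<psi> S" by (simp add: sign_match_via_def order_match_def)
        then show "\<exists>Z. sign_match_via Z \<phi> \<psi> S" by blast
      qed
      then show ?thesis by blast
    next
      case True
      \<comment> \<open>With \<open>q\<close> of largest degree, every divisor \<open>p\<close> in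
        \<open>D\<close> has degree at most \<open>d\<close>, hence every remainder has a smaller
        one.\<close>
      define d where "d = Max (degree ` S)"
      have "S \<noteq> {}" using True by blast
      then have "d \<in> degree ` S" using 1 unfolding d_def by (intro Max_in) auto
      then obtain q where q: "q \<in> S" "degree q = d" by auto
      have dmax: "degree p \<le> d" if "p \<in> S" for p using that 1 by (auto simp: d_def)
      have d0: "d > 0" using True dmax by (metis less_le_trans)
      define low where "low = (\<lambda>p :: 'c poly. p - monom (lead_coeff p) (degree p))"
      have cl: "coeffs_in C (low p)" if "p \<in> S" for p
        unfolding low_def using that 1 C
          by (intro coeffs_in_diff coeffs_in_monom) (auto simp: coeffs_in_def)
      have "\<forall>p\<in>{p \<in> S. degree p > 0}. \<exists>T. P T ((S - {p}) \<union> {low p})"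
      proof
        fix p assume p: "p \<in> {p \<in> S. degree p > 0}"
        show "\<exists>T. P T ((S - {p}) \<union> {low p})"
        proof (rule IH)
          show "(degree_mset ((S - {p}) \<union> {low p}), degree_mset S) \<in> Multiset.mult {(x, y). x < y}"
            by (rule degree_mset_less) (use 1 p degree_drop_lead[of p] in \<open>auto simp: low_def\<close>)
        qed (use 1 cl p in auto)
      qed
      from bchoice[OF this] obtain TL where
        TL: "\<And>p. p \<in> S \<Longrightarrow> degree p > 0 \<Longrightarrow> P (TL p) ((S - {p}) \<union> {low p})" by blast
      define D where "D = insert (pderiv q) (S - {q})"
      have cD: "coeffs_in C p" if "p \<in> D" for p
        using that 1 q coeffs_in_pderiv[OF C] by (auto simp: D_def)
      have dD: "degree p \<le> d" if "p \<in> D" for p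
        using that dmax degree_pderiv_le[of q] q by (auto simp: D_def)
      have "\<forall>p\<in>{p \<in> D. degree p > 0}. \<exists>r. (\<exists>k a. smult (lead_coeff p ^ k) q = a * p + r) \<and>
          degree r < degree p \<and> coeffs_in C r"
        using pseudo_remainder[OF C] cD 1 q by blast
      from bchoice[OF this] obtain R where R: "\<And>p. p \<in> D \<Longrightarrow> degree p > 0 \<Longrightarrow>
          (\<exists>k a. smult (lead_coeff p ^ k) q = a * p + R p) \<and> degree (R p) < degree p \<and>
            coeffs_in C (R p)"
        by blast
      define S' where "S' = (S - {q}) \<union> insert (pderiv q) (R ` {p \<in> D. degree p > 0})"
      have finD: "finite D" using 1 by (simp add: D_def)
      have "\<exists>T. P T S'"
      proof (rule IH)
        have "degree (pderiv q) < degree q" using degree_pderiv_le[of q] q d0 by linarith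
        moreover have "degree (R p) < degree q" if "p \<in> D" "degree p > 0" for p
          using R[OF that] dD[OF that(1)] q by linarith
        ultimately show "(degree_mset S', degree_mset S) \<in> Multiset.mult {(x, y). x < y}"
          unfolding S'_def using 1 q finD by (intro degree_mset_less) auto
        show "finite S'" "\<forall>p\<in>S'. coeffs_in C p" using 1 finD cD R by (auto simp: S'_def D_def)
      qed
      then obtain T' where T': "P T' S'" by blast
      \<comment> \<open>The leading coefficients decide which branch applies; the other members
        serve that branch.\<close>
      define T where "T = lead_coeff ` S \<union> (\<Union>p\<in>{p \<in> S. degree p > 0}. TL p) \<union> T'"
      have "P T S"
      proof (rule PI)
        have "finite (TL p)" "TL p \<subseteq> C" if "p \<in> S" "degree p > 0" for p
          using PD[OF TL[OF that]] by blast+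
        note fTL = this
        show "finite T" unfolding T_def using 1 PD(1)[OF T'] fTL(1) by auto
        show "T \<subseteq> C" unfolding T_def using 1(3) PD(2)[OF T'] fTL(2) unfolding coeffs_in_def by blast
        fix \<phi> :: "'c \<Rightarrow> 'a" and \<psi> :: "'c \<Rightarrow> 'b"
        assume h: "is_hom \<phi>" "is_hom \<psi>" and ag: "agree T \<phi> \<psi>"
        show "\<exists>Z. sign_match_via Z \<phi> \<psi> S"
        proof (cases "\<exists>p\<in>S. degree p > 0 \<and> \<phi> (lead_coeff p) = 0")
          case True
          then obtain p where p: "p \<in> S" "degree p > 0" "\<phi> (lead_coeff p) = 0" by blast
          \<comment> \<open>Agreement of signs includes agreement of zeros, so the same term is
            dropped on both sides.\<close>
          then have p0: "\<psi> (lead_coeff p) = 0"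
            using ag same_sign_zero by (auto simp: agree_def T_def)
          have eq: "map_poly \<phi> (low p) = map_poly \<phi> p" "map_poly \<psi> (low p) = map_poly \<psi> p"
            using h p p0 by (simp_all add: low_def map_poly_hom_diff map_poly_hom_monom)
          have "agree (TL p) \<phi> \<psi>" using ag p by (auto simp: agree_def T_def)
          then obtain Z where Z: "sign_match_via Z \<phi> \<psi> ((S - {p}) \<union> {low p})"
            using PE[OF TL[OF p(1,2)] h] by blast
          have "sign_match_via Z \<phi> \<psi> S"
            unfolding sign_match_via_def
          proof (intro conjI allI impI ballI)
            show "order_match Z" using Z by (simp add: sign_match_via_def)
            fix t u g assume tu: "same_cut Z t u" and g: "g \<in> S"
            show "same_sign (poly (map_poly \<phi> g) t) (poly (map_poly \<psi> g) u)"
            proof (cases "g = p")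
              case True
              then show ?thesis using sign_match_viaD[OF Z tu, of "low p"] eq by simp
            next
              case False
              then show ?thesis using sign_match_viaD[OF Z tu, of g] g by simp
            qed
          qed
          then show ?thesis by blast
        next
          case False
          have lcs: "same_sign (\<phi> (lead_coeff p)) (\<psi> (lead_coeff p)) \<and> \<phi> (lead_coeff p) \<noteq> 0"
            if "p \<in> S" "degree p > 0" for p
            using False ag that by (auto simp: agree_def T_def)
          have "agree T' \<phi> \<psi>" using ag by (auto simp: agree_def T_def)
          then obtain Z where Z: "sign_match_via Z \<phi> \<psi> S'" using PE[OF T' h] by blast
          have "S' = insert (pderiv q) (S - {q}) \<union> R ` {p \<in> insert (pderiv q) (S - {q}). degree p
            > 0}"
            by (auto simp: S'_def D_def)
          then have "\<exists>Z. sign_match_via Z \<phi> \<psi> (insert q (S - {q}))"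
            using sign_match_step[OF h, of q "S - {q}" R Z] lcs q d0 R Z unfolding D_def by auto
          then show ?thesis using q by (simp add: insert_absorb)
        qed
      qed
      then show ?thesis by blast
    qed
  qed
  then show ?thesis using S unfolding P_def by blast
qed

section \<open>The ring of regulous functions\<close>

lemma polyfun_neg: "p \<in> polyfun_set \<Longrightarrow> (\<lambda>x. - p x) \<in> polyfun_set"
  using polyfun_set.mult[OF polyfun_set.const[of "-1"]] by simp

lemma polyfun_diff: "p \<in> polyfun_set \<Longrightarrow> q \<in> polyfun_set \<Longrightarrow> (\<lambda>x. p x - q x) \<in> polyfun_set"
  using polyfun_set.add[OF _ polyfun_neg] by simp

lemma polyfun_power: "p \<in> polyfun_set \<Longrightarrow> (\<lambda>x. p x ^ n) \<in> polyfun_set"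
  by (induction n) (auto intro: polyfun_set.intros)

lemma polyfun_sum: "(\<And>i. i \<in> A \<Longrightarrow> f i \<in> polyfun_set) \<Longrightarrow> (\<lambda>x. \<Sum>i\<in>A. f i x) \<in> polyfun_set"
  by (induction A rule: infinite_finite_induct) (auto intro: polyfun_set.intros)

lemma polyfun_continuous: "p \<in> polyfun_set \<Longrightarrow> continuous_on A p"
  by (induction rule: polyfun_set.induct) (auto intro!: continuous_intros)

text \<open>The end point \<open>z\<close> stays fixed while \<open>x\<close> varies, so that the
  coefficients in the line parameter are again polynomial functions. The bound on the degree is
  uniform in \<open>x\<close>, which allows summing all coefficients.\<close>

lemma polyfun_on_lines:
  assumes "p \<in> polyfun_set"
  shows "\<exists>(P :: real ^ 'n \<Rightarrow> real poly) N. (\<forall>k. (\<lambda>x. coeff (P x) k) \<in> polyfun_set) \<and>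
    (\<forall>x. degree (P x) \<le> N) \<and> (\<forall>x t. p (x + t *\<^sub>R (z - x)) = poly (P x) t)"
  using assms
proof (induction rule: polyfun_set.induct)
  case (const c)
  show ?case
    by (rule exI[of _ "\<lambda>x. [:c:]"], rule exI[of _ 0])
       (auto simp: coeff_pCons split: nat.split intro: polyfun_set.intros)
next
  case (coord i)
  have "(\<lambda>x. coeff [:x $ i, z $ i - x $ i:] k) \<in> polyfun_set" for k
  proof -
    consider "k = 0" | "k = 1" | j where "k = Suc (Suc j)" by (metis One_nat_def not0_implies_Suc)
    then show ?thesis
      by cases (auto intro: polyfun_set.intros polyfun_diff)
  qed
  then show ?case
    by (intro exI[of _ "\<lambda>x. [:x $ i, z $ i - x $ i:]"] exI[of _ 1]) (auto simp: algebra_simps)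
next
  case (add p q)
  then obtain P N Q M where *:
    "\<And>k. (\<lambda>x. coeff (P x) k) \<in> polyfun_set" "\<And>x. degree (P x) \<le> N"
      "\<And>x t. p (x + t *\<^sub>R (z - x)) = poly (P x) t"
    "\<And>k. (\<lambda>x. coeff (Q x) k) \<in> polyfun_set" "\<And>x. degree (Q x) \<le> M"
      "\<And>x t. q (x + t *\<^sub>R (z - x)) = poly (Q x) t"
    by blast
  have "degree (P x + Q x) \<le> max N M" for x
    using *(2)[of x] *(5)[of x] by (intro degree_add_le) auto
  then show ?case using *
    by (intro exI[of _ "\<lambda>x. P x + Q x"] exI[of _ "max N M"]) (auto intro: polyfun_set.intros)
next
  case (mult p q)
  then obtain P N Q M where *:
    "\<And>k. (\<lambda>x. coeff (P x) k) \<in> polyfun_set" "\<And>x. degree (P x) \<le> N"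
      "\<And>x t. p (x + t *\<^sub>R (z - x)) = poly (P x) t"
    "\<And>k. (\<lambda>x. coeff (Q x) k) \<in> polyfun_set" "\<And>x. degree (Q x) \<le> M"
      "\<And>x t. q (x + t *\<^sub>R (z - x)) = poly (Q x) t"
    by blast
  have "degree (P x * Q x) \<le> N + M" for x
    using degree_mult_le[of "P x" "Q x"] add_mono[OF *(2)[of x] *(5)[of x]] by linarith
  then show ?case using *
    by (intro exI[of _ "\<lambda>x. P x * Q x"] exI[of _ "N + M"])
       (auto intro!: polyfun_set.mult polyfun_sum simp: coeff_mult)
qed

text \<open>On the line from \<open>x\<close> to \<open>z\<close> the function is a polynomial that
  does not vanish at parameter \<open>1\<close>; its finitely many zeros can be avoided arbitrarily
  close to \<open>x\<close>.\<close>

lemma polyfun_nonzero_dense: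
  fixes q :: "real ^ 'n \<Rightarrow> real"
  assumes q: "q \<in> polyfun_set" "q z \<noteq> 0"
  shows "closure {x. q x \<noteq> 0} = UNIV"
proof -
  have "x \<in> closure {x. q x \<noteq> 0}" for x
  proof -
    obtain P :: "real ^ 'n \<Rightarrow> real poly" where P: "\<And>x t. q (x + t *\<^sub>R (z - x)) = poly (P x) t"
      using polyfun_on_lines[OF q(1)] by blast
    have "poly (P x) 1 \<noteq> 0" using P[of x 1] q(2) by simp
    then have "P x \<noteq> 0" by auto
    then have fin: "finite {t. poly (P x) t = 0}" by (rule poly_roots_finite)
    have lim: "((\<lambda>t. x + t *\<^sub>R (z - x)) \<longlongrightarrow> x + 0 *\<^sub>R (z - x)) (at_right 0)"
      by (intro tendsto_intros)
    have "eventually (\<lambda>t. t \<notin> {t. poly (P x) t = 0} - {0}) (nhds 0)"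
      unfolding eventually_nhds
      using open_Compl[OF finite_imp_closed[OF finite_Diff[OF fin, of "{0}"]]] by blast
    then have "eventually (\<lambda>t. t \<notin> {t. poly (P x) t = 0} - {0}) (at_right 0)"
      by (rule filter_leD[rotated]) (simp add: at_within_def)
    moreover have "eventually (\<lambda>t. t > (0::real)) (at_right 0)" by (rule eventually_at_right_less)
    ultimately have "eventually (\<lambda>t. x + t *\<^sub>R (z - x) \<in> closure {x. q x \<noteq> 0}) (at_right 0)"
      by eventually_elim (auto simp: P intro!: subsetD[OF closure_subset])
    from Lim_in_closed_set[OF closed_closure this _ lim] show ?thesis by simp
  qed
  then show ?thesis by blast
qed

lemma eq_on_polyfun_nonzero:
  fixes f g :: "real ^ 'n \<Rightarrow> real"
  assumes q: "q \<in> polyfun_set" "q z \<noteq> 0"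
    and fg: "continuous_on UNIV f" "continuous_on UNIV g" "\<And>x. q x \<noteq> 0 \<Longrightarrow> f x = g x"
  shows "f x = g x"
proof -
  have "closed {x. f x = g x}" using closed_Collect_eq[OF fg(1,2)] .
  then have "closure {x. q x \<noteq> 0} \<subseteq> {x. f x = g x}" using fg(3) by (intro closure_minimal) auto
  then show ?thesis using polyfun_nonzero_dense[OF q] by auto
qed

lemma polyfun_mult_nonzero:
  assumes p: "p \<in> polyfun_set" "p y \<noteq> 0" and q: "q \<in> polyfun_set" "q z \<noteq> (0::real)"
  shows "\<exists>x. p x * q x \<noteq> 0"
proof (rule ccontr)
  assume "\<nexists>x. p x * q x \<noteq> 0"
  then have "p x = 0" if "q x \<noteq> 0" for x using that by auto
  then show False
    using eq_on_polyfun_nonzero[OF q, of p "\<lambda>_. 0"] p polyfun_continuous by auto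
qed

text \<open>The relation without division extends from the open set to the whole space by continuity
  and density. In this form it survives sums and products without regard to domains.\<close>

lemma regulous_iff:
  "regulous f \<longleftrightarrow> continuous_on UNIV f \<and>
     (\<exists>p q. p \<in> polyfun_set \<and> q \<in> polyfun_set \<and> (\<exists>x. q x \<noteq> 0) \<and> (\<forall>x. q x * f x = p x))"
proof (intro iffI conjI)
  assume "regulous f"
  then obtain U p q where f: "continuous_on UNIV f" "zariski_open U" "U \<noteq> {}" "p \<in> polyfun_set"
    "q \<in> polyfun_set"
    "\<And>x. x \<in> U \<Longrightarrow> q x \<noteq> 0 \<and> f x = p x / q x" unfolding regulous_def by blast
  show "continuous_on UNIV f" by fact
  obtain G where G: "G \<subseteq> polyfun_set" "U = UNIV - {x. \<forall>g\<in>G. g x = 0}"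
    using f(2) by (auto simp: zariski_open_def)
  obtain z where z: "z \<in> U" using f(3) by blast
  then obtain g where g: "g \<in> G" "g z \<noteq> 0" using G by blast
  have gU: "q x * f x = p x" if "g x \<noteq> 0" for x
  proof -
    have "x \<in> U" using that g(1) G(2) by blast
    then show ?thesis using f(6)[of x] by simp
  qed
  have "continuous_on UNIV (\<lambda>x. q x * f x)" using f polyfun_continuous
    by (auto intro: continuous_on_mult)
  then have "q x * f x = p x" for x
    using eq_on_polyfun_nonzero[of g z "\<lambda>x. q x * f x" p x] g G(1) f(4) gU polyfun_continuous
      by blast
  then show "\<exists>p q. p \<in> polyfun_set \<and> q \<in> polyfun_set \<and> (\<exists>x. q x \<noteq> 0) \<and> (\<forall>x. q x * f x = p x)"
    using f z by blast
next
  assume *: "continuous_on UNIV f \<and>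
     (\<exists>p q. p \<in> polyfun_set \<and> q \<in> polyfun_set \<and> (\<exists>x. q x \<noteq> 0) \<and> (\<forall>x. q x * f x = p x))"
  then obtain p q z where pq: "p \<in> polyfun_set" "q \<in> polyfun_set" "q z \<noteq> 0" "\<And>x. q x * f x = p x"
    by blast
  define U where "U = UNIV - {x. \<forall>g\<in>{q}. g x = 0}"
  have "zariski_open U" unfolding zariski_open_def U_def using pq by (intro exI[of _ "{q}"]) auto
  moreover have "U \<noteq> {}" using pq by (auto simp: U_def)
  moreover have "\<forall>x\<in>U. q x \<noteq> 0 \<and> f x = p x / q x" using pq(4) by (auto simp: U_def field_simps)
  ultimately show "regulous f" unfolding regulous_def using * pq by blast
qed

lemma polyfun_regulous: "p \<in> polyfun_set \<Longrightarrow> regulous p"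
  unfolding regulous_iff using polyfun_continuous
  by (intro conjI exI[of _ p] exI[of _ "\<lambda>_. 1"]) (auto intro: polyfun_set.intros)

lemma regulous_add:
  assumes "regulous f" "regulous g"
  shows "regulous (\<lambda>x. f x + g x)"
proof -
  obtain p q y where f: "continuous_on UNIV f" "p \<in> polyfun_set" "q \<in> polyfun_set" "q y \<noteq> 0"
    "\<And>x. q x * f x = p x"
    using assms(1) unfolding regulous_iff by blast
  obtain r s z where g: "continuous_on UNIV g" "r \<in> polyfun_set" "s \<in> polyfun_set" "s z \<noteq> 0"
    "\<And>x. s x * g x = r x"
    using assms(2) unfolding regulous_iff by blast
  have "q x * s x * (f x + g x) = p x * s x + q x * r x" for x
    by (simp add: algebra_simps flip: f(5) g(5))
  then show ?thesis
    unfolding regulous_iff using f g polyfun_mult_nonzero[OF f(3,4) g(3,4)]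
    by (intro conjI exI[of _ "\<lambda>x. p x * s x + q x * r x"] exI[of _ "\<lambda>x. q x * s x"])
       (auto intro!: polyfun_set.intros continuous_intros)
qed

lemma regulous_mult:
  assumes "regulous f" "regulous g"
  shows "regulous (\<lambda>x. f x * g x)"
proof -
  obtain p q y where f: "continuous_on UNIV f" "p \<in> polyfun_set" "q \<in> polyfun_set" "q y \<noteq> 0"
    "\<And>x. q x * f x = p x"
    using assms(1) unfolding regulous_iff by blast
  obtain r s z where g: "continuous_on UNIV g" "r \<in> polyfun_set" "s \<in> polyfun_set" "s z \<noteq> 0"
    "\<And>x. s x * g x = r x"
    using assms(2) unfolding regulous_iff by blast
  have "q x * s x * (f x * g x) = p x * r x" for x
    by (simp add: algebra_simps flip: f(5) g(5))
  then show ?thesis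
    unfolding regulous_iff using f g polyfun_mult_nonzero[OF f(3,4) g(3,4)]
    by (intro conjI exI[of _ "\<lambda>x. p x * r x"] exI[of _ "\<lambda>x. q x * s x"])
       (auto intro!: polyfun_set.intros continuous_intros)
qed

text \<open>A regulous function other than zero has a nonzero numerator, and nonzero polynomial
  functions multiply to nonzero ones.\<close>

lemma regulous_no_zero_divisors:
  assumes "regulous f" "regulous g" "\<And>x. f x * g x = 0"
  shows "(\<forall>x. f x = 0) \<or> (\<forall>x. g x = 0)"
proof (rule ccontr)
  assume *: "\<not> ?thesis"
  obtain p q y where f: "continuous_on UNIV f" "p \<in> polyfun_set" "q \<in> polyfun_set" "q y \<noteq> 0"
    "\<And>x. q x * f x = p x"
    using assms(1) unfolding regulous_iff by blast
  obtain r s z where g: "continuous_on UNIV g" "r \<in> polyfun_set" "s \<in> polyfun_set" "s z \<noteq> 0"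
    "\<And>x. s x * g x = r x"
    using assms(2) unfolding regulous_iff by blast
  have "\<exists>x. p x \<noteq> 0"
  proof (rule ccontr)
    assume "\<nexists>x. p x \<noteq> 0"
    then have "f x = 0" if "q x \<noteq> 0" for x using f(5)[of x] that by auto
    then have "f x = 0" for x using eq_on_polyfun_nonzero[OF f(3,4,1), of "\<lambda>_. 0"] by auto
    then show False using * by blast
  qed
  moreover have "\<exists>x. r x \<noteq> 0"
  proof (rule ccontr)
    assume "\<nexists>x. r x \<noteq> 0"
    then have "g x = 0" if "s x \<noteq> 0" for x using g(5)[of x] that by auto
    then have "g x = 0" for x using eq_on_polyfun_nonzero[OF g(3,4,1), of "\<lambda>_. 0"] by auto
    then show False using * by blast
  qed
  ultimately obtain x where "p x * r x \<noteq> 0" using polyfun_mult_nonzero f(2) g(2) by blast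
  moreover have "p x * r x = q x * s x * (f x * g x)" by (simp add: algebra_simps flip: f(5) g(5))
  ultimately show False using assms(3) by simp
qed

text \<open>Reduces regularity of a quotient to its continuity: clearing the denominators of
  \<open>a\<close> and \<open>b\<close> yields the polynomial relation for \<open>w\<close>.\<close>

lemma regulous_quotient:
  assumes w: "continuous_on UNIV w" "\<And>x. b x * w x = a x" and ab: "regulous a" "regulous b"
    "b c \<noteq> 0"
  shows "regulous w"
proof -
  obtain p q y where f: "p \<in> polyfun_set" "q \<in> polyfun_set" "q y \<noteq> 0" "\<And>x. q x * a x = p x"
    using ab(1) unfolding regulous_iff by blast
  obtain r s z where g: "continuous_on UNIV b" "r \<in> polyfun_set" "s \<in> polyfun_set" "s z \<noteq> 0"
    "\<And>x. s x * b x = r x"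
    using ab(2) unfolding regulous_iff by blast
  obtain v where v: "r v \<noteq> 0"
  proof (rule ccontr)
    assume "\<not> thesis"
    then have "\<nexists>x. r x \<noteq> 0" using that by blast
    then have "b x = 0" if "s x \<noteq> 0" for x using g(5)[of x] that by auto
    then have "b x = 0" for x using eq_on_polyfun_nonzero[OF g(3,4,1), of "\<lambda>_. 0"] by auto
    then show False using ab(3) by blast
  qed
  have "q x * r x * w x = s x * p x" for x
    by (simp add: algebra_simps flip: f(4) g(5) w(2))
  then show ?thesis
    unfolding regulous_iff using w f g polyfun_mult_nonzero[OF f(2,3) g(2) v]
    by (intro conjI exI[of _ "\<lambda>x. s x * p x"] exI[of _ "\<lambda>x. q x * r x"])
       (auto intro!: polyfun_set.intros)
qed

section \<open>The regulous functions as an integral domain\<close>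

typedef 'n regfun = "{f :: real ^ 'n \<Rightarrow> real. regulous f}"
  using polyfun_regulous[OF polyfun_set.const] by blast

setup_lifting type_definition_regfun

instantiation regfun :: (finite) idom
begin

lift_definition zero_regfun :: "'a regfun" is "\<lambda>x. 0"
  by (rule polyfun_regulous[OF polyfun_set.const])
lift_definition one_regfun :: "'a regfun" is "\<lambda>x. 1"
  by (rule polyfun_regulous[OF polyfun_set.const])
lift_definition plus_regfun :: "'a regfun \<Rightarrow> 'a regfun \<Rightarrow> 'a regfun" is "\<lambda>f g x. f x + g x"
  by (rule regulous_add)
lift_definition times_regfun :: "'a regfun \<Rightarrow> 'a regfun \<Rightarrow> 'a regfun" is "\<lambda>f g x. f x * g x"
  by (rule regulous_mult)
lift_definition uminus_regfun :: "'a regfun \<Rightarrow> 'a regfun" is "\<lambda>f x. - f x"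
  using regulous_mult[OF polyfun_regulous[OF polyfun_set.const[of "-1"]]] by simp
lift_definition minus_regfun :: "'a regfun \<Rightarrow> 'a regfun \<Rightarrow> 'a regfun" is "\<lambda>f g x. f x - g x"
  using regulous_add[OF _ regulous_mult[OF polyfun_regulous[OF polyfun_set.const[of "-1"]]]] by simp

instance
proof
  fix a b c :: "'a regfun"
  show "a + b + c = a + (b + c)" "a + b = b + a" "0 + a = a" "- a + a = 0" "a - b = a + - b"
    "a * b * c = a * (b * c)" "a * b = b * a" "1 * a = a" "(a + b) * c = a * c + b * c"
    "a * (b + c) = a * b + a * c" "0 * a = 0" "a * 0 = 0"
    by (transfer; simp add: algebra_simps)+
  show "(0 :: 'a regfun) \<noteq> 1" by transfer (simp add: fun_eq_iff)
  show "a \<noteq> 0 \<Longrightarrow> b \<noteq> 0 \<Longrightarrow> a * b \<noteq> 0"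
    by transfer (metis (mono_tags, lifting) regulous_no_zero_divisors ext)
qed

end

abbreviation rapp :: "'n::finite regfun \<Rightarrow> real ^ 'n \<Rightarrow> real" where
  "rapp \<equiv> Rep_regfun"

lift_definition rconst :: "real \<Rightarrow> 'n::finite regfun" is "\<lambda>c x. c"
  by (rule polyfun_regulous[OF polyfun_set.const])

lift_definition rcoord :: "'n::finite \<Rightarrow> 'n regfun" is "\<lambda>i x. x $ i"
  by (rule polyfun_regulous[OF polyfun_set.coord])

lemma rapp_simps [simp]:
  "rapp 0 x = 0" "rapp 1 x = 1" "rapp (f + g) x = rapp f x + rapp g x"
    "rapp (f * g) x = rapp f x * rapp g x"
  "rapp (- f) x = - rapp f x" "rapp (f - g) x = rapp f x - rapp g x" "rapp (rconst c) x = c"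
    "rapp (rcoord i) x = x $ i"
  by (simp_all add: zero_regfun.rep_eq one_regfun.rep_eq plus_regfun.rep_eq times_regfun.rep_eq
      uminus_regfun.rep_eq minus_regfun.rep_eq rconst.rep_eq rcoord.rep_eq)

lemma rapp_power [simp]: "rapp (f ^ n) x = rapp f x ^ n"
  by (induction n) auto

lemma rapp_sum [simp]: "rapp (sum f A) x = (\<Sum>i\<in>A. rapp (f i) x)"
  by (induction A rule: infinite_finite_induct) auto

lemma rapp_eqI: "(\<And>x. rapp f x = rapp g x) \<Longrightarrow> f = g"
  by (metis Rep_regfun_inject ext)

lemma regulous_rapp: "regulous (rapp f)"
  using Rep_regfun by blast

lemma rapp_Abs: "regulous f \<Longrightarrow> rapp (Abs_regfun f) = f"
  by (simp add: Abs_regfun_inverse)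

lemma is_hom_rapp: "is_hom (\<lambda>f. rapp f x)"
  by (simp add: is_hom_def)

text \<open>Polynomials in the coordinates from \<open>J\<close>, taken inside the ring of regulous
  functions; eliminating a coordinate shrinks \<open>J\<close> while the ring stays the
  same.\<close>

inductive_set polyreg :: "'n::finite set \<Rightarrow> 'n regfun set" for J where
  const: "rconst c \<in> polyreg J"
| coord: "i \<in> J \<Longrightarrow> rcoord i \<in> polyreg J"
| add: "f \<in> polyreg J \<Longrightarrow> g \<in> polyreg J \<Longrightarrow> f + g \<in> polyreg J"
| mult: "f \<in> polyreg J \<Longrightarrow> g \<in> polyreg J \<Longrightarrow> f * g \<in> polyreg J"

lemma polyreg_subring: "is_subring (polyreg J)"
  unfolding is_subring_def
proof (intro conjI ballI)
  have "rconst 1 = (1 :: 'a regfun)" by (rule rapp_eqI) simp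
  then show "(1 :: 'a regfun) \<in> polyreg J" using polyreg.const by metis
  fix f g assume *: "f \<in> polyreg J" "g \<in> polyreg J"
  have "f - g = f + rconst (-1) * g" by (rule rapp_eqI) simp
  moreover have "f + rconst (-1) * g \<in> polyreg J" using *
    by (intro polyreg.add polyreg.mult polyreg.const)
  ultimately show "f - g \<in> polyreg J" by (simp only:)
qed (rule polyreg.mult)

lemma polyreg_UNIV_iff: "f \<in> polyreg UNIV \<longleftrightarrow> rapp f \<in> polyfun_set"
proof
  assume "f \<in> polyreg UNIV"
  then show "rapp f \<in> polyfun_set"
  proof (induction rule: polyreg.induct)
    case (const c) then show ?case using polyfun_set.const[of c] by (simp add: rconst.rep_eq)
  next
    case (coord i) then show ?case using polyfun_set.coord[of i] by (simp add: rcoord.rep_eq)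
  qed (auto simp: plus_regfun.rep_eq times_regfun.rep_eq intro: polyfun_set.intros)
next
  have *: "\<exists>f\<in>polyreg UNIV. rapp f = p" if "p \<in> polyfun_set" for p :: "real ^ 'n \<Rightarrow> real"
    using that
  proof (induction rule: polyfun_set.induct)
    case (const c) then show ?case by (metis polyreg.const rconst.rep_eq)
  next
    case (coord i) then show ?case by (metis polyreg.coord UNIV_I rcoord.rep_eq)
  next
    case (add p q) then show ?case using polyreg.add plus_regfun.rep_eq by metis
  next
    case (mult p q) then show ?case using polyreg.mult times_regfun.rep_eq by metis
  qed
  assume "rapp f \<in> polyfun_set"
  then show "f \<in> polyreg UNIV" using * rapp_eqI by metis
qed

lemma polyreg_independent:
  assumes "f \<in> polyreg J" "\<And>i. i \<in> J \<Longrightarrow> x $ i = y $ i"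
  shows "rapp f x = rapp f y"
  using assms by (induction rule: polyreg.induct) auto

lemma polyreg_empty: "f \<in> polyreg {} \<Longrightarrow> \<exists>c. f = rconst c"
proof (induction rule: polyreg.induct)
  case (add f g)
  then obtain c d where "f = rconst c" "g = rconst d" by blast
  then have "f + g = rconst (c + d)" by (intro rapp_eqI) simp
  then show ?case by blast
next
  case (mult f g)
  then obtain c d where "f = rconst c" "g = rconst d" by blast
  then have "f * g = rconst (c * d)" by (intro rapp_eqI) simp
  then show ?case by blast
qed auto

lemma polyreg_insert:
  assumes "f \<in> polyreg (insert j J)"
  shows "\<exists>P. coeffs_in (polyreg J) P \<and> f = poly P (rcoord j)"
  using assms
proof (induction rule: polyreg.induct)
  case (const c)
  have "coeffs_in (polyreg J) [:rconst c:]"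
    by (auto simp: coeffs_in_def coeff_pCons is_subring_0[OF polyreg_subring] split: nat.split
      intro: polyreg.intros)
  then show ?case by (intro exI[of _ "[:rconst c:]"]) simp
next
  case (coord i)
  have m: "coeffs_in (polyreg J) (monom 1 1)"
    using polyreg_subring[of J] by (intro coeffs_in_monom polyreg_subring) (simp add:
      is_subring_def)
  show ?case
  proof (cases "i = j")
    case True
    then show ?thesis using m by (intro exI[of _ "monom 1 1"]) (simp add: poly_monom)
  next
    case False
    then have "coeffs_in (polyreg J) [:rcoord i:]" using coord
      by (auto simp: coeffs_in_def coeff_pCons is_subring_0[OF polyreg_subring] split: nat.split
        intro: polyreg.intros)
    then show ?thesis by (intro exI[of _ "[:rcoord i:]"]) simp
  qed
next
  case (add f g)
  then show ?case using coeffs_in_add[OF polyreg_subring] poly_add by metis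
next
  case (mult f g)
  then show ?case using coeffs_in_mult[OF polyreg_subring] poly_mult by metis
qed

section \<open>The Artin-Lang theorem\<close>

lemma is_hom_poly: "is_hom \<phi> \<Longrightarrow> \<phi> (poly P c) = poly (map_poly \<phi> P) (\<phi> c)"
  by (induction P) (simp_all add: is_hom_simps map_poly_pCons)

text \<open>The one-variable theorem for evaluation at \<open>x\<close> and \<open>\<psi>\<close>.
  Changing coordinate \<open>j\<close> of \<open>x\<close> leaves the coefficients alone, so the new
  value can be placed freely on the line.\<close>

lemma eliminate_coord:
  fixes j :: "'n::finite"
  assumes j: "j \<notin> J" and S: "finite S" "S \<subseteq> polyreg (insert j J)"
  shows "\<exists>T. finite T \<and> T \<subseteq> polyreg J \<and>
    (\<forall>x (\<psi> :: 'n regfun \<Rightarrow> 'b::real_closed_field). is_hom \<psi> \<longrightarrow> agree T (\<lambda>f. rapp f x) \<psi> \<longrightarrow>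
      (\<exists>y. (\<forall>i. i \<noteq> j \<longrightarrow> y $ i = x $ i) \<and> agree S (\<lambda>f. rapp f y) \<psi>))"
proof -
  have "\<forall>s\<in>S. \<exists>P. coeffs_in (polyreg J) P \<and> s = poly P (rcoord j)" using S polyreg_insert by blast
  from bchoice[OF this] obtain P where P: "\<And>s. s \<in> S \<Longrightarrow> coeffs_in (polyreg J) (P s)"
    "\<And>s. s \<in> S \<Longrightarrow> s = poly (P s) (rcoord j)" by blast
  obtain T where T: "finite T" "T \<subseteq> polyreg J"
    "\<And>(\<phi> :: 'n regfun \<Rightarrow> real) (\<psi> :: 'n regfun \<Rightarrow> 'b). is_hom \<phi> \<Longrightarrow> is_hom \<psi> \<Longrightarrow> agree T \<phi> \<psi> \<Longrightarrow>
      \<exists>Z. sign_match_via Z \<phi> \<psi> (P ` S)"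
    using sign_match_finite[OF polyreg_subring, of "P ` S" J] S(1) P(1) by blast
  have "\<exists>y. (\<forall>i. i \<noteq> j \<longrightarrow> y $ i = x $ i) \<and> agree S (\<lambda>f. rapp f y) \<psi>"
    if \<psi>: "is_hom \<psi>" and ag: "agree T (\<lambda>f. rapp f x) \<psi>" for x and \<psi> :: "'n regfun \<Rightarrow> 'b"
  proof -
    obtain Z where Z: "sign_match_via Z (\<lambda>f. rapp f x) \<psi> (P ` S)" using T(3)[OF is_hom_rapp \<psi> ag]
      by blast
    then have "order_match (Z\<inverse>)" by (simp add: sign_match_via_def order_match_converse)
    \<comment> \<open>The new real coordinate imitates the position of
      \<open>\<psi> (rcoord j)\<close> among the roots; \<open>Z\<close> is reversed because the
      partner is sought on the real side.\<close>
    then obtain t where t: "same_cut Z t (\<psi> (rcoord j))" using same_cut_ex same_cut_converse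
      by blast
    define y where "y = (\<chi> i. if i = j then t else x $ i)"
    have "same_sign (rapp s y) (\<psi> s)" if s: "s \<in> S" for s
    proof -
      have "rapp (coeff (P s) k) y = rapp (coeff (P s) k) x" for k
        using P(1)[OF s] j by (intro polyreg_independent[of _ J]) (auto simp: coeffs_in_def y_def)
      then have "map_poly (\<lambda>f. rapp f y) (P s) = map_poly (\<lambda>f. rapp f x) (P s)"
        by (intro poly_eqI) (simp add: coeff_map_poly)
      moreover have "rapp s y = poly (map_poly (\<lambda>f. rapp f y) (P s)) (rapp (rcoord j) y)"
        using is_hom_poly[OF is_hom_rapp[of y], of "P s" "rcoord j"] P(2)[OF s] by simp
      moreover have "rapp (rcoord j) y = t" by (simp add: y_def)
      moreover have "\<psi> s = poly (map_poly \<psi> (P s)) (\<psi> (rcoord j))"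
        using is_hom_poly[OF \<psi>, of "P s" "rcoord j"] P(2)[OF s] by simp
      ultimately show ?thesis using sign_match_viaD[OF Z t, of "P s"] s by simp
    qed
    then have "agree S (\<lambda>f. rapp f y) \<psi>" by (simp add: agree_def)
    then show ?thesis by (intro exI[of _ y]) (auto simp: y_def)
  qed
  then show ?thesis using T(1,2) by blast
qed

lemma eliminate_coords:
  fixes J :: "'n::finite set"
  assumes "finite J" "J \<inter> I = {}" "finite S" "S \<subseteq> polyreg (J \<union> I)"
  shows "\<exists>T. finite T \<and> T \<subseteq> polyreg I \<and>
    (\<forall>x (\<psi> :: 'n regfun \<Rightarrow> 'b::real_closed_field). is_hom \<psi> \<longrightarrow> agree T (\<lambda>f. rapp f x) \<psi> \<longrightarrow>
      (\<exists>y. (\<forall>i. i \<notin> J \<longrightarrow> y $ i = x $ i) \<and> agree S (\<lambda>f. rapp f y) \<psi>))"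
  using assms
proof (induction J arbitrary: S rule: finite_induct)
  case empty
  then show ?case by (intro exI[of _ S]) auto
next
  case (insert j J)
  have "j \<notin> J \<union> I" using insert by auto
  moreover have "S \<subseteq> polyreg (insert j (J \<union> I))" using insert by simp
  ultimately obtain T where T: "finite T" "T \<subseteq> polyreg (J \<union> I)"
    "\<And>x (\<psi> :: 'n regfun \<Rightarrow> 'b). is_hom \<psi> \<Longrightarrow> agree T (\<lambda>f. rapp f x) \<psi> \<Longrightarrow>
      \<exists>y. (\<forall>i. i \<noteq> j \<longrightarrow> y $ i = x $ i) \<and> agree S (\<lambda>f. rapp f y) \<psi>"
    using eliminate_coord[of j "J \<union> I" S] insert.prems(2) by blast
  obtain T' where T': "finite T'" "T' \<subseteq> polyreg I"
    "\<And>x (\<psi> :: 'n regfun \<Rightarrow> 'b). is_hom \<psi> \<Longrightarrow> agree T' (\<lambda>f. rapp f x) \<psi> \<Longrightarrow>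
      \<exists>y. (\<forall>i. i \<notin> J \<longrightarrow> y $ i = x $ i) \<and> agree T (\<lambda>f. rapp f y) \<psi>"
    using insert.IH[OF _ T(1,2)] insert.prems by blast
  have "\<exists>y. (\<forall>i. i \<notin> insert j J \<longrightarrow> y $ i = x $ i) \<and> agree S (\<lambda>f. rapp f y) \<psi>"
    if \<psi>: "is_hom \<psi>" "agree T' (\<lambda>f. rapp f x) \<psi>" for x and \<psi> :: "'n regfun \<Rightarrow> 'b"
  proof -
    obtain y where y: "\<And>i. i \<notin> J \<Longrightarrow> y $ i = x $ i" "agree T (\<lambda>f. rapp f y) \<psi>" using T'(3)[OF \<psi>]
      by blast
    obtain z where z: "\<And>i. i \<noteq> j \<Longrightarrow> z $ i = y $ i" "agree S (\<lambda>f. rapp f z) \<psi>"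
      using T(3)[OF \<psi>(1) y(2)] by blast
    show ?thesis using y z by (intro exI[of _ z]) auto
  qed
  then show ?case using T'(1,2) by blast
qed

text \<open>Positive reals are invertible squares, so any homomorphism to an ordered field sends
  them to positive elements.\<close>

lemma hom_rconst_sign:
  fixes \<psi> :: "'n::finite regfun \<Rightarrow> 'b::linordered_field"
  assumes "is_hom \<psi>"
  shows "same_sign c (\<psi> (rconst c))"
proof -
  have pos: "0 < \<psi> (rconst a)" if "0 < a" for a
  proof -
    have "rconst a = rconst (sqrt a) * (rconst (sqrt a) :: 'n regfun)" using that
      by (intro rapp_eqI) simp
    then have "\<psi> (rconst a) = \<psi> (rconst (sqrt a)) * \<psi> (rconst (sqrt a))"
      using is_hom_mult[OF assms] by metis
    moreover have "\<psi> (rconst a) \<noteq> 0"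
    proof
      assume "\<psi> (rconst a) = 0"
      moreover have "rconst a * rconst (1 / a) = (1 :: 'n regfun)" using that
        by (intro rapp_eqI) simp
      ultimately show False using is_hom_mult[OF assms] is_hom_1[OF assms]
        by (metis mult_zero_left zero_neq_one)
    qed
    ultimately show ?thesis by (metis linorder_neqE_linordered_idom not_square_less_zero)
  qed
  have neg: "\<psi> (rconst (- a)) = - \<psi> (rconst a)" for a
  proof -
    have "rconst (- a) = - (rconst a :: 'n regfun)" by (rule rapp_eqI) simp
    then show ?thesis using is_hom_minus[OF assms] by metis
  qed
  consider "0 < c" | "c = 0" | "0 < - c" by linarith
  then show ?thesis
  proof cases
    case 1
    then show ?thesis using pos[of c] by (simp add: same_sign_def)
  next
    case 2
    have "rconst 0 = (0 :: 'n regfun)" by (rule rapp_eqI) simp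
    then show ?thesis using is_hom_0[OF assms] 2 by (simp add: same_sign_def)
  next
    case 3
    then show ?thesis using pos[of "- c"] neg[of c] by (simp add: same_sign_def)
  qed
qed

text \<open>Once all coordinates are eliminated, the remaining conditions concern constants and hold
  automatically; the elimination may start from any point, here the origin.\<close>

theorem artin_lang:
  fixes \<psi> :: "'n::finite regfun \<Rightarrow> 'b::real_closed_field"
  assumes \<psi>: "is_hom \<psi>" and S: "finite S" "S \<subseteq> polyreg UNIV"
  obtains x where "agree S (\<lambda>f. rapp f x) \<psi>"
proof -
  obtain T where T: "T \<subseteq> polyreg {}"
    "\<And>x (\<psi> :: 'n regfun \<Rightarrow> 'b). is_hom \<psi> \<Longrightarrow> agree T (\<lambda>f. rapp f x) \<psi> \<Longrightarrow> \<exists>y. agree S (\<lambda>f. rapp f y) \<psi>"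
    using eliminate_coords[of UNIV "{}" S] S by auto
  have "agree T (\<lambda>f. rapp f 0) \<psi>"
    unfolding agree_def
  proof
    fix f assume "f \<in> T"
    then obtain c where "f = rconst c" using T(1) polyreg_empty by blast
    then show "same_sign (rapp f 0) (\<psi> f)" using hom_rconst_sign[OF \<psi>] by simp
  qed
  then show ?thesis using T(2)[OF \<psi>] that by blast
qed

section \<open>Signs of real polynomials in two variables near the origin\<close>

lemma poly_bounded_01:
  fixes c :: "real poly"
  shows "\<exists>B\<ge>0. \<forall>s. 0 < s \<longrightarrow> s < 1 \<longrightarrow> \<bar>poly c s\<bar> \<le> B"
proof (induction c)
  case (pCons a c)
  then obtain B where B: "B \<ge> 0" "\<And>s. 0 < s \<Longrightarrow> s < 1 \<Longrightarrow> \<bar>poly c s\<bar> \<le> B" by blast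
  have "\<bar>poly (pCons a c) s\<bar> \<le> \<bar>a\<bar> + B" if s: "0 < s" "s < 1" for s
  proof -
    have "\<bar>s * poly c s\<bar> \<le> 1 * B" unfolding abs_mult using B s by (intro mult_mono) auto
    then show ?thesis using abs_triangle_ineq[of a "s * poly c s"] by simp
  qed
  then show ?case using B(1) by (intro exI[of _ "\<bar>a\<bar> + B"]) auto
qed auto

lemma poly_poly_bounded_01:
  fixes P :: "real poly poly"
  shows "\<exists>B\<ge>0. \<forall>s y. 0 < s \<longrightarrow> s < 1 \<longrightarrow> 0 < y \<longrightarrow> y < 1 \<longrightarrow> \<bar>poly (map_poly (\<lambda>c. poly c s) P) y\<bar> \<le> B"
proof (induction P)
  case (pCons a P)
  then obtain B where B: "B \<ge> 0" "\<And>s y. 0 < s \<Longrightarrow> s < 1 \<Longrightarrow> 0 < y \<Longrightarrow> y < 1 \<Longrightarrow>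
    \<bar>poly (map_poly (\<lambda>c. poly c s) P) y\<bar> \<le> B"
    by blast
  obtain A where A: "A \<ge> 0" "\<And>s. 0 < s \<Longrightarrow> s < 1 \<Longrightarrow> \<bar>poly a s\<bar> \<le> A" using poly_bounded_01[of a]
    by blast
  have "\<bar>poly (map_poly (\<lambda>c. poly c s) (pCons a P)) y\<bar> \<le> A + B"
    if s: "0 < s" "s < 1" "0 < y" "y < 1" for s y
  proof -
    let ?v = "poly (map_poly (\<lambda>c. poly c s) P) y"
    have "\<bar>y * ?v\<bar> \<le> 1 * B" unfolding abs_mult using B s by (intro mult_mono) auto
    then show ?thesis using abs_triangle_ineq[of "poly a s" "y * ?v"] A(2)[OF s(1,2)]
      by (simp add: map_poly_pCons)
  qed
  then show ?case using A(1) B(1) by (intro exI[of _ "A + B"]) auto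
qed auto

text \<open>\<open>i\<close> is the order of vanishing at \<open>0\<close>. The explicit lower
  bound, beyond a mere sign, is what later absorbs the terms of higher order in
  \<open>y\<close>.\<close>

lemma poly_sign_near_0:
  fixes c :: "real poly"
  assumes "c \<noteq> 0"
  shows "\<exists>i k d \<sigma>. 0 < k \<and> 0 < d \<and> d \<le> 1 \<and> \<bar>\<sigma>\<bar> = 1 \<and> (\<forall>s. 0 < s \<longrightarrow> s < d \<longrightarrow> k * s ^ i \<le> \<sigma> * poly c s)"
  using assms
proof (induction c)
  case (pCons a c)
  show ?case
  proof (cases "a = 0")
    case True
    then have "c \<noteq> 0" using pCons by auto
    then obtain i k d \<sigma> where *: "0 < k" "0 < d" "d \<le> 1" "\<bar>\<sigma>\<bar> = 1"
      "\<And>s. 0 < s \<Longrightarrow> s < d \<Longrightarrow> k * s ^ i \<le> \<sigma> * poly c s"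
      using pCons.IH by blast
    have "k * s ^ Suc i \<le> \<sigma> * poly (pCons a c) s" if "0 < s" "s < d" for s
      using mult_left_mono[OF *(5)[OF that], of s] that True by (simp add: mult_ac)
    then show ?thesis using * by blast
  next
    case False
    obtain B where B: "B \<ge> 0" "\<And>s. 0 < s \<Longrightarrow> s < 1 \<Longrightarrow> \<bar>poly c s\<bar> \<le> B" using poly_bounded_01[of c]
      by blast
    define d where "d = min 1 (\<bar>a\<bar> / (2 * (B + 1)))"
    have d: "0 < d" "d \<le> 1" using False B(1) by (auto simp: d_def)
    have "\<bar>a\<bar> / 2 * s ^ 0 \<le> sgn a * poly (pCons a c) s" if s: "0 < s" "s < d" for s
    proof -
      have "s < 1" "s < \<bar>a\<bar> / (2 * (B + 1))" using s by (auto simp: d_def)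
      have "\<bar>sgn a * (s * poly c s)\<bar> = s * \<bar>poly c s\<bar>" using False s by (simp add: abs_mult)
      also have "\<dots> \<le> s * (B + 1)" using B(2)[of s] s \<open>s < 1\<close> by (intro mult_left_mono) auto
      also have "\<dots> \<le> \<bar>a\<bar> / 2" using \<open>s < \<bar>a\<bar> / (2 * (B + 1))\<close> B(1) by (simp add: field_simps)
      finally have "- (\<bar>a\<bar> / 2) \<le> sgn a * (s * poly c s)" by linarith
      moreover have "sgn a * a = \<bar>a\<bar>" by (simp add: abs_sgn mult.commute)
      ultimately show ?thesis by (simp add: algebra_simps)
    qed
    moreover have "0 < \<bar>a\<bar> / 2" "\<bar>sgn a\<bar> = 1" using False by auto
    ultimately show ?thesis using d by blast
  qed
qed simp

text \<open>Here \<open>P\<close> is a polynomial in \<open>y\<close> over polynomials in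
  \<open>s\<close>. Its lowest nonzero coefficient is at least \<open>k * s ^ i\<close> in size, and
  for \<open>y < s ^ Suc i\<close> the rest is smaller by a factor of order
  \<open>s\<close>.\<close>

lemma poly_poly_sign_near_0:
  fixes P :: "real poly poly"
  shows "\<exists>M d \<sigma>. 0 < d \<and> d \<le> 1 \<and> (\<forall>s y. 0 < s \<longrightarrow> s < d \<longrightarrow> 0 < y \<longrightarrow> y < s ^ M \<longrightarrow>
    same_sign (poly (map_poly (\<lambda>c. poly c s) P) y) (\<sigma> :: real))"
proof (induction P)
  case 0
  then show ?case by (intro exI[of _ 0] exI[of _ 1]) (auto simp: same_sign_def)
next
  case (pCons a P)
  obtain M d \<sigma> where *: "0 < d" "d \<le> 1" "\<And>s y. 0 < s \<Longrightarrow> s < d \<Longrightarrow> 0 < y \<Longrightarrow> y < s ^ M \<Longrightarrow>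
    same_sign (poly (map_poly (\<lambda>c. poly c s) P) y) (\<sigma> :: real)" using pCons.IH by blast
  show ?case
  proof (cases "a = 0")
    case True
    have **: "same_sign (poly (map_poly (\<lambda>c. poly c s) (pCons a P)) y) \<sigma>"
      if "0 < s" "s < d" "0 < y" "y < s ^ M" for s y
      using *(3)[OF that] that True by (simp add: map_poly_pCons same_sign_def zero_less_mult_iff
        mult_less_0_iff)
    show ?thesis
      by (rule exI[of _ M], rule exI[of _ d], rule exI[of _ \<sigma>]) (intro conjI allI impI *(1,2) **)
  next
    case False
    obtain i k e \<tau> where c: "0 < k" "0 < e" "e \<le> 1" "\<bar>\<tau>\<bar> = 1"
      "\<And>s. 0 < s \<Longrightarrow> s < e \<Longrightarrow> k * s ^ i \<le> \<tau> * poly a s" using poly_sign_near_0[OF False] by blast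
    obtain B where B: "B \<ge> 0" "\<And>s y. 0 < s \<Longrightarrow> s < 1 \<Longrightarrow> 0 < y \<Longrightarrow> y < 1 \<Longrightarrow>
      \<bar>poly (map_poly (\<lambda>c. poly c s) P) y\<bar> \<le> B"
      using poly_poly_bounded_01[of P] by blast
    define d' where "d' = min e (k / (B + 1))"
    have d': "0 < d'" "d' \<le> 1" using c B by (auto simp: d'_def)
    have **: "same_sign (poly (map_poly (\<lambda>c. poly c s) (pCons a P)) y) \<tau>"
      if s: "0 < s" "s < d'" "0 < y" "y < s ^ Suc i" for s y
    proof -
      let ?v = "poly (map_poly (\<lambda>c. poly c s) P) y"
      have s1: "s < e" "s < 1" "s < k / (B + 1)" using s c by (auto simp: d'_def)
      have "s ^ Suc i \<le> 1" using s s1 by (intro power_le_one) auto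
      then have y1: "y < 1" using s by simp
      have 1: "\<bar>\<tau> * (y * ?v)\<bar> = y * \<bar>?v\<bar>" using c(4) s by (simp add: abs_mult)
      have 2: "y * \<bar>?v\<bar> \<le> s ^ Suc i * B" using B(2)[of s y] s s1 y1 by (intro mult_mono) auto
      have 3: "s ^ Suc i * B \<le> s ^ i * (s * (B + 1))" using s by (simp add: algebra_simps)
      have "s * (B + 1) < k" using s1(3) B(1) by (simp add: pos_less_divide_eq)
      then have 4: "s ^ i * (s * (B + 1)) < s ^ i * k" using s(1) by simp
      have 5: "s ^ i * k \<le> \<tau> * poly a s" using c(5)[of s] s s1 by (simp add: mult.commute)
      have 6: "- \<bar>\<tau> * (y * ?v)\<bar> \<le> \<tau> * (y * ?v)" by linarith
      have "\<bar>\<tau> * (y * ?v)\<bar> < \<tau> * poly a s" unfolding 1 using 2 3 4 5 by linarith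
      with 6 have "0 < \<tau> * poly a s + \<tau> * (y * ?v)" by linarith
      then have "0 < \<tau> * poly (map_poly (\<lambda>c. poly c s) (pCons a P)) y"
        by (simp add: map_poly_pCons algebra_simps)
      then show ?thesis using c(4) by (auto simp: same_sign_def zero_less_mult_iff)
    qed
    show ?thesis
      by (rule exI[of _ "Suc i"], rule exI[of _ d'], rule exI[of _ \<tau>]) (intro conjI allI impI d' **)
  qed
qed

lemma is_hom_poly_eval: "is_hom (\<lambda>c. poly c s)"
  by (simp add: is_hom_def)

lemma polyreg_two_coords:
  assumes "f \<in> polyreg {i, j}"
  shows "\<exists>P. \<forall>z. rapp f z = poly (map_poly (\<lambda>c. poly c (z $ i)) P) (z $ j)"
  using assms
proof (induction rule: polyreg.induct)
  case (const c)
  then show ?case by (intro exI[of _ "[:[:c:]:]"]) (simp add: map_poly_pCons)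
next
  case (coord k)
  then consider "k = i" | "k = j" by blast
  then show ?case
  proof cases
    case 1
    then show ?thesis by (intro exI[of _ "[:[:0, 1:]:]"]) (simp add: map_poly_pCons)
  next
    case 2
    then show ?thesis by (intro exI[of _ "[:0, 1:]"]) (simp add: map_poly_pCons)
  qed
next
  case (add f g)
  then obtain P Q where "\<forall>z. rapp f z = poly (map_poly (\<lambda>c. poly c (z $ i)) P) (z $ j)"
    "\<forall>z. rapp g z = poly (map_poly (\<lambda>c. poly c (z $ i)) Q) (z $ j)" by blast
  then show ?case by (intro exI[of _ "P + Q"]) (simp add: map_poly_hom_add is_hom_poly_eval)
next
  case (mult f g)
  then obtain P Q where "\<forall>z. rapp f z = poly (map_poly (\<lambda>c. poly c (z $ i)) P) (z $ j)"
    "\<forall>z. rapp g z = poly (map_poly (\<lambda>c. poly c (z $ i)) Q) (z $ j)" by blast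
  then show ?case by (intro exI[of _ "P * Q"]) (simp add: map_poly_hom_mult is_hom_poly_eval)
qed

text \<open>A larger exponent and a smaller \<open>d\<close> only shrink the region, as
  \<open>z $ i < 1\<close>; so one region serves all of \<open>T\<close>.\<close>

lemma two_coords_agree:
  assumes "finite T" "T \<subseteq> polyreg {i, j}"
  shows "\<exists>M d. 0 < d \<and> d \<le> 1 \<and> (\<forall>z w. z $ i = w $ i \<longrightarrow> 0 < z $ i \<longrightarrow> z $ i < d \<longrightarrow>
    0 < z $ j \<longrightarrow> z $ j < (z $ i) ^ M \<longrightarrow> 0 < w $ j \<longrightarrow> w $ j < (z $ i) ^ M \<longrightarrow>
    agree T (\<lambda>f. rapp f z) (\<lambda>f. rapp f w))"
  using assms
proof (induction T rule: finite_induct)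
  case empty
  then show ?case by (intro exI[of _ 0] exI[of _ 1]) (auto simp: agree_def)
next
  case (insert f T)
  obtain M d where IH: "0 < d" "d \<le> 1" "\<And>z w. z $ i = w $ i \<Longrightarrow> 0 < z $ i \<Longrightarrow> z $ i < d \<Longrightarrow>
    0 < z $ j \<Longrightarrow> z $ j < (z $ i) ^ M \<Longrightarrow> 0 < w $ j \<Longrightarrow> w $ j < (z $ i) ^ M \<Longrightarrow>
    agree T (\<lambda>f. rapp f z) (\<lambda>f. rapp f w)" using insert by blast
  obtain P where P: "\<And>z. rapp f z = poly (map_poly (\<lambda>c. poly c (z $ i)) P) (z $ j)"
    using polyreg_two_coords insert.prems by blast
  obtain N e \<sigma> where e: "0 < e" "e \<le> 1" "\<And>s y. 0 < s \<Longrightarrow> s < e \<Longrightarrow> 0 < y \<Longrightarrow> y < s ^ N \<Longrightarrow>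
    same_sign (poly (map_poly (\<lambda>c. poly c s) P) y) (\<sigma> :: real)" using poly_poly_sign_near_0[of P]
      by blast
  have "agree (insert f T) (\<lambda>f. rapp f z) (\<lambda>f. rapp f w)"
    if zw: "z $ i = w $ i" "0 < z $ i" "z $ i < min d e" "0 < z $ j" "z $ j < (z $ i) ^ max M N"
      "0 < w $ j" "w $ j < (z $ i) ^ max M N" for z w
  proof -
    have "(z $ i) ^ max M N \<le> (z $ i) ^ M" "(z $ i) ^ max M N \<le> (z $ i) ^ N"
      using zw e by (intro power_decreasing; simp)+
    then have b: "z $ j < (z $ i) ^ M" "z $ j < (z $ i) ^ N" "w $ j < (z $ i) ^ M"
      "w $ j < (z $ i) ^ N"
      using zw by linarith+
    have "same_sign (rapp f z) \<sigma>" "same_sign (rapp f w) \<sigma>"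
      using e(3)[of "z $ i" "z $ j"] e(3)[of "w $ i" "w $ j"] zw b by (auto simp: P)
    then have "same_sign (rapp f z) (rapp f w)" by (simp add: same_sign_def)
    moreover have "agree T (\<lambda>f. rapp f z) (\<lambda>f. rapp f w)"
      using IH(3)[OF zw(1,2) _ zw(4) b(1) zw(6) b(3)] zw by simp
    ultimately show ?thesis by (simp add: agree_def)
  qed
  moreover have "0 < min d e" "min d e \<le> 1" using IH e by auto
  ultimately show ?case by blast
qed

text \<open>The index type \<open>'n + bool\<close> makes room for two further coordinates,
  \<open>Inr True\<close> for \<open>s\<close> and \<open>Inr False\<close> for
  \<open>y\<close>.\<close>

lemma polyreg_embed:
  assumes "p \<in> polyfun_set"
  shows "\<exists>f\<in>polyreg (range Inl). \<forall>z :: real ^ ('n + bool). rapp f z = p (\<chi> i :: 'n::finite. z $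
    Inl i)"
  using assms
proof (induction rule: polyfun_set.induct)
  case (const c)
  show ?case by (rule bexI[OF _ polyreg.const[of c]]) simp
next
  case (coord i)
  show ?case by (rule bexI[OF _ polyreg.coord[of "Inl i"]]) auto
next
  case (add p q)
  then obtain f g where "f \<in> polyreg (range Inl)" "g \<in> polyreg (range Inl)"
    "\<forall>z :: real ^ ('n + bool). rapp f z = p (\<chi> i. z $ Inl i)"
      "\<forall>z :: real ^ ('n + bool). rapp g z = q (\<chi> i. z $ Inl i)" by blast
  then show ?case by (intro bexI[of _ "f + g"]) (auto intro: polyreg.add)
next
  case (mult p q)
  then obtain f g where "f \<in> polyreg (range Inl)" "g \<in> polyreg (range Inl)"
    "\<forall>z :: real ^ ('n + bool). rapp f z = p (\<chi> i. z $ Inl i)"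
      "\<forall>z :: real ^ ('n + bool). rapp g z = q (\<chi> i. z $ Inl i)" by blast
  then show ?case by (intro bexI[of _ "f * g"]) (auto intro: polyreg.mult)
qed

lemma polyreg_mono: "f \<in> polyreg I \<Longrightarrow> I \<subseteq> J \<Longrightarrow> f \<in> polyreg J"
  by (induction rule: polyreg.induct) (auto intro: polyreg.intros)

section \<open>The Lojasiewicz inequality\<close>

text \<open>Eliminating \<open>x\<close> from the conditions \<open>norm x \<le> 1 / s\<close>, \<open>s \<le> \<bar>u x\<bar>\<close>,
  \<open>(r x)\<^sup>2 \<le> y\<close> leaves finitely
  many polynomials in \<open>s\<close> and \<open>y\<close>, whose signs are constant on a region \<open>0 < y < s ^ M\<close>. A solution
  with \<open>(r x)\<^sup>2 < s ^ M\<close> thus yields solutions for all smaller \<open>y\<close>, against compactness.\<close>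

lemma lojasiewicz_generic:
  fixes u :: "real ^ 'n \<Rightarrow> real"
  assumes pq: "p \<in> polyfun_set" "q \<in> polyfun_set" and r: "r \<in> polyfun_set"
    and u: "continuous_on UNIV u" "\<And>x. q x * u x = p x" and zero: "\<And>x. r x = 0 \<Longrightarrow> u x = 0"
  shows "\<exists>M d. 0 < d \<and> (\<forall>s x. 0 < s \<longrightarrow> s < d \<longrightarrow> q x \<noteq> 0 \<longrightarrow> norm x \<le> 1 / s \<longrightarrow> s \<le> \<bar>u x\<bar> \<longrightarrow>
    s ^ M \<le> (r x)\<^sup>2)"
proof -
  let ?x = "\<lambda>z :: real ^ ('n + bool). \<chi> i. z $ Inl i"
  let ?I = "{Inr True, Inr False} :: ('n + bool) set"
  obtain P where P: "P \<in> polyreg (range Inl)" "\<And>z. rapp P z = p (?x z)"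
    using polyreg_embed[OF pq(1)] by blast
  obtain Q where Q: "Q \<in> polyreg (range Inl)" "\<And>z. rapp Q z = q (?x z)"
    using polyreg_embed[OF pq(2)] by blast
  obtain R where R: "R \<in> polyreg (range Inl)" "\<And>z. rapp R z = r (?x z)" using polyreg_embed[OF r]
    by blast
  have "(\<lambda>x. (norm x)\<^sup>2) = (\<lambda>x :: real ^ 'n. \<Sum>i\<in>UNIV. x $ i * x $ i)"
    by (simp add: norm_vec_def L2_set_def sum_nonneg power2_eq_square[symmetric] abs_le_square_iff)
  also have "\<dots> \<in> polyfun_set" by (intro polyfun_sum polyfun_set.intros)
  finally have "(\<lambda>x :: real ^ 'n. (norm x)\<^sup>2) \<in> polyfun_set" .
  from polyreg_embed[OF this] obtain N where N: "N \<in> polyreg (range Inl)"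
    "\<And>z. rapp N z = (norm (?x z))\<^sup>2" by blast
  define s y where "s = (rcoord (Inr True) :: ('n + bool) regfun)" and "y = (rcoord (Inr False) ::
    ('n + bool) regfun)"
  \<comment> \<open>With \<open>u = p / q\<close> these encode \<open>q \<noteq> 0\<close>,
    \<open>s * norm x \<le> 1\<close>, \<open>s \<le> \<bar>u x\<bar>\<close> and
    \<open>(r x)\<^sup>2 \<le> y\<close> without division.\<close>
  define S where "S = {Q, 1 - s * s * N, P * P - s * s * (Q * Q), y - R * R}"
  let ?A = "polyreg (range Inl \<union> ?I) :: ('n + bool) regfun set"
  note sub = is_subring_diff[OF polyreg_subring] is_subring_mult[OF polyreg_subring]
  have "P \<in> ?A" "Q \<in> ?A" "R \<in> ?A" "N \<in> ?A" using P Q R N polyreg_mono by blast+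
  moreover have "s \<in> ?A" "y \<in> ?A" by (auto simp: s_def y_def intro: polyreg.coord)
  moreover have "1 \<in> ?A" using polyreg_subring by (auto simp: is_subring_def)
  ultimately have "S \<subseteq> ?A" by (auto simp: S_def intro!: sub)
  moreover have "range Inl \<inter> ?I = {}" "finite S" by (auto simp: S_def)
  ultimately obtain T where T: "finite T" "T \<subseteq> polyreg ?I"
    "\<And>x (\<psi> :: ('n + bool) regfun \<Rightarrow> real). is_hom \<psi> \<Longrightarrow> agree T (\<lambda>f. rapp f x) \<psi> \<Longrightarrow>
      \<exists>y. (\<forall>i. i \<notin> range Inl \<longrightarrow> y $ i = x $ i) \<and> agree S (\<lambda>f. rapp f y) \<psi>"
    using eliminate_coords[of "range Inl" ?I S] by (metis finite)
  obtain M d where Md: "0 < d" "d \<le> 1"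
    "\<And>z w. z $ Inr True = w $ Inr True \<Longrightarrow> 0 < z $ Inr True \<Longrightarrow> z $ Inr True < d \<Longrightarrow>
    0 < z $ Inr False \<Longrightarrow> z $ Inr False < (z $ Inr True) ^ M \<Longrightarrow> 0 < w $ Inr False \<Longrightarrow>
      w $ Inr False < (z $ Inr True) ^ M \<Longrightarrow>
    agree T (\<lambda>f. rapp f z) (\<lambda>f. rapp f w)"
    using two_coords_agree[OF T(1,2)] by blast
  have "a ^ M \<le> (r x)\<^sup>2" if a: "0 < a" "a < d" and x: "q x \<noteq> 0" "norm x \<le> 1 / a" "a \<le> \<bar>u x\<bar>" for a x
  proof (rule ccontr)
    assume "\<not> a ^ M \<le> (r x)\<^sup>2"
    then have rx: "(r x)\<^sup>2 < a ^ M" by simp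
    define K where "K = {x. norm x \<le> 1 / a \<and> a \<le> \<bar>u x\<bar>}"
    have xK: "x \<in> K" using x by (simp add: K_def)
    have "closed {x. a \<le> \<bar>u x\<bar>}" using u(1) by (intro closed_Collect_le continuous_intros)
    moreover have "K = cball 0 (1 / a) \<inter> {x. a \<le> \<bar>u x\<bar>}" by (auto simp: K_def)
    ultimately have "compact K" by (simp add: compact_Int_closed)
    moreover have "continuous_on K (\<lambda>x. (r x)\<^sup>2)" using r
      by (intro continuous_intros polyfun_continuous)
    ultimately obtain v where v: "v \<in> K" "\<And>x. x \<in> K \<Longrightarrow> (r v)\<^sup>2 \<le> (r x)\<^sup>2"
      using continuous_attains_inf[of K "\<lambda>x. (r x)\<^sup>2"] xK by blast
    have "u v \<noteq> 0" using v(1) a by (auto simp: K_def)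
    then have "r v \<noteq> 0" using zero by blast
    \<comment> \<open>\<open>b\<close> lies below the minimum of the square of \<open>r\<close> on
      \<open>K\<close>, which is positive as \<open>u\<close> has no zero there. \<open>c\<close>
      lies between \<open>(r x)\<^sup>2\<close> and \<open>a ^ M\<close>, so that \<open>x\<close>
      solves the conditions for \<open>c\<close>.\<close>
    define b where "b = min ((r v)\<^sup>2 / 2) (a ^ M / 2)"
    define c where "c = ((r x)\<^sup>2 + a ^ M) / 2"
    have aM: "0 < a ^ M" using a by simp
    have b: "0 < b" "b < a ^ M" "b < (r v)\<^sup>2" using \<open>r v \<noteq> 0\<close> aM by (auto simp: b_def min_def)
    have r2: "0 \<le> (r x)\<^sup>2" by simp
    have c: "0 < c" using aM r2 by (simp add: c_def add_nonneg_pos)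
    have c2: "c < a ^ M" "(r x)\<^sup>2 \<le> c" using rx unfolding c_def by (simp_all add: field_simps)
    define z :: "real \<Rightarrow> real ^ ('n + bool)"
      where "z = (\<lambda>t. \<chi> i. case i of Inl j \<Rightarrow> x $ j | Inr k \<Rightarrow> if k then a else t)"
    have zc: "z t $ Inr True = a" "z t $ Inr False = t" "?x (z t) = x" for t
      by (simp_all add: z_def vec_eq_iff)
    have "agree T (\<lambda>f. rapp f (z b)) (\<lambda>f. rapp f (z c))"
      by (rule Md(3)) (use a b c c2 in \<open>simp_all add: zc\<close>)
    \<comment> \<open>Evaluation at the solved point \<open>z c\<close> acts as the homomorphism,
      and the solution is moved over the parameter \<open>b\<close>.\<close>
    from T(3)[OF is_hom_rapp this] obtain w where
      w: "\<And>i. i \<notin> range Inl \<Longrightarrow> w $ i = z b $ i" "agree S (\<lambda>f. rapp f w) (\<lambda>f. rapp f (z c))" by blast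
    have wc: "w $ Inr True = a" "w $ Inr False = b"
      using w(1)[of "Inr True"] w(1)[of "Inr False"] zc by auto
    have sc: "rapp s w = a" "rapp y w = b" "rapp s (z c) = a" "rapp y (z c) = c"
      by (simp_all add: s_def y_def wc zc)
    have ax: "a * norm x \<le> 1" using x(2) a by (simp add: field_simps)
    have "0 \<le> rapp (1 - s * s * N) (z c)"
      using power_mono[OF ax, of 2] a by (simp add: N sc zc power2_eq_square mult_ac)
    moreover have "0 \<le> rapp (P * P - s * s * (Q * Q)) (z c)"
    proof -
      have "a\<^sup>2 \<le> (u x)\<^sup>2" using x(3) a by (metis abs_le_square_iff abs_of_pos)
      then have "(q x)\<^sup>2 * a\<^sup>2 \<le> (q x)\<^sup>2 * (u x)\<^sup>2" by (intro mult_left_mono) auto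
      then show ?thesis by (simp add: P Q sc zc power2_eq_square mult_ac flip: u(2))
    qed
    moreover have "0 \<le> rapp (y - R * R) (z c)" using c2(2) by (simp add: R sc zc power2_eq_square)
    moreover have "rapp Q (z c) \<noteq> 0" using x(1) by (simp add: Q zc)
    ultimately have g: "0 \<le> rapp (1 - s * s * N) w" "0 \<le> rapp (P * P - s * s * (Q * Q)) w"
      "0 \<le> rapp (y - R * R) w" "rapp Q w \<noteq> 0"
      using w(2) same_sign_zero[of "rapp Q w" "rapp Q (z c)"]
      unfolding agree_def S_def same_sign_def
        by (auto simp: not_less[symmetric] simp del: rapp_simps)
    define t where "t = ?x w"
    have qt: "q t \<noteq> 0" using g(4) by (simp add: Q t_def)
    have "(a * norm t)\<^sup>2 \<le> 1\<^sup>2" using g(1) by (simp add: N sc t_def power2_eq_square mult_ac)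
    then have "a * norm t \<le> 1" by (rule power2_le_imp_le) simp
    then have "norm t \<le> 1 / a" using a by (simp add: field_simps)
    moreover have "(q t)\<^sup>2 * a\<^sup>2 \<le> (q t)\<^sup>2 * (u t)\<^sup>2"
      using g(2) by (simp add: P Q sc power2_eq_square mult_ac t_def flip: u(2))
    then have "a\<^sup>2 \<le> (u t)\<^sup>2" using qt by simp
    then have "a \<le> \<bar>u t\<bar>" using a by (simp add: abs_le_square_iff[symmetric])
    ultimately have "t \<in> K" by (simp add: K_def)
    then have "(r v)\<^sup>2 \<le> (r t)\<^sup>2" by (rule v(2))
    moreover have "(r t)\<^sup>2 \<le> b" using g(3) by (simp add: R sc t_def power2_eq_square)
    ultimately show False using b(3) by linarith
  qed
  then show ?thesis using Md(1) by blast
qed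

text \<open>With strict inequalities the conditions define an open set, in which the points with
  \<open>q x \<noteq> 0\<close> are dense; the conclusion is a closed condition.\<close>

lemma lojasiewicz:
  fixes u :: "real ^ 'n \<Rightarrow> real"
  assumes u: "regulous u" and r: "r \<in> polyfun_set" and zero: "\<And>x. r x = 0 \<Longrightarrow> u x = 0"
  shows "\<exists>M d. 0 < d \<and> (\<forall>s x. 0 < s \<longrightarrow> s < d \<longrightarrow> norm x < 1 / s \<longrightarrow> s < \<bar>u x\<bar> \<longrightarrow> s ^ M \<le> (r x)\<^sup>2)"
proof -
  obtain p q z where pq: "continuous_on UNIV u" "p \<in> polyfun_set" "q \<in> polyfun_set" "q z \<noteq> 0"
    "\<And>x. q x * u x = p x"
    using u unfolding regulous_iff by blast
  obtain M d where Md: "0 < d" "\<And>s x. 0 < s \<Longrightarrow> s < d \<Longrightarrow> q x \<noteq> 0 \<Longrightarrow> norm x \<le> 1 / s \<Longrightarrow> s \<le> \<bar>u x\<bar> \<Longrightarrow>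
    s ^ M \<le> (r x)\<^sup>2"
    using lojasiewicz_generic[OF pq(2,3) r pq(1,5) zero] by blast
  have "s ^ M \<le> (r x)\<^sup>2" if s: "0 < s" "s < d" and x: "norm x < 1 / s" "s < \<bar>u x\<bar>" for s x
  proof -
    define A where "A = {x. norm x < 1 / s} \<inter> {x. s < \<bar>u x\<bar>}"
    have "open A" unfolding A_def using pq(1)
      by (intro open_Int open_Collect_less continuous_intros)
    have "closed {x. s ^ M \<le> (r x)\<^sup>2}" using r
      by (intro closed_Collect_le continuous_intros polyfun_continuous)
    moreover have "A \<inter> {x. q x \<noteq> 0} \<subseteq> {x. s ^ M \<le> (r x)\<^sup>2}" using Md(2)[OF s] by (auto simp: A_def)
    ultimately have "closure (A \<inter> {x. q x \<noteq> 0}) \<subseteq> {x. s ^ M \<le> (r x)\<^sup>2}" by (intro closure_minimal)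
    moreover have "A \<inter> closure {x. q x \<noteq> 0} \<subseteq> closure (A \<inter> {x. q x \<noteq> 0})"
      using \<open>open A\<close> by (rule open_Int_closure_subset)
    moreover have "x \<in> A" using x by (simp add: A_def)
    ultimately show ?thesis using polyfun_nonzero_dense[OF pq(3,4)] by auto
  qed
  then show ?thesis using Md(1) by blast
qed

text \<open>The Lojasiewicz inequality with \<open>s\<close> equal to half of
  \<open>\<bar>u y\<bar>\<close> bounds the quotient near a zero of \<open>r\<close> by
  \<open>2 ^ M * \<bar>u y\<bar>\<close>, so it tends to \<open>0\<close> there; the extra factor in
  \<open>Suc M\<close> is what remains.\<close>

lemma regulous_nullstellensatz:
  fixes u :: "real ^ 'n \<Rightarrow> real"
  assumes u: "regulous u" and r: "r \<in> polyfun_set" and zero: "\<And>x. r x = 0 \<Longrightarrow> u x = 0"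
  obtains M v where "regulous v" "\<And>x. (r x)\<^sup>2 * v x = u x ^ Suc M"
proof (cases "\<exists>c. r c \<noteq> 0")
  case False
  then have "u x = 0" "r x = 0" for x using zero by auto
  then show ?thesis using that[of "\<lambda>_. 0" 0] polyfun_regulous[OF polyfun_set.const] by auto
next
  case True
  then obtain c where c: "r c \<noteq> 0" by blast
  obtain M d where Md: "0 < d" "\<And>s x. 0 < s \<Longrightarrow> s < d \<Longrightarrow> norm x < 1 / s \<Longrightarrow> s < \<bar>u x\<bar> \<Longrightarrow> s ^ M \<le> (r x)\<^sup>2"
    using lojasiewicz[OF u r zero] by blast
  have cu: "continuous_on UNIV u" using u by (simp add: regulous_iff)
  define v where "v = (\<lambda>x. u x ^ Suc M / (r x)\<^sup>2)"
  have rv: "(r x)\<^sup>2 * v x = u x ^ Suc M" for x using zero by (auto simp: v_def)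
  have "isCont v x" for x
  proof (cases "r x = 0")
    case False
    have "isCont r x" "isCont u x"
      using polyfun_continuous[OF r, of UNIV] cu by (simp_all add: continuous_on_eq_continuous_at)
    then show ?thesis unfolding v_def using False by (intro continuous_intros) auto
  next
    case True
    then have ux: "u x = 0" by (rule zero)
    have v0: "v x = 0" using True by (simp add: v_def)
    have ut: "(u \<longlongrightarrow> 0) (at x)"
    proof -
      have "isCont u x" using cu by (simp add: continuous_on_eq_continuous_at)
      then show ?thesis by (simp only: isCont_def ux)
    qed
    \<comment> \<open>Ensures both \<open>s < d\<close> and
      \<open>norm y < norm x + 1 < 1 / s\<close> for the \<open>s\<close> chosen below.\<close>
    define e where "e = min d (1 / (norm x + 1))"
    have "0 < norm x + 1" using norm_ge_zero[of x] by linarith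
    then have e: "0 < e" using Md by (simp add: e_def)
    have "eventually (\<lambda>y. \<bar>u y\<bar> < e) (at x)"
      using tendstoD[OF ut e] by (simp add: dist_real_def)
    moreover have "eventually (\<lambda>y. norm y < norm x + 1) (at x)"
    proof -
      have "(norm \<longlongrightarrow> norm x) (at x)" by (rule tendsto_norm[OF tendsto_ident_at])
      from order_tendstoD(2)[OF this, of "norm x + 1"] show ?thesis by simp
    qed
    ultimately have "eventually (\<lambda>y. norm (v y) \<le> 2 ^ M * \<bar>u y\<bar>) (at x)"
    proof eventually_elim
      case (elim y)
      show ?case
      proof (cases "u y = 0")
        case True
        then show ?thesis by (simp add: v_def)
      next
        case False
        \<comment> \<open>Half, since \<open>s\<close> has to stay strictly below
          \<open>\<bar>u y\<bar>\<close>; this produces the factor \<open>2 ^ M\<close>.\<close>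
        define s where "s = \<bar>u y\<bar> / 2"
        have s: "0 < s" "s < \<bar>u y\<bar>" "s < e" using False elim by (auto simp: s_def)
        then have "s < d" "s < 1 / (norm x + 1)" by (auto simp: e_def)
        then have "norm x + 1 < 1 / s"
          using s(1) \<open>0 < norm x + 1\<close> by (simp add: less_divide_eq mult.commute)
        then have "s ^ M \<le> (r y)\<^sup>2" using Md(2)[OF s(1) \<open>s < d\<close> _ s(2)] elim by linarith
        moreover have "0 < s ^ M" using s by simp
        ultimately have "s ^ M / (r y)\<^sup>2 \<le> 1" by (simp add: divide_le_eq_1)
        then have "2 ^ M * \<bar>u y\<bar> * (s ^ M / (r y)\<^sup>2) \<le> 2 ^ M * \<bar>u y\<bar> * 1"
          by (intro mult_left_mono) auto
        moreover have "norm (v y) = 2 ^ M * \<bar>u y\<bar> * (s ^ M / (r y)\<^sup>2)"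
        proof -
          have "norm (v y) = \<bar>u y\<bar> * \<bar>u y\<bar> ^ M / (r y)\<^sup>2"
            unfolding v_def real_norm_def abs_divide power_abs abs_power2 by simp
          also have "\<bar>u y\<bar> ^ M = 2 ^ M * s ^ M"
            unfolding s_def power_mult_distrib[symmetric] by simp
          finally show ?thesis by simp
        qed
        ultimately show ?thesis by simp
      qed
    qed
    moreover have "((\<lambda>y. 2 ^ M * \<bar>u y\<bar>) \<longlongrightarrow> 2 ^ M * \<bar>0\<bar>) (at x)" by (intro tendsto_intros ut)
    ultimately have "(v \<longlongrightarrow> 0) (at x)" by (intro Lim_null_comparison[of v "\<lambda>y. 2 ^ M * \<bar>u y\<bar>"]) auto
    then show ?thesis by (simp add: isCont_def v0)
  qed
  then have "continuous_on UNIV v" by (simp add: continuous_on_eq_continuous_at)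
  moreover have "regulous (\<lambda>x. u x ^ Suc M)"
  proof (induction M)
    case (Suc M)
    then show ?case using regulous_mult[OF u Suc] by simp
  qed (use u in simp)
  moreover have "regulous (\<lambda>x. (r x)\<^sup>2)" by (rule polyfun_regulous[OF polyfun_power[OF r]])
  ultimately have "regulous v"
    using rv c by (intro regulous_quotient[where w = v and a = "\<lambda>x. u x ^ Suc M" and b = "\<lambda>x. (r
      x)\<^sup>2" and c = c]) simp_all
  then show ?thesis using rv that by blast
qed

lemma limit_const_coeffs:
  fixes P Q :: "real poly" and g :: "real \<Rightarrow> real"
  assumes g: "(g \<longlongrightarrow> l) (at_right 0)" and eq: "\<And>t. 0 < t \<Longrightarrow> poly Q t * g t = poly P t"
  shows "coeff Q 0 * l = coeff P 0"
proof -
  have poly0: "(poly p \<longlongrightarrow> poly p 0) (at_right 0)" for p :: "real poly"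
  proof -
    have "isCont (poly p) 0" by (rule poly_isCont)
    then show ?thesis by (auto simp: isCont_def intro: tendsto_mono[OF at_le[OF subset_UNIV]])
  qed
  have "((\<lambda>t. poly Q t * g t) \<longlongrightarrow> poly Q 0 * l) (at_right 0)" by (intro tendsto_mult poly0 g)
  moreover have "eventually (\<lambda>t. poly Q t * g t = poly P t) (at_right 0)"
    using eventually_at_right_less[of 0] by eventually_elim (rule eq)
  ultimately have "(poly P \<longlongrightarrow> poly Q 0 * l) (at_right 0)" by (simp add: tendsto_cong)
  then have "poly Q 0 * l = poly P 0" by (rule tendsto_unique[rotated]) (simp_all add: poly0)
  then show ?thesis by (simp add: poly_0_coeff_0)
qed

text \<open>As \<open>g\<close> has a limit, a vanishing constant term of \<open>Q\<close> forces
  one of \<open>P\<close>; dividing both by the variable reduces \<open>k\<close>.\<close>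

lemma limit_coeffs:
  fixes P Q :: "real poly" and g :: "real \<Rightarrow> real"
  assumes g: "(g \<longlongrightarrow> l) (at_right 0)" and eq: "\<And>t. 0 < t \<Longrightarrow> poly Q t * g t = poly P t"
    and Q: "\<And>j. j < k \<Longrightarrow> coeff Q j = 0"
  shows "coeff Q k * l = coeff P k"
  using eq Q
proof (induction k arbitrary: P Q)
  case 0
  then show ?case using limit_const_coeffs[OF g] by blast
next
  case (Suc k)
  obtain a Q' where Q': "Q = pCons a Q'" by (cases Q)
  obtain b P' where P': "P = pCons b P'" by (cases P)
  have "a = 0" using Suc.prems(2)[of 0] Q' by simp
  moreover have "coeff Q 0 * l = coeff P 0"
    using limit_const_coeffs[OF g Suc.prems(1)] .
  ultimately have "b = 0" using P' Q' by simp
  have "coeff Q' k * l = coeff P' k"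
  proof (rule Suc.IH)
    show "poly Q' t * g t = poly P' t" if "0 < t" for t
      using Suc.prems(1)[of t] that \<open>a = 0\<close> \<open>b = 0\<close> Q' P' by simp
    show "coeff Q' j = 0" if "j < k" for j using Suc.prems(2)[of "Suc j"] that Q' by simp
  qed
  then show ?case using Q' P' by simp
qed

section \<open>Homomorphisms to real closed fields\<close>

text \<open>The denominator \<open>q\<close> of \<open>f\<close> may be mapped to \<open>0\<close>. Restricting \<open>f = p / q\<close> to the lines from
  \<open>x\<close> to a point \<open>z\<close> with \<open>q z \<noteq> 0\<close> and expanding in the line parameter gives coefficients \<open>a k\<close>
  and \<open>b k\<close>; the \<open>b k\<close> add up to \<open>q z\<close>, so one of them is not mapped to \<open>0\<close>. For the first such
  \<open>k\<close>, \<open>f\<close> equals \<open>a k / b k\<close> on the common zeros of the preceding \<open>b j\<close>.\<close>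

theorem hom_nonneg:
  fixes \<psi> :: "'n::finite regfun \<Rightarrow> 'b::real_closed_field"
  assumes \<psi>: "is_hom \<psi>" and f: "\<And>x. rapp f x \<ge> 0"
  shows "0 \<le> \<psi> f"
proof -
  obtain p q z where pq: "continuous_on UNIV (rapp f)" "p \<in> polyfun_set" "q \<in> polyfun_set" "q z \<noteq> 0"
    "\<And>x. q x * rapp f x = p x"
    using regulous_rapp[of f] unfolding regulous_iff by blast
  obtain P where P: "\<And>k. (\<lambda>x. coeff (P x) k) \<in> polyfun_set"
    "\<And>x t. p (x + t *\<^sub>R (z - x)) = poly (P x) t"
    using polyfun_on_lines[OF pq(2)] by blast
  obtain Q N where Q: "\<And>k. (\<lambda>x. coeff (Q x) k) \<in> polyfun_set" "\<And>x. degree (Q x) \<le> N"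
    "\<And>x t. q (x + t *\<^sub>R (z - x)) = poly (Q x) t"
    using polyfun_on_lines[OF pq(3)] by blast
  define a where "a = (\<lambda>k. Abs_regfun (\<lambda>x. coeff (P x) k))"
  define b where "b = (\<lambda>k. Abs_regfun (\<lambda>x. coeff (Q x) k))"
  have a: "rapp (a k) = (\<lambda>x. coeff (P x) k)" and b: "rapp (b k) = (\<lambda>x. coeff (Q x) k)" for k
    using P(1) Q(1) by (auto simp: a_def b_def intro!: rapp_Abs polyfun_regulous)
  have ab: "a k \<in> polyreg UNIV" "b k \<in> polyreg UNIV" for k
    unfolding polyreg_UNIV_iff a b by (rule P(1), rule Q(1))
  have "(\<Sum>k\<le>N. b k) = rconst (q z)"
  proof (rule rapp_eqI)
    fix x
    have "(\<Sum>k\<le>N. coeff (Q x) k) = poly (Q x) 1"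
      unfolding poly_altdef using Q(2)[of x]
      by (simp add: sum.mono_neutral_right[of "{..N}" "{..degree (Q x)}"] coeff_eq_0)
    then show "rapp (\<Sum>k\<le>N. b k) x = rapp (rconst (q z)) x" using Q(3)[of x 1] by (simp add: b)
  qed
  then have "(\<Sum>k\<le>N. \<psi> (b k)) = \<psi> (rconst (q z))" using is_hom_sum[OF \<psi>] by metis
  moreover have "\<psi> (rconst (q z)) \<noteq> 0"
    using same_sign_zero[OF hom_rconst_sign[OF \<psi>, of "q z"]] pq(4) by blast
  ultimately have "\<exists>k. \<psi> (b k) \<noteq> 0" by (metis sum.neutral)
  then obtain k where k: "\<psi> (b k) \<noteq> 0" "\<And>j. j < k \<Longrightarrow> \<psi> (b j) = 0"
    using exists_least_iff[of "\<lambda>k. \<psi> (b k) \<noteq> 0"] by blast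
  \<comment> \<open>Over the reals the single equation \<open>r = 0\<close> expresses that all
    preceding \<open>b j\<close> vanish.\<close>
  define r where "r = (\<Sum>j<k. b j * b j)"
  have r: "r \<in> polyreg UNIV"
    unfolding r_def using ab by (intro is_subring_sum polyreg_subring polyreg.mult)
  have r0: "\<psi> r = 0" unfolding r_def by (simp add: is_hom_sum[OF \<psi>] is_hom_mult[OF \<psi>] k)
  have lim: "rapp f x * coeff (Q x) k = coeff (P x) k" if x: "rapp r x = 0" for x
  proof -
    have "(\<Sum>j<k. rapp (b j) x * rapp (b j) x) = 0" using x by (simp add: r_def)
    then have z: "coeff (Q x) j = 0" if "j < k" for j
      using that by (simp add: sum_nonneg_eq_0_iff b)
    define g where "g = (\<lambda>t. rapp f (x + t *\<^sub>R (z - x)))"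
    have "continuous_on UNIV g"
      unfolding g_def by (rule continuous_on_compose2[OF pq(1)]) (auto intro!: continuous_intros)
    then have "isCont g 0" by (simp add: continuous_on_eq_continuous_at)
    then have "(g \<longlongrightarrow> g 0) (at_right 0)"
      by (auto simp: isCont_def intro: tendsto_mono[OF at_le[OF subset_UNIV]])
    then have "coeff (Q x) k * g 0 = coeff (P x) k"
      by (rule limit_coeffs) (use pq(5) P(2) Q(3) z in \<open>auto simp: g_def simp flip: P(2) Q(3)\<close>)
    then show ?thesis by (simp add: g_def mult.commute)
  qed
  define u where "u = f * b k - a k"
  have "rapp u x = 0" if "rapp r x = 0" for x using lim[OF that] by (simp add: u_def a b)
  then obtain M v where v: "regulous v" "\<And>x. (rapp r x)\<^sup>2 * v x = rapp u x ^ Suc M"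
    using regulous_nullstellensatz[of "rapp u" "rapp r"] regulous_rapp r polyreg_UNIV_iff by metis
  \<comment> \<open>The vanishing of \<open>u\<close> on the zeros of \<open>r\<close> becomes an
    identity in the ring, which any homomorphism respects.\<close>
  have "u ^ Suc M = r * r * Abs_regfun v"
    by (rule rapp_eqI) (use v in \<open>simp add: rapp_Abs power2_eq_square\<close>)
  then have "\<psi> (u ^ Suc M) = \<psi> (r * r * Abs_regfun v)" by (rule arg_cong)
  then have "\<psi> u ^ Suc M = 0"
    unfolding is_hom_power[OF \<psi>] is_hom_mult[OF \<psi>] r0 mult_zero_left .
  then have "\<psi> u = 0" by auto
  then have ab\<psi>: "\<psi> f * \<psi> (b k) = \<psi> (a k)" by (simp add: u_def is_hom_simps[OF \<psi>])
  \<comment> \<open>The sign to be transferred is that of \<open>a k * b k\<close>, which on the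
    zeros of \<open>r\<close> is \<open>f\<close> times a square; listing \<open>r\<close> keeps the
    real point on these zeros.\<close>
  have "finite {r, b k, a k * b k}" "{r, b k, a k * b k} \<subseteq> polyreg UNIV"
    using r ab by (auto intro: polyreg.mult)
  then obtain x where x: "agree {r, b k, a k * b k} (\<lambda>f. rapp f x) \<psi>" using artin_lang[OF \<psi>]
    by blast
  have "rapp r x = 0" using x r0 same_sign_zero[of "rapp r x" "\<psi> r"] by (simp add: agree_def)
  then have "rapp (a k * b k) x = rapp f x * (coeff (Q x) k)\<^sup>2"
    using lim[of x] by (simp add: a b power2_eq_square mult_ac flip: lim)
  then have "0 \<le> rapp (a k * b k) x" using f by simp
  then have "\<not> \<psi> (a k * b k) < 0" using x unfolding agree_def same_sign_def
    by (auto simp del: rapp_simps)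
  then have "0 \<le> \<psi> f * (\<psi> (b k))\<^sup>2" by (simp add: is_hom_mult[OF \<psi>] power2_eq_square mult_ac flip:
    ab\<psi>)
  then show ?thesis using k(1) by (simp add: zero_le_mult_iff)
qed

section \<open>Prime cones\<close>

definition preordering :: "'a::comm_ring_1 set \<Rightarrow> bool" where
  "preordering P \<longleftrightarrow> (\<forall>x\<in>P. \<forall>y\<in>P. x + y \<in> P \<and> x * y \<in> P) \<and> (\<forall>x. x * x \<in> P)"

text \<open>A point of the real spectrum: the elements \<open>x\<close> with both \<open>x\<close>
  and \<open>- x\<close> in \<open>P\<close> form a prime ideal, the support, and \<open>P\<close>
  orders the residue ring.\<close>

definition prime_cone :: "'a::comm_ring_1 set \<Rightarrow> bool" where
  "prime_cone P \<longleftrightarrow> preordering P \<and> - 1 \<notin> P \<and> (\<forall>x. x \<in> P \<or> - x \<in> P) \<and>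
     (\<forall>x y. x * y \<in> P \<and> - (x * y) \<in> P \<longrightarrow> x \<in> P \<and> - x \<in> P \<or> y \<in> P \<and> - y \<in> P)"

inductive_set sum_squares :: "'a::comm_ring_1 set" where
  zero: "0 \<in> sum_squares"
| add: "s \<in> sum_squares \<Longrightarrow> x * x + s \<in> sum_squares"

lemma preordering_add: "preordering P \<Longrightarrow> x \<in> P \<Longrightarrow> y \<in> P \<Longrightarrow> x + y \<in> P"
  and preordering_mult: "preordering P \<Longrightarrow> x \<in> P \<Longrightarrow> y \<in> P \<Longrightarrow> x * y \<in> P"
  and preordering_square: "preordering P \<Longrightarrow> x * x \<in> P"
  by (simp_all add: preordering_def)

lemma preordering_0_1: "preordering P \<Longrightarrow> 0 \<in> P" "preordering P \<Longrightarrow> 1 \<in> P"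
  using preordering_square[of P 0] preordering_square[of P 1] by simp_all

lemma sum_squares_square: "x * x \<in> sum_squares"
  using sum_squares.add[OF sum_squares.zero, of x] by simp

lemma sum_squares_add: "s \<in> sum_squares \<Longrightarrow> t \<in> sum_squares \<Longrightarrow> s + t \<in> sum_squares"
  by (induction rule: sum_squares.induct) (auto simp: add.assoc intro: sum_squares.add)

lemma sum_squares_mult_square: "s \<in> sum_squares \<Longrightarrow> x * x * s \<in> sum_squares"
proof (induction rule: sum_squares.induct)
  case (add s y)
  have "x * x * (y * y + s) = (x * y) * (x * y) + x * x * s" by (simp add: algebra_simps)
  then show ?case using add sum_squares.add by metis
qed (simp add: sum_squares.zero)

lemma sum_squares_mult: "s \<in> sum_squares \<Longrightarrow> t \<in> sum_squares \<Longrightarrow> s * t \<in> sum_squares"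
  by (induction rule: sum_squares.induct)
     (auto simp: distrib_right intro: sum_squares.zero sum_squares_add sum_squares_mult_square)

lemma preordering_sum_squares: "preordering sum_squares"
  by (simp add: preordering_def sum_squares_add sum_squares_mult sum_squares_square)

lemma preordering_adjoin:
  assumes "preordering P"
  shows "preordering {x + a * y | x y. x \<in> P \<and> y \<in> P}"
  unfolding preordering_def
proof (intro conjI ballI allI)
  let ?Q = "{x + a * y | x y. x \<in> P \<and> y \<in> P}"
  note cl = preordering_add[OF assms] preordering_mult[OF assms] preordering_square[OF assms]
  fix u v assume "u \<in> ?Q" "v \<in> ?Q"
  then obtain x y x' y' where *: "u = x + a * y" "v = x' + a * y'" "x \<in> P" "y \<in> P" "x' \<in> P"
    "y' \<in> P" by blast
  have 1: "u + v = (x + x') + a * (y + y')" using * by (simp add: algebra_simps)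
  have 2: "u * v = (x * x' + (a * a) * (y * y')) + a * (x * y' + y * x')" using *
    by (simp add: algebra_simps)
  show "u + v \<in> ?Q"
    unfolding 1 mem_Collect_eq by (rule exI, rule exI, rule conjI[OF refl]) (intro conjI cl *)
  show "u * v \<in> ?Q"
    unfolding 2 mem_Collect_eq by (rule exI, rule exI, rule conjI[OF refl]) (intro conjI cl *)
next
  fix u
  have "u * u = u * u + a * 0" by simp
  then show "u * u \<in> {x + a * y | x y. x \<in> P \<and> y \<in> P}"
    using preordering_square[OF assms] preordering_0_1[OF assms] by blast
qed

text \<open>By maximality, each \<open>a\<close> outside \<open>P\<close> yields an identity
  \<open>- (f ^ (2 * N)) = x + a * y\<close> over \<open>P\<close>. Multiplying two such identities
  gives another excluded power in \<open>P\<close>; the exponents are even so that the powers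
  themselves, being squares, lie in \<open>P\<close>.\<close>

lemma prime_cone_of_maximal:
  fixes f :: "'a::comm_ring_1"
  assumes P: "preordering P" "\<And>N. - (f ^ (2 * N)) \<notin> P"
    and max: "\<And>Q. preordering Q \<Longrightarrow> P \<subseteq> Q \<Longrightarrow> (\<And>N. - (f ^ (2 * N)) \<notin> Q) \<Longrightarrow> Q = P"
  shows "prime_cone P"
proof -
  note cl = preordering_add[OF P(1)] preordering_mult[OF P(1)] preordering_square[OF P(1)]
  have sq: "f ^ (2 * N) \<in> P" for N using cl(3)[of "f ^ N"] by (simp add: mult_2 power_add)
  have ext: "\<exists>N x y. x \<in> P \<and> y \<in> P \<and> - (f ^ (2 * N)) = x + a * y" if a: "a \<notin> P" for a
  proof (rule ccontr)
    assume no: "\<not> ?thesis"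
    let ?Q = "{x + a * y | x y. x \<in> P \<and> y \<in> P}"
    have "?Q = P"
    proof (rule max)
      show "preordering ?Q" by (rule preordering_adjoin[OF P(1)])
      show "P \<subseteq> ?Q" using preordering_0_1[OF P(1)] by force
      show "- (f ^ (2 * N)) \<notin> ?Q" for N using no by blast
    qed
    moreover have "0 + a * 1 \<in> ?Q" using preordering_0_1[OF P(1)] by blast
    ultimately show False using a by simp
  qed
  have total: "x \<in> P \<or> - x \<in> P" for x
  proof (rule ccontr)
    assume "\<not> ?thesis"
    then obtain N u v M s t where *: "u \<in> P" "v \<in> P" "- (f ^ (2 * N)) = u + x * v"
      "s \<in> P" "t \<in> P" "- (f ^ (2 * M)) = s + (- x) * t" using ext[of x] ext[of "- x"] by blast
    have 1: "x * v = - (f ^ (2 * N)) - u" and 2: "x * t = f ^ (2 * M) + s" using *(3,6)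
      by (simp_all add: algebra_simps)
    \<comment> \<open>Multiplying the identities for \<open>x\<close> and \<open>- x\<close> leaves
      \<open>x\<close> only through its square.\<close>
    have "x * x * (v * t) = (x * v) * (x * t)" by (simp add: algebra_simps)
    also have "\<dots> = - (f ^ (2 * (N + M))) - (f ^ (2 * N) * s + u * f ^ (2 * M) + u * s)"
      unfolding 1 2 by (simp add: algebra_simps power_add)
    finally have "- (f ^ (2 * (N + M))) = x * x * (v * t) + (f ^ (2 * N) * s + u * f ^ (2 * M) + u
      * s)"
      by (simp add: algebra_simps)
    moreover have "\<dots> \<in> P" using * sq cl by (intro cl)
    ultimately show False using P(2) by metis
  qed
  \<comment> \<open>Outside the support, some multiple of \<open>x\<close> or \<open>- x\<close> by
    an element of \<open>P\<close> is a power of \<open>f\<close> plus an element of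
    \<open>P\<close>; two such relations can be multiplied.\<close>
  have half: "\<exists>N u t. u \<in> P \<and> t \<in> P \<and> x * t = f ^ (2 * N) + u \<or> u \<in> P \<and> t \<in> P \<and>
    - x * t = f ^ (2 * N) + u"
    if nx: "\<not> (x \<in> P \<and> - x \<in> P)" for x
  proof -
    consider "x \<notin> P" | "- x \<notin> P" using nx by blast
    then show ?thesis
    proof cases
      case 1
      then obtain N u t where ut: "u \<in> P" "t \<in> P" "- (f ^ (2 * N)) = u + x * t" using ext by blast
      have "- x * t = u - (u + x * t)" by simp
      also have "\<dots> = f ^ (2 * N) + u" unfolding ut(3)[symmetric] by simp
      finally have "- x * t = f ^ (2 * N) + u" .
      then show ?thesis using ut(1,2) by blast
    next
      case 2
      then obtain N u t where "u \<in> P" "t \<in> P" "- (f ^ (2 * N)) = u + (- x) * t" using ext by blast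
      then have "x * t = f ^ (2 * N) + u" by (simp add: algebra_simps)
      then show ?thesis using \<open>u \<in> P\<close> \<open>t \<in> P\<close> by blast
    qed
  qed
  have prime: "x \<in> P \<and> - x \<in> P \<or> y \<in> P \<and> - y \<in> P" if xy: "x * y \<in> P" "- (x * y) \<in> P" for x y
  proof (rule ccontr)
    assume "\<not> ?thesis"
    then obtain N u t M v s where *: "u \<in> P" "t \<in> P"
      "x * t = f ^ (2 * N) + u \<or> - x * t = f ^ (2 * N) + u"
      "v \<in> P" "s \<in> P" "y * s = f ^ (2 * M) + v \<or> - y * s = f ^ (2 * M) + v"
      using half[of x] half[of y] by blast
    then obtain e where e: "e = x * y \<or> e = - (x * y)"
      "e * (t * s) = (f ^ (2 * N) + u) * (f ^ (2 * M) + v)"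
    proof -
      have "(x * y) * (t * s) = (x * t) * (y * s)" "- (x * y) * (t * s) = (- x * t) * (y * s)"
        "- (x * y) * (t * s) = (x * t) * (- y * s)" "(x * y) * (t * s) = (- x * t) * (- y * s)"
        by (simp_all add: algebra_simps)
      then show ?thesis using that[of "x * y"] that[of "- (x * y)"] *(3,6) by metis
    qed
    have "- e \<in> P" using e(1) xy by auto
    have "- (f ^ (2 * (N + M))) = (- e) * (t * s) + (f ^ (2 * N) * v + u * f ^ (2 * M) + u * v)"
      using e(2) by (simp add: algebra_simps power_add)
    moreover have "\<dots> \<in> P" using * sq \<open>- e \<in> P\<close> by (intro cl)
    ultimately show False using P(2) by metis
  qed
  have "- 1 \<notin> P" using P(2)[of 0] by simp
  then show ?thesis using P(1) total prime unfolding prime_cone_def by blast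
qed

text \<open>Without such an identity the preordering generated by \<open>- f\<close> avoids all
  \<open>- (f ^ (2 * N))\<close>. A maximal one above it is a prime cone, which by hypothesis
  contains \<open>f\<close> too, hence also the excluded \<open>- (f * f)\<close>.\<close>

theorem formal_positivstellensatz:
  fixes f :: "'a::comm_ring_1"
  assumes "\<And>P. prime_cone P \<Longrightarrow> f \<in> P"
  shows "\<exists>g\<in>sum_squares. \<exists>h\<in>sum_squares. \<exists>N. f * g = f ^ (2 * N) + h"
proof (rule ccontr)
  assume no: "\<not> ?thesis"
  define A where "A = {P. preordering P \<and> - f \<in> P \<and> (\<forall>N. - (f ^ (2 * N)) \<notin> P)}"
  let ?Q = "{x + (- f) * y | x y. x \<in> sum_squares \<and> y \<in> sum_squares}"
  have "preordering ?Q" by (rule preordering_adjoin[OF preordering_sum_squares])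
  moreover have "0 + (- f) * (1 * 1) \<in> ?Q" using sum_squares.zero sum_squares_square by blast
  moreover have "- (f ^ (2 * N)) \<notin> ?Q" for N
  proof
    assume "- (f ^ (2 * N)) \<in> ?Q"
    then obtain x y where "x \<in> sum_squares" "y \<in> sum_squares" "- (f ^ (2 * N)) = x + (- f) * y"
      by blast
    moreover from this have "f * y = f ^ (2 * N) + x" by (simp add: algebra_simps)
    ultimately show False using no by blast
  qed
  ultimately have "?Q \<in> A" by (simp add: A_def)
  moreover have "\<Union>C \<in> A" if C: "C \<noteq> {}" "subset.chain A C" for C
  proof -
    have CA: "P \<in> A" if "P \<in> C" for P using C(2) that by (auto simp: subset.chain_def)
    have dir: "\<exists>P\<in>C. x \<in> P \<and> y \<in> P" if xy: "x \<in> \<Union>C" "y \<in> \<Union>C" for x y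
    proof -
      obtain P Q where PQ: "P \<in> C" "x \<in> P" "Q \<in> C" "y \<in> Q" using xy by blast
      then have "P \<subseteq> Q \<or> Q \<subseteq> P" using C(2) unfolding subset.chain_def by blast
      then show ?thesis using PQ by blast
    qed
    have "x + y \<in> \<Union>C \<and> x * y \<in> \<Union>C" if xy: "x \<in> \<Union>C" "y \<in> \<Union>C" for x y
    proof -
      obtain P where P: "P \<in> C" "x \<in> P" "y \<in> P" using dir[OF xy] by blast
      then have "preordering P" using CA by (simp add: A_def)
      then show ?thesis using P preordering_add preordering_mult by blast
    qed
    moreover obtain P where P: "P \<in> C" using C(1) by blast
    then have "preordering P" "- f \<in> P" using CA by (simp_all add: A_def)
    then have "x * x \<in> \<Union>C" "- f \<in> \<Union>C" for x using P preordering_square by blast+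
    moreover have "- (f ^ (2 * N)) \<notin> \<Union>C" for N using CA by (auto simp: A_def)
    ultimately show ?thesis by (simp add: A_def preordering_def)
  qed
  ultimately obtain P where P: "P \<in> A" "\<And>Q. Q \<in> A \<Longrightarrow> P \<subseteq> Q \<Longrightarrow> Q = P"
    using subset_Zorn_nonempty[of A] by blast
  have PA: "preordering P" "- f \<in> P" "\<And>N. - (f ^ (2 * N)) \<notin> P" using P(1) by (simp_all add: A_def)
  have "prime_cone P"
  proof (rule prime_cone_of_maximal[OF PA(1,3)])
    fix Q assume "preordering Q" "P \<subseteq> Q" "\<And>N. - (f ^ (2 * N)) \<notin> Q"
    then show "Q = P" using P(2)[of Q] PA(2) by (auto simp: A_def)
  qed
  then have "f \<in> P" by (rule assms)
  then have "(- f) * f \<in> P" using PA preordering_mult by blast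
  then show False using PA(3)[of 1] by (simp add: power2_eq_square)
qed

section \<open>Real closures\<close>

text \<open>The nonnegative elements of a preordered subfield that is not named: it consists of the
  differences of members of \<open>Q\<close>, whence the squares
  \<open>(x - y) * (x - y)\<close>.\<close>

definition field_cone :: "'a::field set \<Rightarrow> bool" where
  "field_cone Q \<longleftrightarrow> 1 \<in> Q \<and> - 1 \<notin> Q \<and> (\<forall>x\<in>Q. inverse x \<in> Q) \<and>
     (\<forall>x\<in>Q. \<forall>y\<in>Q. x + y \<in> Q \<and> x * y \<in> Q \<and> (x - y) * (x - y) \<in> Q)"

lemma field_cone_1: "field_cone Q \<Longrightarrow> 1 \<in> Q"
  and field_cone_minus_1: "field_cone Q \<Longrightarrow> - 1 \<notin> Q"
  and field_cone_inverse: "field_cone Q \<Longrightarrow> x \<in> Q \<Longrightarrow> inverse x \<in> Q"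
  and field_cone_add: "field_cone Q \<Longrightarrow> x \<in> Q \<Longrightarrow> y \<in> Q \<Longrightarrow> x + y \<in> Q"
  and field_cone_mult: "field_cone Q \<Longrightarrow> x \<in> Q \<Longrightarrow> y \<in> Q \<Longrightarrow> x * y \<in> Q"
  and field_cone_square: "field_cone Q \<Longrightarrow> x \<in> Q \<Longrightarrow> y \<in> Q \<Longrightarrow> (x - y) * (x - y) \<in> Q"
  by (simp_all add: field_cone_def)

lemma field_cone_0: "field_cone Q \<Longrightarrow> 0 \<in> Q"
  using field_cone_square[OF _ field_cone_1 field_cone_1] by simp

lemma inverse_eq_mult_inverse_square: "inverse (u::'a::field) = u * inverse (u * u)"
proof (cases "u = 0")
  case False
  have "u * inverse (u * u) = (u * inverse u) * inverse u"
    unfolding inverse_mult_distrib mult.assoc ..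
  also have "u * inverse u = 1" using False by (rule right_inverse)
  finally show ?thesis by simp
qed simp

text \<open>Adjoining \<open>y\<close> gives the cone \<open>R\<close>; if it contained
  \<open>- 1\<close>, solving for \<open>y\<close> would put \<open>- y\<close> into
  \<open>Q\<close>. As \<open>y\<close> is already a difference, the subfield does not grow, so
  squares of differences from \<open>R\<close> lie in \<open>Q\<close>.\<close>

lemma field_cone_total:
  assumes Q: "field_cone Q" and max: "\<And>R. field_cone R \<Longrightarrow> Q \<subseteq> R \<Longrightarrow> R = Q"
    and y: "y = c - d" "c \<in> Q" "d \<in> Q"
  shows "y \<in> Q \<or> - y \<in> Q"
proof (rule ccontr)
  assume no: "\<not> ?thesis"
  note cl = field_cone_add[OF Q] field_cone_mult[OF Q]
  define R where "R = {a + y * b | a b. a \<in> Q \<and> b \<in> Q}"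
  have RI: "a + y * b \<in> R" if "a \<in> Q" "b \<in> Q" for a b using that by (auto simp: R_def)
  have yy: "y * y \<in> Q" using field_cone_square[OF Q y(2,3)] y(1) by simp
  have diff: "\<exists>p\<in>Q. \<exists>q\<in>Q. x = p - q" if x: "x \<in> R" for x
  proof -
    obtain a b where ab: "a \<in> Q" "b \<in> Q" "x = a + y * b" using x by (auto simp: R_def)
    then have "x = (a + c * b) - d * b" by (simp add: y(1) algebra_simps)
    moreover have "a + c * b \<in> Q" "d * b \<in> Q" using ab y by (intro cl; simp)+
    ultimately show ?thesis by blast
  qed
  have QR: "a \<in> R" if "a \<in> Q" for a using RI[OF that field_cone_0[OF Q]] by simp
  have Radd: "u + v \<in> R" if uv: "u \<in> R" "v \<in> R" for u v
  proof -
    obtain a b a' b' where *: "u = a + y * b" "v = a' + y * b'" "a \<in> Q" "b \<in> Q" "a' \<in> Q" "b' \<in> Q"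
      using uv by (auto simp: R_def)
    have e: "u + v = (a + a') + y * (b + b')" using * by (simp add: algebra_simps)
    show ?thesis unfolding e using RI[of "a + a'" "b + b'"] cl * by simp
  qed
  have Rmult: "u * v \<in> R" if uv: "u \<in> R" "v \<in> R" for u v
  proof -
    obtain a b a' b' where *: "u = a + y * b" "v = a' + y * b'" "a \<in> Q" "b \<in> Q" "a' \<in> Q" "b' \<in> Q"
      using uv by (auto simp: R_def)
    have e: "u * v = (a * a' + y * y * (b * b')) + y * (a * b' + b * a')" using *
      by (simp add: algebra_simps)
    show ?thesis unfolding e using RI[of "a * a' + y * y * (b * b')" "a * b' + b * a'"] cl * yy
      by simp
  qed
  have "field_cone R"
    unfolding field_cone_def
  proof (intro conjI ballI)
    show "1 \<in> R" using QR field_cone_1[OF Q] by blast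
    show "- 1 \<notin> R"
    proof
      assume "- 1 \<in> R"
      then obtain a b where ab: "a \<in> Q" "b \<in> Q" "- 1 = a + y * b" by (auto simp: R_def)
      have "b \<noteq> 0" using ab field_cone_minus_1[OF Q] by auto
      have "- y * b = a - (a + y * b)" by simp
      also have "\<dots> = 1 + a" unfolding ab(3)[symmetric] by simp
      finally have "- y = (1 + a) * inverse b" using \<open>b \<noteq> 0\<close> by (simp add: field_simps)
      then have "- y \<in> Q" using cl field_cone_inverse[OF Q] field_cone_1[OF Q] ab by simp
      then show False using no by blast
    qed
    fix u v assume uv: "u \<in> R" "v \<in> R"
    show "u + v \<in> R" "u * v \<in> R" using Radd[OF uv] Rmult[OF uv] .
    obtain p q p' q' where pq: "p \<in> Q" "q \<in> Q" "u = p - q" "p' \<in> Q" "q' \<in> Q" "v = p' - q'"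
      using diff[OF uv(1)] diff[OF uv(2)] by blast
    have "u - v = (p + q') - (q + p')" using pq by simp
    then show "(u - v) * (u - v) \<in> R"
      using field_cone_square[OF Q cl(1)[OF pq(1,5)] cl(1)[OF pq(2,4)]] QR by simp
  next
    fix u assume u: "u \<in> R"
    obtain p q where pq: "p \<in> Q" "q \<in> Q" "u = p - q" using diff[OF u] by blast
    have "u * u \<in> Q" using field_cone_square[OF Q pq(1,2)] pq(3) by simp
    then have "inverse (u * u) \<in> R" using field_cone_inverse[OF Q] QR by blast
    then have "u * inverse (u * u) \<in> R" by (rule Rmult[OF u])
    then show "inverse u \<in> R" by (subst inverse_eq_mult_inverse_square)
  qed
  then have "R = Q" using max QR by blast
  moreover have "0 + y * 1 \<in> R" using RI[OF field_cone_0[OF Q] field_cone_1[OF Q]] .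
  ultimately show False using no by simp
qed

text \<open>Maximality lets both the order and the subfield grow inside the algebraic closure.
  \<open>SOME\<close> turns the result of Zorn's lemma into a constant on which a type can be
  based.\<close>

definition closure_cone :: "'a::linordered_field alg_closure set" where
  "closure_cone = (SOME Q. to_ac ` {x. 0 \<le> x} \<subseteq> Q \<and> field_cone Q \<and> (\<forall>R. field_cone R \<longrightarrow> Q \<subseteq> R \<longrightarrow>
    R = Q))"

lemma closure_cone:
  fixes x :: "'a::linordered_field"
  shows to_ac_closure_cone: "0 \<le> x \<Longrightarrow> to_ac x \<in> closure_cone"
    and field_cone_closure_cone: "field_cone (closure_cone :: 'a alg_closure set)"
    and closure_cone_maximal: "field_cone R \<Longrightarrow> (closure_cone :: 'a alg_closure set) \<subseteq> R \<Longrightarrow>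
      R = closure_cone"
proof -
  let ?B = "to_ac ` {x :: 'a. 0 \<le> x}"
  define A where "A = {Q. ?B \<subseteq> Q \<and> field_cone Q}"
  have "field_cone ?B"
    unfolding field_cone_def
  proof (intro conjI ballI)
    show "1 \<in> ?B" by (rule image_eqI[of _ _ 1]) auto
    show "- 1 \<notin> ?B"
    proof
      assume "- 1 \<in> ?B"
      then obtain x :: 'a where "0 \<le> x" "to_ac (- 1) = to_ac x" by auto
      then show False by (simp only: to_ac_eq_iff)
    qed
    fix u v assume "u \<in> ?B" "v \<in> ?B"
    then obtain x y where *: "u = to_ac x" "v = to_ac y" "0 \<le> x" "0 \<le> y" by auto
    show "u + v \<in> ?B" by (rule image_eqI[of _ _ "x + y"]) (use * in auto)
    show "u * v \<in> ?B" by (rule image_eqI[of _ _ "x * y"]) (use * in auto)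
    show "(u - v) * (u - v) \<in> ?B" by (rule image_eqI[of _ _ "(x - y) * (x - y)"]) (use * in auto)
  next
    fix u assume "u \<in> ?B"
    then obtain x where *: "u = to_ac x" "0 \<le> x" by auto
    show "inverse u \<in> ?B" by (rule image_eqI[of _ _ "inverse x"]) (use * in auto)
  qed
  then have "?B \<in> A" by (simp add: A_def)
  moreover have "\<Union>C \<in> A" if C: "C \<noteq> {}" "subset.chain A C" for C
  proof -
    have CA: "P \<in> A" if "P \<in> C" for P using C(2) that by (auto simp: subset.chain_def)
    have dir: "\<exists>P\<in>C. x \<in> P \<and> y \<in> P" if xy: "x \<in> \<Union>C" "y \<in> \<Union>C" for x y
    proof -
      obtain P Q where PQ: "P \<in> C" "x \<in> P" "Q \<in> C" "y \<in> Q" using xy by blast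
      then have "P \<subseteq> Q \<or> Q \<subseteq> P" using C(2) unfolding subset.chain_def by blast
      then show ?thesis using PQ by blast
    qed
    obtain P where P: "P \<in> C" using C(1) by blast
    have "field_cone (\<Union>C)"
      unfolding field_cone_def
    proof (intro conjI ballI)
      show "1 \<in> \<Union>C" using P CA[OF P] field_cone_1 by (auto simp: A_def)
      show "- 1 \<notin> \<Union>C" using CA field_cone_minus_1 by (auto simp: A_def)
      fix u v assume uv: "u \<in> \<Union>C" "v \<in> \<Union>C"
      obtain Q where Q: "Q \<in> C" "u \<in> Q" "v \<in> Q" using dir[OF uv] by blast
      have fQ: "field_cone Q" using CA[OF Q(1)] by (simp add: A_def)
      show "u + v \<in> \<Union>C" "u * v \<in> \<Union>C" "(u - v) * (u - v) \<in> \<Union>C"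
        using field_cone_add[OF fQ Q(2,3)] field_cone_mult[OF fQ Q(2,3)] field_cone_square[OF fQ
          Q(2,3)] Q(1) by blast+
    next
      fix u assume "u \<in> \<Union>C"
      then obtain Q where Q: "Q \<in> C" "u \<in> Q" by blast
      have "field_cone Q" using CA[OF Q(1)] by (simp add: A_def)
      then show "inverse u \<in> \<Union>C" using field_cone_inverse Q by blast
    qed
    moreover have "?B \<subseteq> \<Union>C" using P CA[OF P] by (auto simp: A_def)
    ultimately show ?thesis by (simp add: A_def)
  qed
  ultimately obtain Q where Q: "Q \<in> A" "\<And>R. R \<in> A \<Longrightarrow> Q \<subseteq> R \<Longrightarrow> R = Q"
    using subset_Zorn_nonempty[of A] by blast
  have "\<exists>Q. ?B \<subseteq> Q \<and> field_cone Q \<and> (\<forall>R. field_cone R \<longrightarrow> Q \<subseteq> R \<longrightarrow> R = Q)"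
    using Q by (intro exI[of _ Q]) (auto simp: A_def)
  from someI_ex[OF this] have *: "?B \<subseteq> closure_cone \<and>
    field_cone (closure_cone :: 'a alg_closure set) \<and>
    (\<forall>R. field_cone R \<longrightarrow> closure_cone \<subseteq> R \<longrightarrow> R = (closure_cone :: 'a alg_closure set))"
    unfolding closure_cone_def .
  show "0 \<le> x \<Longrightarrow> to_ac x \<in> closure_cone" using * by blast
  show "field_cone (closure_cone :: 'a alg_closure set)" using * by blast
  show "field_cone R \<Longrightarrow> closure_cone \<subseteq> R \<Longrightarrow> R = closure_cone" using * by blast
qed

lemma closure_cone_diff:
  assumes "x \<in> closure_cone" "y \<in> closure_cone"
  shows "x - y \<in> closure_cone \<or> - (x - y) \<in> closure_cone"
  by (rule field_cone_total[OF field_cone_closure_cone closure_cone_maximal refl assms])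

lemma closure_cone_antisym:
  assumes "x \<in> closure_cone" "- x \<in> closure_cone"
  shows "x = 0"
proof (rule ccontr)
  assume "x \<noteq> 0"
  then have "(- x) * inverse x = - 1" by simp
  moreover have "(- x) * inverse x \<in> closure_cone"
    using assms field_cone_closure_cone field_cone_mult field_cone_inverse by blast
  ultimately show False using field_cone_minus_1[OF field_cone_closure_cone] by metis
qed

definition closure_field :: "'a::linordered_field alg_closure set" where
  "closure_field = {x. x \<in> closure_cone \<or> - x \<in> closure_cone}"

lemma closure_fieldE:
  fixes x :: "'a::linordered_field alg_closure"
  assumes "x \<in> closure_field"
  obtains p q where "p \<in> closure_cone" "q \<in> closure_cone" "x = p - q"
proof -
  have z: "(0 :: 'a alg_closure) \<in> closure_cone" by (rule field_cone_0[OF field_cone_closure_cone])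
  show ?thesis
  proof (cases "x \<in> closure_cone")
    case True
    then show ?thesis using that[OF _ z] by simp
  next
    case False
    then have "- x \<in> closure_cone" using assms by (simp add: closure_field_def)
    then show ?thesis using that[OF z] by simp
  qed
qed

lemma closure_fieldI: "p \<in> closure_cone \<Longrightarrow> q \<in> closure_cone \<Longrightarrow> p - q \<in> closure_field"
  using closure_cone_diff by (auto simp: closure_field_def)

lemma closure_field_minus: "x \<in> closure_field \<Longrightarrow> - x \<in> closure_field"
  by (auto simp: closure_field_def)

lemma closure_field_add:
  assumes "x \<in> closure_field" "y \<in> closure_field"
  shows "x + y \<in> closure_field"
proof -
  obtain p q p' q' where *: "p \<in> closure_cone" "q \<in> closure_cone" "x = p - q"
    "p' \<in> closure_cone" "q' \<in> closure_cone" "y = p' - q'"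
    using closure_fieldE[OF assms(1)] closure_fieldE[OF assms(2)] by metis
  have "x + y = (p + p') - (q + q')" using * by simp
  then show ?thesis
    using closure_fieldI[OF field_cone_add[OF field_cone_closure_cone *(1,4)] field_cone_add[OF
      field_cone_closure_cone *(2,5)]]
    by simp
qed

lemma closure_field_mult:
  assumes "x \<in> closure_field" "y \<in> closure_field"
  shows "x * y \<in> closure_field"
proof -
  obtain p q p' q' where *: "p \<in> closure_cone" "q \<in> closure_cone" "x = p - q"
    "p' \<in> closure_cone" "q' \<in> closure_cone" "y = p' - q'"
    using closure_fieldE[OF assms(1)] closure_fieldE[OF assms(2)] by metis
  have "x * y = (p * p' + q * q') - (p * q' + q * p')" unfolding *(3,6) by (simp add: algebra_simps)
  moreover have "p * p' + q * q' \<in> closure_cone" "p * q' + q * p' \<in> closure_cone"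
    by (intro field_cone_add field_cone_mult field_cone_closure_cone *)+
  ultimately show ?thesis using closure_fieldI by simp
qed

lemma closure_field_inverse: "x \<in> closure_field \<Longrightarrow> inverse x \<in> closure_field"
  using field_cone_inverse[OF field_cone_closure_cone,
    of x] field_cone_inverse[OF field_cone_closure_cone, of "- x"]
  by (auto simp: closure_field_def)

lemma closure_field_0_1: "0 \<in> closure_field" "1 \<in> closure_field"
  using field_cone_0[OF field_cone_closure_cone] field_cone_1[OF field_cone_closure_cone]
  by (auto simp: closure_field_def)

typedef (overloaded) 'a real_closure = "closure_field :: 'a::linordered_field alg_closure set"
  using closure_field_0_1 by blast

setup_lifting type_definition_real_closure

instantiation real_closure :: (linordered_field) linordered_field
begin

lift_definition zero_real_closure :: "'a real_closure" is 0 by (rule closure_field_0_1)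
lift_definition one_real_closure :: "'a real_closure" is 1 by (rule closure_field_0_1)
lift_definition plus_real_closure :: "'a real_closure \<Rightarrow> 'a real_closure \<Rightarrow> 'a real_closure" is "(+)"
  by (rule closure_field_add)
lift_definition times_real_closure :: "'a real_closure \<Rightarrow> 'a real_closure \<Rightarrow> 'a real_closure" is "(*)"
  by (rule closure_field_mult)
lift_definition uminus_real_closure :: "'a real_closure \<Rightarrow> 'a real_closure" is uminus
  by (rule closure_field_minus)
lift_definition minus_real_closure :: "'a real_closure \<Rightarrow> 'a real_closure \<Rightarrow> 'a real_closure" is "(-)"
  using closure_field_add closure_field_minus by fastforce
lift_definition inverse_real_closure :: "'a real_closure \<Rightarrow> 'a real_closure" is inverse
  by (rule closure_field_inverse)
lift_definition divide_real_closure :: "'a real_closure \<Rightarrow> 'a real_closure \<Rightarrow> 'a real_closure" is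
  "(/)"
  using closure_field_mult closure_field_inverse
    by (fastforce simp: field_class.field_divide_inverse)
lift_definition less_eq_real_closure :: "'a real_closure \<Rightarrow> 'a real_closure \<Rightarrow> bool" is
  "\<lambda>x y. y - x \<in> closure_cone" .

definition less_real_closure :: "'a real_closure \<Rightarrow> 'a real_closure \<Rightarrow> bool" where
  "less_real_closure x y \<longleftrightarrow> x \<le> y \<and> \<not> y \<le> x"
definition abs_real_closure :: "'a real_closure \<Rightarrow> 'a real_closure" where
  "abs_real_closure x = (if x < 0 then - x else x)"
definition sgn_real_closure :: "'a real_closure \<Rightarrow> 'a real_closure" where
  "sgn_real_closure x = (if x = 0 then 0 else if 0 < x then 1 else - 1)"

instance
proof
  fix x y z :: "'a real_closure"
  show "x + y + z = x + (y + z)" "x + y = y + x" "0 + x = x" "- x + x = 0" "x - y = x + - y"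
    "x * y * z = x * (y * z)" "x * y = y * x" "1 * x = x" "(x + y) * z = x * z + y * z"
    "x + y - x = y" "x - y - z = x - (y + z)" "0 * x = 0" "x * 0 = 0"
    by (transfer; simp add: algebra_simps)+
  show "(0 :: 'a real_closure) \<noteq> 1" by transfer simp
  show "x \<noteq> 0 \<Longrightarrow> inverse x * x = 1" by transfer simp
  show "x div y = x * inverse y" by transfer (simp add: field_class.field_divide_inverse)
  show "inverse (0 :: 'a real_closure) = 0" by transfer simp
  show "x < y \<longleftrightarrow> x \<le> y \<and> \<not> y \<le> x" by (rule less_real_closure_def)
  show "x \<le> x" by transfer (simp add: field_cone_0[OF field_cone_closure_cone])
  show "x \<le> y \<Longrightarrow> y \<le> z \<Longrightarrow> x \<le> z"
  proof transfer
    fix x y z :: "'a alg_closure" assume "y - x \<in> closure_cone" "z - y \<in> closure_cone"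
    then have "(y - x) + (z - y) \<in> closure_cone"
      by (rule field_cone_add[OF field_cone_closure_cone])
    then show "z - x \<in> closure_cone" by simp
  qed
  show "x \<le> y \<Longrightarrow> y \<le> x \<Longrightarrow> x = y"
  proof transfer
    fix x y :: "'a alg_closure" assume "y - x \<in> closure_cone" "x - y \<in> closure_cone"
    then have "y - x = 0" by (intro closure_cone_antisym) auto
    then show "x = y" by simp
  qed
  show "x \<le> y \<or> y \<le> x"
  proof transfer
    fix x y :: "'a alg_closure" assume "x \<in> closure_field" "y \<in> closure_field"
    then have "y + (- x) \<in> closure_field" by (intro closure_field_add closure_field_minus)
    then show "y - x \<in> closure_cone \<or> x - y \<in> closure_cone" by (simp add: closure_field_def)
  qed
  show "x \<le> y \<Longrightarrow> z + x \<le> z + y" by transfer simp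
  show "x < y \<Longrightarrow> 0 < z \<Longrightarrow> z * x < z * y"
  proof -
    assume "x < y" "0 < z"
    then have *: "x \<le> y" "0 \<le> z" "x \<noteq> y" "z \<noteq> 0" unfolding less_real_closure_def by auto
    have le: "z * x \<le> z * y" using *(1,2)
    proof transfer
      fix x y z :: "'a alg_closure" assume "y - x \<in> closure_cone" "z - 0 \<in> closure_cone"
      then have "(y - x) * (z - 0) \<in> closure_cone"
        by (rule field_cone_mult[OF field_cone_closure_cone])
      then show "z * y - z * x \<in> closure_cone" by (simp add: algebra_simps)
    qed
    have "z * x \<noteq> z * y" using *(3,4) by transfer simp
    moreover have "z * y \<le> z * x \<Longrightarrow> z * x = z * y" using le
    proof transfer
      fix x y z :: "'a alg_closure"
      assume "z * x - z * y \<in> closure_cone" "z * y - z * x \<in> closure_cone"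
      then have "z * x - z * y = 0" by (intro closure_cone_antisym) auto
      then show "z * x = z * y" by simp
    qed
    ultimately show "z * x < z * y" using le unfolding less_real_closure_def by blast
  qed
  show "\<bar>x\<bar> = (if x < 0 then - x else x)" by (rule abs_real_closure_def)
  show "sgn x = (if x = 0 then 0 else if 0 < x then 1 else - 1)" by (rule sgn_real_closure_def)
qed

end

abbreviation rc_rep :: "'a::linordered_field real_closure \<Rightarrow> 'a alg_closure" where
  "rc_rep \<equiv> Rep_real_closure"

lemma is_hom_rc_rep: "is_hom rc_rep"
  by (simp add: is_hom_def one_real_closure.rep_eq plus_real_closure.rep_eq
    times_real_closure.rep_eq)

lemma rc_rep_eq_0_iff: "rc_rep x = 0 \<longleftrightarrow> x = 0"
  by (metis Rep_real_closure_inject zero_real_closure.rep_eq)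

lemma rc_rep_nonneg_iff: "0 \<le> x \<longleftrightarrow> rc_rep x \<in> closure_cone"
  by (simp add: less_eq_real_closure.rep_eq zero_real_closure.rep_eq)

lemma closure_cone_rc_rep:
  assumes "y \<in> closure_cone"
  obtains x where "y = rc_rep x" "0 \<le> x"
proof -
  have "y \<in> closure_field" using assms by (simp add: closure_field_def)
  then have "rc_rep (Abs_real_closure y) = y" by (rule Abs_real_closure_inverse)
  then show ?thesis using that[of "Abs_real_closure y"] assms by (simp add: rc_rep_nonneg_iff)
qed

text \<open>The weights \<open>k\<close> are kept because a nonnegative scalar need not be a square
  in the ground field.\<close>

inductive_set poly_sos :: "'a::linordered_field poly set" where
  zero: "0 \<in> poly_sos"
| add: "0 \<le> k \<Longrightarrow> s \<in> poly_sos \<Longrightarrow> smult k (g * g) + s \<in> poly_sos"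

lemma poly_sos_add: "s \<in> poly_sos \<Longrightarrow> t \<in> poly_sos \<Longrightarrow> s + t \<in> poly_sos"
  by (induction rule: poly_sos.induct) (auto simp: add.assoc intro: poly_sos.add)

lemma poly_sos_square: "0 \<le> k \<Longrightarrow> smult k (g * g) \<in> poly_sos"
  using poly_sos.add[OF _ poly_sos.zero] by force

lemma poly_sos_mult_square:
  assumes "0 \<le> k" "s \<in> poly_sos"
  shows "smult k (g * g) * s \<in> poly_sos"
  using assms(2)
proof (induction rule: poly_sos.induct)
  case (add l s h)
  have "smult k (g * g) * (smult l (h * h) + s) = smult (k * l) ((g * h) * (g * h)) + smult k (g *
    g) * s"
    by (simp add: algebra_simps)
  moreover have "0 \<le> k * l" using assms(1) add by simp
  ultimately show ?case using poly_sos.add add by metis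
qed (simp add: poly_sos.zero)

lemma poly_sos_mult: "s \<in> poly_sos \<Longrightarrow> t \<in> poly_sos \<Longrightarrow> s * t \<in> poly_sos"
  by (induction rule: poly_sos.induct)
     (auto simp: distrib_right simp del: mult_smult_left intro: poly_sos.zero poly_sos_add
       poly_sos_mult_square)

lemma poly_sos_nonneg: "s \<in> poly_sos \<Longrightarrow> 0 \<le> poly s x"
  by (induction rule: poly_sos.induct) auto

text \<open>Each square is reduced modulo \<open>p\<close> before squaring, so that the degree stays
  below \<open>2 * degree p\<close> regardless of the number of summands and the result is still a
  sum of squares.\<close>

lemma poly_sos_reduce:
  assumes "s \<in> poly_sos" "degree p > 0"
  shows "\<exists>t\<in>poly_sos. p dvd s - t \<and> degree t \<le> 2 * degree p - 2"
  using assms(1)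
proof (induction rule: poly_sos.induct)
  case zero
  then show ?case using poly_sos.zero by force
next
  case (add k s g)
  then obtain t where t: "t \<in> poly_sos" "p dvd s - t" "degree t \<le> 2 * degree p - 2" by blast
  define h where "h = g mod p"
  have hg: "p dvd g - h" unfolding h_def by (simp add: minus_mod_eq_mult_div)
  have "p \<noteq> 0" using assms(2) by auto
  then have dh: "degree h \<le> degree p - 1"
    using degree_mod_less[of p g] assms(2) unfolding h_def by auto
  have "degree (smult k (h * h)) \<le> degree h + degree h"
    by (rule order_trans[OF degree_smult_le degree_mult_le])
  then have "degree (smult k (h * h) + t) \<le> 2 * degree p - 2"
    using dh t(3) by (intro degree_add_le) linarith+
  moreover have eq: "smult k (g * g) + s - (smult k (h * h) + t) = smult k ((g - h) * (g + h)) +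
    (s - t)"
    by (simp add: algebra_simps smult_diff_right smult_add_right)
  have "p dvd smult k (g * g) + s - (smult k (h * h) + t)"
    unfolding eq using hg t(2) by (intro dvd_add dvd_smult dvd_mult2)
  ultimately show ?case using poly_sos.add[OF add(1) t(1), of h] by blast
qed

text \<open>The product of \<open>p\<close> and \<open>w\<close> is positive everywhere, so the two
  always have the same sign.\<close>

lemma sum_squares_cofactor_sign_change:
  fixes p w s :: "'a::linordered_field poly"
  assumes "s \<in> poly_sos" "1 + s = p * w" "poly p a * poly p b < 0"
  shows "poly w a * poly w b < 0"
proof -
  have pos: "0 < poly p x * poly w x" for x
    using poly_sos_nonneg[OF assms(1), of x] arg_cong[OF assms(2), of "\<lambda>f. poly f x"]
    by (simp add: add_pos_nonneg)
  have "0 < (poly p a * poly p b) * (poly w a * poly w b)"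
    using mult_pos_pos[OF pos[of a] pos[of b]] by (simp add: mult_ac)
  then show ?thesis
    using assms(3) mult_nonpos_nonneg[of "poly p a * poly p b" "poly w a * poly w b"] by linarith
qed

definition ivt_fails :: "'a::linordered_field poly \<Rightarrow> 'a \<Rightarrow> 'a \<Rightarrow> bool" where
  "ivt_fails p a b \<longleftrightarrow> a < b \<and> poly p a * poly p b < 0 \<and> (\<forall>x. a < x \<longrightarrow> x < b \<longrightarrow> poly p x \<noteq> 0)"

section \<open>Simple algebraic extensions by evaluation at a root\<close>

lemma hom_ev_mod:
  fixes \<rho> :: "'k::field \<Rightarrow> 'o::field"
  assumes h: "is_hom \<rho>" and p: "poly (map_poly \<rho> p) \<alpha> = 0"
  shows "poly (map_poly \<rho> (g mod p)) \<alpha> = poly (map_poly \<rho> g) \<alpha>"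
proof -
  have "poly (map_poly \<rho> g) \<alpha> = poly (map_poly \<rho> (p * (g div p) + g mod p)) \<alpha>" by simp
  also have "\<dots> = poly (map_poly \<rho> (g mod p)) \<alpha>"
    unfolding map_poly_hom_add[OF h] map_poly_hom_mult[OF h] poly_add poly_mult p by simp
  finally show ?thesis by simp
qed

lemma hom_nonzero:
  fixes \<rho> :: "'k::field \<Rightarrow> 'o::field"
  assumes "is_hom \<rho>" "c \<noteq> 0"
  shows "\<rho> c \<noteq> 0"
proof
  assume "\<rho> c = 0"
  then have "\<rho> (c * inverse c) = 0" unfolding is_hom_mult[OF assms(1)] by simp
  then show False using assms by (simp add: is_hom_1)
qed

lemma hom_ev_const:
  assumes "is_hom \<rho>"
  shows "poly (map_poly \<rho> [:c:]) \<alpha> = \<rho> c"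
  by (simp add: map_poly_pCons is_hom_0[OF assms])

text \<open>A polynomial \<open>\<mu>\<close> of least degree among those vanishing at
  \<open>\<alpha>\<close> divides all the others; irreducibility makes \<open>p\<close> a scalar
  multiple of it.\<close>

lemma root_dvd:
  fixes \<rho> :: "'k::field \<Rightarrow> 'o::field"
  assumes h: "is_hom \<rho>" and p: "p \<noteq> 0" "poly (map_poly \<rho> p) \<alpha> = 0"
    and irr: "\<And>\<mu> w. p = \<mu> * w \<Longrightarrow> degree \<mu> > 0 \<Longrightarrow> degree w = 0"
    and g: "poly (map_poly \<rho> g) \<alpha> = 0"
  shows "p dvd g"
proof -
  let ?P = "\<lambda>n. \<exists>\<mu>. \<mu> \<noteq> 0 \<and> poly (map_poly \<rho> \<mu>) \<alpha> = 0 \<and> degree \<mu> = n"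
  have "?P (degree p)" using p by blast
  then have P: "?P (LEAST n. ?P n)" by (rule LeastI)
  then obtain \<mu> where \<mu>: "\<mu> \<noteq> 0" "poly (map_poly \<rho> \<mu>) \<alpha> = 0" "degree \<mu> = (LEAST n. ?P n)" by blast
  have min: "degree \<mu> \<le> degree k" if "k \<noteq> 0" "poly (map_poly \<rho> k) \<alpha> = 0" for k
    unfolding \<mu>(3) by (rule Least_le) (use that in blast)
  have \<mu>dvd: "\<mu> dvd k" if k: "poly (map_poly \<rho> k) \<alpha> = 0" for k
  proof -
    have "k mod \<mu> = 0"
      using min[of "k mod \<mu>"] hom_ev_mod[OF h \<mu>(2), of k] k degree_mod_less[OF \<mu>(1), of k]
        by fastforce
    then show ?thesis by (simp add: mod_eq_0_iff_dvd)
  qed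
  obtain w where w: "p = \<mu> * w" using \<mu>dvd[OF p(2)] by (rule dvdE)
  have "degree \<mu> > 0"
  proof (rule ccontr)
    assume "\<not> degree \<mu> > 0"
    then obtain c where c: "\<mu> = [:c:]" using degree_eq_zeroE by blast
    then have "\<rho> c = 0" using \<mu>(2) hom_ev_const[OF h, of c \<alpha>] by simp
    then show False using hom_nonzero[OF h, of c] \<mu>(1) c by auto
  qed
  then have "degree w = 0" by (rule irr[OF w])
  then obtain c where c: "w = [:c:]" by (rule degree_eq_zeroE)
  then have "p = smult c \<mu>" "c \<noteq> 0" using w p(1) by auto
  then show ?thesis using \<mu>dvd[OF g] by (simp add: smult_dvd_iff)
qed

text \<open>A descent in place of Bezout coefficients: among the polynomials whose value at
  \<open>\<alpha>\<close> is a nonzero multiple of that of \<open>g\<close>, one of least degree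
  divides \<open>p\<close> and is then constant.\<close>

lemma root_inverse:
  fixes \<rho> :: "'k::field \<Rightarrow> 'o::field"
  assumes h: "is_hom \<rho>" and p: "p \<noteq> 0" "poly (map_poly \<rho> p) \<alpha> = 0"
    and dvdI: "\<And>g. poly (map_poly \<rho> g) \<alpha> = 0 \<Longrightarrow> p dvd g"
    and g: "poly (map_poly \<rho> g) \<alpha> \<noteq> 0"
  shows "\<exists>k. poly (map_poly \<rho> k) \<alpha> * poly (map_poly \<rho> g) \<alpha> = 1"
proof -
  define ev where "ev = (\<lambda>g. poly (map_poly \<rho> g) \<alpha>)"
  have ev: "ev (x * y) = ev x * ev y" "ev (x - y) = ev x - ev y" "ev 0 = 0" for x y
    by (simp_all add: ev_def map_poly_hom_mult[OF h] map_poly_hom_diff[OF h])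
  let ?R = "\<lambda>r. ev r \<noteq> 0 \<and> (\<exists>k. ev r = ev k * ev g)"
  let ?P = "\<lambda>n. \<exists>r. ?R r \<and> degree r = n"
  have "ev g = ev 1 * ev g" unfolding ev(1)[symmetric] by simp
  then have "?P (degree g)" using g unfolding ev_def by blast
  then have P: "?P (LEAST n. ?P n)" by (rule LeastI)
  then obtain r k where r: "ev r \<noteq> 0" "ev r = ev k * ev g" "degree r = (LEAST n. ?P n)" by blast
  have min: "degree r \<le> degree t" if "ev t \<noteq> 0" "ev t = ev k * ev g" for t k
    unfolding r(3) by (rule Least_le) (use that in blast)
  have r0: "r \<noteq> 0" using r(1) ev(3) by auto
  have red: "ev (r mod p) = ev r" unfolding ev_def by (rule hom_ev_mod[OF h p(2)])
  then have "degree r \<le> degree (r mod p)" using r(1,2) by (intro min) simp_all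
  moreover have "r mod p \<noteq> 0" using red r(1) ev(3) by auto
  ultimately have drp: "degree r < degree p" using degree_mod_less[OF p(1), of r] by linarith
  have "p mod r = p - (p div r) * r" by (simp add: minus_div_mult_eq_mod)
  then have "ev (p mod r) = ev p - ev (p div r) * ev r" by (simp only: ev)
  also have "\<dots> = ev (0 - (p div r) * k) * ev g"
    using p(2) unfolding ev r(2) by (simp add: ev_def mult.assoc)
  finally have et: "ev (p mod r) = ev (0 - (p div r) * k) * ev g" .
  have dt: "p mod r = 0 \<or> degree (p mod r) < degree r" by (rule degree_mod_less[OF r0])
  have "ev (p mod r) = 0"
  proof (rule ccontr)
    assume nz: "ev (p mod r) \<noteq> 0"
    then have "degree r \<le> degree (p mod r)" using et by (rule min)
    then show False using dt nz ev(3) by auto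
  qed
  then have "p dvd p mod r" unfolding ev_def by (rule dvdI)
  then have "p mod r = 0" using dt drp dvd_imp_degree_le[of p "p mod r"] by linarith
  then have pr: "p = (p div r) * r" using div_mult_mod_eq[of p r] by simp
  have "ev (p div r) * ev r = ev p" unfolding ev(1)[symmetric] using pr by simp
  then have "ev (p div r) = 0" using r(1) p(2) unfolding ev_def by simp
  then have "p dvd p div r" unfolding ev_def by (rule dvdI)
  moreover have nzd: "p div r \<noteq> 0" using pr p(1) by auto
  ultimately have "degree p \<le> degree (p div r)" by (rule dvd_imp_degree_le)
  moreover have "degree ((p div r) * r) = degree (p div r) + degree r"
    by (rule degree_mult_eq[OF nzd r0])
  ultimately have "degree r = 0" using pr by simp
  then obtain c where c: "r = [:c:]" by (rule degree_eq_zeroE)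
  then have c0: "c \<noteq> 0" using r0 by auto
  have "ev [:inverse c:] * ev r = \<rho> (inverse c) * \<rho> c"
    unfolding ev_def c hom_ev_const[OF h] ..
  also have "\<dots> = 1" unfolding is_hom_mult[OF h, symmetric] using c0 by (simp add: is_hom_1[OF h])
  finally have "ev ([:inverse c:] * k) * ev g = 1" unfolding ev(1) r(2) by (simp only: mult.assoc)
  then show ?thesis unfolding ev_def by blast
qed

text \<open>A sign change of a product is a sign change of a factor, and a factor of smaller degree
  would supply the missing root.\<close>

lemma least_ivt_failure_irreducible:
  fixes p :: "'a::linordered_field poly"
  assumes fail: "ivt_fails p a b"
    and least: "\<And>q c d. degree q < degree p \<Longrightarrow> \<not> ivt_fails (q :: 'a poly) c d"
    and w: "p = \<mu> * w" and d\<mu>: "degree \<mu> > 0"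
  shows "degree w = 0"
proof (rule ccontr)
  assume "degree w \<noteq> 0"
  have ab: "a < b" "poly p a * poly p b < 0" and noroot: "\<And>x. a < x \<Longrightarrow> x < b \<Longrightarrow> poly p x \<noteq> 0"
    using fail by (auto simp: ivt_fails_def)
  have "p \<noteq> 0" using ab by auto
  then have "degree p = degree \<mu> + degree w" using w degree_mult_eq[of \<mu> w] by auto
  then have d: "degree \<mu> < degree p" "degree w < degree p" using d\<mu> \<open>degree w \<noteq> 0\<close> by auto
  have "(poly \<mu> a * poly \<mu> b) * (poly w a * poly w b) < 0" using ab(2) w by (simp add: mult_ac)
  then have "poly \<mu> a * poly \<mu> b < 0 \<or> poly w a * poly w b < 0"
    unfolding mult_less_0_iff[of "_ * _"] by blast
  then obtain x where "a < x" "x < b" "poly \<mu> x = 0 \<or> poly w x = 0"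
    using least[OF d(1), of a b] least[OF d(2), of a b] ab(1) unfolding ivt_fails_def by blast
  then show False using noroot w by auto
qed

lemma linear_sign_change:
  fixes a b k l :: "'a::linordered_field"
  assumes "((a - k) * l) * ((b - k) * l) < 0" "a < b"
  shows "a < k" "k < b"
proof -
  have prod: "(l * l) * ((a - k) * (b - k)) < 0" using assms(1) by (simp only: mult_ac)
  have "\<not> 0 \<le> (a - k) * (b - k)"
  proof
    assume "0 \<le> (a - k) * (b - k)"
    then have "0 \<le> (l * l) * ((a - k) * (b - k))" by (rule mult_nonneg_nonneg[OF zero_le_square])
    then show False using prod by simp
  qed
  then have "\<not> (0 \<le> a - k \<and> 0 \<le> b - k)" "\<not> (a - k \<le> 0 \<and> b - k \<le> 0)"
    using mult_nonneg_nonneg[of "a - k" "b - k"] mult_nonpos_nonpos[of "a - k" "b - k"] by blast+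
  then show "a < k" "k < b" using assms(2) by auto
qed

lemma linear_no_ivt_failure:
  fixes p :: "'a::linordered_field poly"
  assumes "degree p \<le> 1" "poly p k = 0"
  shows "\<not> ivt_fails p a b"
proof
  assume "ivt_fails p a b"
  then have ab: "a < b" "poly p a * poly p b < 0" and noroot: "\<And>x. a < x \<Longrightarrow> x < b \<Longrightarrow> poly p x \<noteq> 0"
    by (auto simp: ivt_fails_def)
  obtain w where w: "p = [:- k, 1:] * w" using assms(2) by (metis poly_eq_0_iff_dvd dvdE)
  then have "w \<noteq> 0" using ab(2) by auto
  then have "degree p = degree [:- k, 1:] + degree w" unfolding w by (intro degree_mult_eq) auto
  then have "degree w = 0" using assms(1) by simp
  then obtain l where l: "w = [:l:]" by (rule degree_eq_zeroE)
  have px: "poly p x = (x - k) * l" for x unfolding w poly_mult l by simp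
  show False
    using linear_sign_change[OF ab(2)[unfolded px] ab(1)] noroot assms(2) by blast
qed

text \<open>If \<open>- 1\<close> were a sum of squares in the extension, then \<open>1 + t = p * w\<close>
  for a sum of squares \<open>t\<close>,
  where \<open>w\<close> changes sign together with \<open>p\<close> but has smaller degree. At a root of \<open>w\<close> this is absurd.\<close>

lemma field_cone_adjoin_root:
  fixes p :: "'k::linordered_field poly" and \<rho> :: "'k \<Rightarrow> 'o::field"
  assumes h: "is_hom \<rho>" and \<alpha>: "poly (map_poly \<rho> p) \<alpha> = 0"
    and fail: "ivt_fails p a b"
    and least: "\<And>q c d. degree q < degree p \<Longrightarrow> \<not> ivt_fails (q :: 'k poly) c d"
  shows "field_cone ((\<lambda>g. poly (map_poly \<rho> g) \<alpha>) ` poly_sos)"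
    and "poly (map_poly \<rho> g) \<alpha> = 0 \<Longrightarrow> p dvd g"
proof -
  have ab: "a < b" "poly p a * poly p b < 0" using fail by (auto simp: ivt_fails_def)
  have p0: "p \<noteq> 0" using ab by auto
  have dvdI: "p dvd g" if "poly (map_poly \<rho> g) \<alpha> = 0" for g
    by (rule root_dvd[OF h p0 \<alpha> least_ivt_failure_irreducible[OF fail least] that])
  then show "poly (map_poly \<rho> g) \<alpha> = 0 \<Longrightarrow> p dvd g" .
  have dp: "degree p > 0"
  proof (rule ccontr)
    assume "\<not> degree p > 0"
    then obtain c where "p = [:c:]" using degree_eq_zeroE by blast
    then show False using ab(2) not_square_less_zero[of c] by simp
  qed
  define ev where "ev = (\<lambda>g. poly (map_poly \<rho> g) \<alpha>)"
  have ev: "ev (g + h) = ev g + ev h" "ev (g - h) = ev g - ev h" "ev (g * h) = ev g * ev h"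
    "ev 0 = 0" "ev 1 = 1" "ev p = 0" for g h
    by (simp_all add: ev_def \<alpha> map_poly_hom_add[OF h] map_poly_hom_diff[OF h] map_poly_hom_mult[OF
      h]
        map_poly_1' is_hom_1[OF h])
  have evdvd: "p dvd g" if "ev g = 0" for g using dvdI that unfolding ev_def by blast
  have inv: "\<exists>k. ev k * ev g = 1" if "ev g \<noteq> 0" for g
    using root_inverse[OF h p0 \<alpha> dvdI, of g] that unfolding ev_def by blast
  have QI: "ev s \<in> ev ` poly_sos" if "s \<in> poly_sos" for s using that by (rule imageI)
  have sq: "g * g \<in> poly_sos" for g :: "'k poly" using poly_sos_square[of 1 g] by simp
  have m1: "- 1 \<notin> ev ` poly_sos"
  proof
    assume "- 1 \<in> ev ` poly_sos"
    then obtain s where s: "- 1 = ev s" "s \<in> poly_sos" by (rule imageE)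
    obtain t where t: "t \<in> poly_sos" "p dvd s - t" "degree t \<le> 2 * degree p - 2"
      using poly_sos_reduce[OF s(2) dp] by blast
    obtain v where v: "s - t = p * v" using t(2) by (rule dvdE)
    have "ev (s - t) = 0" unfolding v ev(3,6) by simp
    then have "ev t = - 1" using s(1) by (simp add: ev(2))
    then have "ev (1 + t) = 0" by (simp add: ev(1,5))
    then have "p dvd 1 + t" by (rule evdvd)
    then obtain w where w: "1 + t = p * w" by (rule dvdE)
    have sc: "poly w a * poly w b < 0" by (rule sum_squares_cofactor_sign_change[OF t(1) w ab(2)])
    then have w0: "w \<noteq> 0" by auto
    have "degree p + degree w = degree (1 + t)" unfolding w
      by (rule degree_mult_eq[OF p0 w0, symmetric])
    also have "\<dots> \<le> 2 * degree p - 2" using t(3) by (intro degree_add_le) auto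
    finally have "degree w < degree p" using dp by linarith
    then have "\<not> ivt_fails w a b" by (rule least)
    then obtain x where x: "poly w x = 0" using sc ab(1) unfolding ivt_fails_def by blast
    have "poly (1 + t) x = 0" unfolding w using x by simp
    then have "1 + poly t x = 0" by simp
    then show False using poly_sos_nonneg[OF t(1), of x] by (simp add: add_eq_0_iff)
  qed
  have cl: "u + v \<in> ev ` poly_sos \<and> u * v \<in> ev ` poly_sos \<and> (u - v) * (u - v) \<in> ev ` poly_sos"
    if uv: "u \<in> ev ` poly_sos" "v \<in> ev ` poly_sos" for u v
  proof -
    obtain s where s: "u = ev s" "s \<in> poly_sos" using uv(1) by (rule imageE)
    obtain t where t: "v = ev t" "t \<in> poly_sos" using uv(2) by (rule imageE)
    show ?thesis
      unfolding s(1) t(1) ev(1)[symmetric] ev(2)[symmetric] ev(3)[symmetric]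
      by (intro conjI QI poly_sos_add poly_sos_mult sq s(2) t(2))
  qed
  have cinv: "inverse u \<in> ev ` poly_sos" if u: "u \<in> ev ` poly_sos" for u
  proof -
    obtain s where s: "u = ev s" "s \<in> poly_sos" using u by (rule imageE)
    show ?thesis
    proof (cases "u = 0")
      case True
      then show ?thesis using QI[OF poly_sos.zero] by (simp add: ev(4))
    next
      case False
      then obtain k where k: "ev k * u = 1" using inv s(1) by blast
      have "inverse u = ev k" using k False by (simp add: field_simps)
      \<comment> \<open>An inverse of a sum of squares is the sum itself times the square of the
        inverse.\<close>
      also have "ev k = ev (k * k * s)" using k unfolding ev(3) s(1)[symmetric]
        by (simp add: mult.assoc)
      finally show ?thesis using QI[OF poly_sos_mult[OF sq[of k] s(2)]] by simp
    qed
  qed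
  have "1 \<in> ev ` poly_sos" using QI[OF sq[of 1]] by (simp add: ev(5))
  then have "field_cone (ev ` poly_sos)" using m1 cl cinv unfolding field_cone_def by blast
  then show "field_cone ((\<lambda>g. poly (map_poly \<rho> g) \<alpha>) ` poly_sos)" unfolding ev_def .
qed

text \<open>For a counterexample of least degree with a root \<open>\<alpha>\<close>, the sums of
  squares evaluated at \<open>\<alpha>\<close> form a cone above \<open>closure_cone\<close>, hence
  equal to it. So \<open>\<alpha>\<close> was present before, \<open>p\<close> is linear, and a
  linear polynomial cannot change sign without passing its root.\<close>

lemma real_closure_ivt:
  fixes p :: "'a::linordered_field real_closure poly"
  shows "\<not> ivt_fails p a b"
proof (induction "degree p" arbitrary: p a b rule: less_induct)
  case less
  show ?case
  proof
    assume fail: "ivt_fails p a b"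
    have hom: "is_hom (rc_rep :: 'a real_closure \<Rightarrow> _)" by (rule is_hom_rc_rep)
    have ab: "a < b" "poly p a * poly p b < 0" using fail by (auto simp: ivt_fails_def)
    have dp: "degree p > 0"
    proof (rule ccontr)
      assume "\<not> degree p > 0"
      then obtain c where "p = [:c:]" using degree_eq_zeroE by blast
      then show False using ab(2) not_square_less_zero[of c] by simp
    qed
    have "degree (map_poly rc_rep p) = degree p"
      by (rule degree_map_poly) (simp add: rc_rep_eq_0_iff)
    then obtain \<alpha> where \<alpha>: "poly (map_poly rc_rep p) \<alpha> = 0"
      using alg_closed_imp_poly_has_root[of "map_poly rc_rep p"] dp by auto
    let ?ev = "\<lambda>g. poly (map_poly rc_rep g) \<alpha>"
    note adj = field_cone_adjoin_root[OF hom \<alpha> fail less]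
    have "closure_cone \<subseteq> ?ev ` poly_sos"
    proof
      fix y :: "'a alg_closure" assume "y \<in> closure_cone"
      then obtain x where x: "y = rc_rep x" "0 \<le> x" by (rule closure_cone_rc_rep)
      have "y = ?ev (smult x (1 * 1))"
        using x(1) hom_ev_const[OF hom, of x \<alpha>] by (simp add: one_pCons)
      then show "y \<in> ?ev ` poly_sos" using poly_sos_square[OF x(2), of 1] by (rule image_eqI)
    qed
    with adj(1) have Qeq: "?ev ` poly_sos = closure_cone" by (rule closure_cone_maximal)
    let ?q = "inverse 4 :: 'a real_closure"
    have inQ: "?ev (smult ?q (g * g)) \<in> closure_cone" for g
      unfolding Qeq[symmetric] by (rule imageI) (rule poly_sos_square, simp)
    \<comment> \<open>The variable is a quarter of \<open>(X + 1)\<^sup>2 - (X - 1)\<^sup>2\<close>,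
      which shows \<open>\<alpha>\<close> as a difference of members of the cone.\<close>
    have "[:0, 1:] = smult ?q ([:1, 1:] * [:1, 1:]) - smult ?q ([:-1, 1:] * [:-1, 1:])" by simp
    then have "?ev [:0, 1:] = ?ev (smult ?q ([:1, 1:] * [:1, 1:])) - ?ev (smult ?q ([:-1,
      1:] * [:-1, 1:]))"
      by (metis map_poly_hom_diff[OF hom] poly_diff)
    moreover have "?ev [:0, 1:] = \<alpha>"
      by (simp add: map_poly_pCons is_hom_0[OF hom] is_hom_1[OF hom])
    ultimately have "\<alpha> \<in> closure_field" using closure_fieldI[OF inQ inQ] by metis
    then obtain k where k: "\<alpha> = rc_rep k" by (metis Abs_real_closure_inverse)
    have "?ev [:- k, 1:] = 0"
      by (simp add: map_poly_pCons is_hom_0[OF hom] is_hom_1[OF hom] is_hom_minus[OF hom] k)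
    then have "p dvd [:- k, 1:]" using adj(2)[of "[:- k, 1:]"] by simp
    then have d1: "degree p \<le> 1" using dvd_imp_degree_le[of p "[:- k, 1:]"] by simp
    have "rc_rep (poly p k) = 0" using \<alpha> is_hom_poly[OF hom, of p k] k by simp
    then have "poly p k = 0" by (simp add: rc_rep_eq_0_iff)
    then show False using linear_no_ivt_failure[OF d1] fail by blast
  qed
qed

instance real_closure :: (linordered_field) real_closed_field
proof
  fix a b :: "'a real_closure" and f :: "nat \<Rightarrow> 'a real_closure" and n
  assume *: "a < b" "(\<Sum>k\<le>n. f k * a ^ k) < 0" "0 < (\<Sum>k\<le>n. f k * b ^ k)"
  define p where "p = (\<Sum>k\<le>n. monom (f k) k)"
  have p: "poly p x = (\<Sum>k\<le>n. f k * x ^ k)" for x by (simp add: p_def poly_sum poly_monom)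
  have "poly p a * poly p b < 0" using * by (simp add: p mult_less_0_iff)
  then show "\<exists>x>a. x < b \<and> (\<Sum>k\<le>n. f k * x ^ k) = 0"
    using real_closure_ivt[of p a b] *(1) unfolding ivt_fails_def p by blast
qed

lift_definition to_rc :: "'a::linordered_field \<Rightarrow> 'a real_closure" is to_ac
proof -
  fix x :: 'a
  show "to_ac x \<in> closure_field"
    using to_ac_closure_cone[of x] to_ac_closure_cone[of "- x"]
      by (cases "0 \<le> x") (auto simp: closure_field_def)
qed

lemma is_hom_to_rc: "is_hom to_rc"
  unfolding is_hom_def by (intro conjI allI) (transfer; simp)+

lemma to_rc_neg:
  fixes x :: "'a::linordered_field"
  assumes "x < 0"
  shows "to_rc x < 0"
proof -
  have "0 \<le> to_rc (- x)"
    unfolding rc_rep_nonneg_iff to_rc.rep_eq by (rule to_ac_closure_cone) (use assms in simp)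
  moreover have "to_rc (- x) = - to_rc x" by (rule is_hom_minus[OF is_hom_to_rc])
  moreover have "to_rc x \<noteq> 0"
    using assms by (metis less_irrefl rc_rep_eq_0_iff to_ac_eq_0_iff to_rc.rep_eq)
  ultimately show ?thesis by simp
qed

section \<open>Sums of squares of regulous functions\<close>

text \<open>Provides a prime cone for the case that there is no counterexample, so that
  \<open>chosen_cone\<close> is prime in every case.\<close>

lemma prime_cone_at_point: "prime_cone {f. 0 \<le> rapp f x}"
  unfolding prime_cone_def preordering_def by (auto simp: zero_le_mult_iff mult_le_0_iff)

text \<open>Types cannot depend on a cone that is fixed inside a proof. The residue ring is therefore
  formed for one cone, chosen to be a counterexample to the claim that nonnegative functions lie in
  every prime cone, if there is one.\<close>

definition bad_cone :: "'n::finite regfun set \<Rightarrow> bool" where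
  "bad_cone P \<longleftrightarrow> prime_cone P \<and> (\<exists>f. (\<forall>x. 0 \<le> rapp f x) \<and> f \<notin> P)"

definition chosen_cone :: "'n::finite regfun set" where
  "chosen_cone = (SOME P. prime_cone P \<and> ((\<exists>P :: 'n regfun set. bad_cone P) \<longrightarrow> bad_cone P))"

lemma chosen_cone:
  shows prime_cone_chosen_cone: "prime_cone (chosen_cone :: 'n::finite regfun set)"
    and bad_cone_chosen_cone: "bad_cone (P :: 'n regfun set) \<Longrightarrow>
      bad_cone (chosen_cone :: 'n regfun set)"
proof -
  have "\<exists>P :: 'n regfun set. prime_cone P \<and> ((\<exists>P :: 'n regfun set. bad_cone P) \<longrightarrow> bad_cone P)"
  proof (cases "\<exists>P :: 'n regfun set. bad_cone P")
    case True
    then show ?thesis using bad_cone_def by blast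
  next
    case False
    then show ?thesis using prime_cone_at_point by blast
  qed
  from someI_ex[OF this]
  have *: "prime_cone (chosen_cone :: 'n regfun set) \<and>
    ((\<exists>P :: 'n regfun set. bad_cone P) \<longrightarrow> bad_cone (chosen_cone :: 'n regfun set))"
    unfolding chosen_cone_def .
  then show "prime_cone (chosen_cone :: 'n::finite regfun set)" by (rule conjunct1)
  show "bad_cone (P :: 'n regfun set) \<Longrightarrow> bad_cone (chosen_cone :: 'n regfun set)" using * by blast
qed

section \<open>The ordered residue domain of the chosen cone\<close>

lemma prime_cone_add: "prime_cone P \<Longrightarrow> f \<in> P \<Longrightarrow> g \<in> P \<Longrightarrow> f + g \<in> P"
  and prime_cone_mult: "prime_cone P \<Longrightarrow> f \<in> P \<Longrightarrow> g \<in> P \<Longrightarrow> f * g \<in> P"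
  and prime_cone_total: "prime_cone P \<Longrightarrow> f \<in> P \<or> - f \<in> P"
  and prime_cone_minus_1: "prime_cone P \<Longrightarrow> - 1 \<notin> P"
  and prime_cone_prime: "prime_cone P \<Longrightarrow> f * g \<in> P \<Longrightarrow> - (f * g) \<in> P \<Longrightarrow>
    f \<in> P \<and> - f \<in> P \<or> g \<in> P \<and> - g \<in> P"
  by (simp_all add: prime_cone_def preordering_def)

lemmas chosen_cone_add = prime_cone_add[OF prime_cone_chosen_cone]
  and chosen_cone_mult = prime_cone_mult[OF prime_cone_chosen_cone]
  and chosen_cone_total = prime_cone_total[OF prime_cone_chosen_cone]
  and chosen_cone_minus_1 = prime_cone_minus_1[OF prime_cone_chosen_cone]
  and chosen_cone_prime = prime_cone_prime[OF prime_cone_chosen_cone]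

lemma chosen_cone_0: "0 \<in> chosen_cone"
  using chosen_cone_total[of 0] by simp

text \<open>Congruence modulo the support of the cone, a prime ideal.\<close>

definition support_rel :: "'n::finite regfun \<Rightarrow> 'n regfun \<Rightarrow> bool" where
  "support_rel f g \<longleftrightarrow> f - g \<in> chosen_cone \<and> g - f \<in> chosen_cone"

text \<open>The support is an ideal because of totality: either \<open>g\<close> or
  \<open>- g\<close> lies in the cone.\<close>

lemma chosen_cone_support_mult:
  assumes "f \<in> chosen_cone" "- f \<in> chosen_cone"
  shows "g * f \<in> chosen_cone" "- (g * f) \<in> chosen_cone"
proof -
  have "g * f \<in> chosen_cone \<and> - (g * f) \<in> chosen_cone"
  proof (cases "g \<in> chosen_cone")
    case True
    then show ?thesis using chosen_cone_mult[OF True assms(1)] chosen_cone_mult[OF True assms(2)]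
      by simp
  next
    case False
    then have g: "- g \<in> chosen_cone" using chosen_cone_total by blast
    then show ?thesis using chosen_cone_mult[OF g assms(1)] chosen_cone_mult[OF g assms(2)] by simp
  qed
  then show "g * f \<in> chosen_cone" "- (g * f) \<in> chosen_cone" by blast+
qed

lemma chosen_cone_sum_eq: "f \<in> chosen_cone \<Longrightarrow> g \<in> chosen_cone \<Longrightarrow> h = f + g \<Longrightarrow> h \<in> chosen_cone"
  by (simp add: chosen_cone_add)

quotient_type 'n residue = "'n::finite regfun" / support_rel
  morphisms residue_rep residue_class
proof (rule equivpI)
  show "reflp (support_rel :: 'n regfun \<Rightarrow> _)"
    by (rule reflpI) (simp add: support_rel_def chosen_cone_0)
  show "symp (support_rel :: 'n regfun \<Rightarrow> _)" by (rule sympI) (simp add: support_rel_def)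
  show "transp (support_rel :: 'n regfun \<Rightarrow> _)"
  proof (rule transpI)
    fix f g h :: "'n regfun" assume *: "support_rel f g" "support_rel g h"
    then show "support_rel f h"
      unfolding support_rel_def
      using chosen_cone_sum_eq[of "f - g" "g - h" "f - h"] chosen_cone_sum_eq[of "h - g" "g - f"
        "h - f"] by simp
  qed
qed

instantiation residue :: (finite) linordered_idom
begin

lift_definition zero_residue :: "'a residue" is 0 .
lift_definition one_residue :: "'a residue" is 1 .
lift_definition plus_residue :: "'a residue \<Rightarrow> 'a residue \<Rightarrow> 'a residue" is "(+)"
proof -
  fix a b c d :: "'a regfun" assume "support_rel a b" "support_rel c d"
  then show "support_rel (a + c) (b + d)"
    unfolding support_rel_def
    using chosen_cone_sum_eq[of "a - b" "c - d" "a + c - (b + d)"]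
      chosen_cone_sum_eq[of "b - a" "d - c" "b + d - (a + c)"] by simp
qed
lift_definition uminus_residue :: "'a residue \<Rightarrow> 'a residue" is uminus
  by (simp add: support_rel_def)
lift_definition minus_residue :: "'a residue \<Rightarrow> 'a residue \<Rightarrow> 'a residue" is "(-)"
proof -
  fix a b c d :: "'a regfun" assume "support_rel a b" "support_rel c d"
  then show "support_rel (a - c) (b - d)"
    unfolding support_rel_def
    using chosen_cone_sum_eq[of "a - b" "d - c" "a - c - (b - d)"]
      chosen_cone_sum_eq[of "b - a" "c - d" "b - d - (a - c)"] by simp
qed
lift_definition times_residue :: "'a residue \<Rightarrow> 'a residue \<Rightarrow> 'a residue" is "(*)"
proof -
  fix a b c d :: "'a regfun" assume *: "support_rel a b" "support_rel c d"
  have "c * (a - b) \<in> chosen_cone" "- (c * (a - b)) \<in> chosen_cone"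
    by (rule chosen_cone_support_mult; use * in \<open>simp add: support_rel_def\<close>)+
  moreover have "b * (c - d) \<in> chosen_cone" "- (b * (c - d)) \<in> chosen_cone"
    by (rule chosen_cone_support_mult; use * in \<open>simp add: support_rel_def\<close>)+
  ultimately show "support_rel (a * c) (b * d)"
    unfolding support_rel_def
    using chosen_cone_sum_eq[of "c * (a - b)" "b * (c - d)" "a * c - b * d"]
      chosen_cone_sum_eq[of "- (c * (a - b))" "- (b * (c - d))" "b * d - a * c"]
    by (simp add: algebra_simps)
qed
lift_definition less_eq_residue :: "'a residue \<Rightarrow> 'a residue \<Rightarrow> bool" is "\<lambda>f g. g - f \<in> chosen_cone"
proof -
  fix a b c d :: "'a regfun" assume *: "support_rel a b" "support_rel c d"
  show "c - a \<in> chosen_cone \<longleftrightarrow> d - b \<in> chosen_cone"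
  proof
    assume h: "c - a \<in> chosen_cone"
    have "d - c \<in> chosen_cone" "a - b \<in> chosen_cone" using * by (simp_all add: support_rel_def)
    then have "(d - c) + (a - b) \<in> chosen_cone" by (rule chosen_cone_add)
    then show "d - b \<in> chosen_cone" using h by (rule chosen_cone_sum_eq) simp
  next
    assume h: "d - b \<in> chosen_cone"
    have "c - d \<in> chosen_cone" "b - a \<in> chosen_cone" using * by (simp_all add: support_rel_def)
    then have "(c - d) + (b - a) \<in> chosen_cone" by (rule chosen_cone_add)
    then show "c - a \<in> chosen_cone" using h by (rule chosen_cone_sum_eq) simp
  qed
qed

definition less_residue :: "'a residue \<Rightarrow> 'a residue \<Rightarrow> bool" where
  "less_residue x y \<longleftrightarrow> x \<le> y \<and> \<not> y \<le> x"
definition abs_residue :: "'a residue \<Rightarrow> 'a residue" where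
  "abs_residue x = (if x < 0 then - x else x)"
definition sgn_residue :: "'a residue \<Rightarrow> 'a residue" where
  "sgn_residue x = (if x = 0 then 0 else if 0 < x then 1 else - 1)"

instance
proof
  fix x y z :: "'a residue"
  have refl: "support_rel f f" for f :: "'a regfun" by (simp add: support_rel_def chosen_cone_0)
  show "x + y + z = x + (y + z)" "x + y = y + x" "0 + x = x" "- x + x = 0" "x - y = x + - y"
    "x * y * z = x * (y * z)" "x * y = y * x" "1 * x = x" "(x + y) * z = x * z + y * z"
    "x + y - x = y" "x - y - z = x - (y + z)" "0 * x = 0" "x * 0 = 0"
    by (transfer; simp add: algebra_simps refl)+
  show "(0 :: 'a residue) \<noteq> 1"
    by transfer (simp add: support_rel_def chosen_cone_minus_1)
  show "x < y \<longleftrightarrow> x \<le> y \<and> \<not> y \<le> x" by (rule less_residue_def)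
  show "x \<le> x" by transfer (simp add: chosen_cone_0)
  show "x \<le> y \<Longrightarrow> y \<le> z \<Longrightarrow> x \<le> z"
  proof transfer
    fix f g h :: "'a regfun" assume "g - f \<in> chosen_cone" "h - g \<in> chosen_cone"
    then show "h - f \<in> chosen_cone" by (rule chosen_cone_sum_eq) simp
  qed
  show "x \<le> y \<Longrightarrow> y \<le> x \<Longrightarrow> x = y" by transfer (simp add: support_rel_def)
  show "x \<le> y \<or> y \<le> x"
  proof transfer
    fix f g :: "'a regfun"
    show "g - f \<in> chosen_cone \<or> f - g \<in> chosen_cone" using chosen_cone_total[of "g - f"] by simp
  qed
  show "x \<le> y \<Longrightarrow> z + x \<le> z + y" by transfer simp
  show "x < y \<Longrightarrow> 0 < z \<Longrightarrow> z * x < z * y"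
  proof -
    assume "x < y" "0 < z"
    then have *: "x \<le> y" "0 \<le> z" "\<not> y \<le> x" "\<not> z \<le> 0" unfolding less_residue_def by auto
    have "z * x \<le> z * y" using *(1,2)
    proof transfer
      fix f g h :: "'a regfun" assume "g - f \<in> chosen_cone" "h - 0 \<in> chosen_cone"
      then have "(g - f) * (h - 0) \<in> chosen_cone" by (rule chosen_cone_mult)
      then show "h * g - h * f \<in> chosen_cone" by (simp add: algebra_simps)
    qed
    moreover have "\<not> z * y \<le> z * x" using *
    proof transfer
      fix f g h :: "'a regfun"
      assume a: "g - f \<in> chosen_cone" "h - 0 \<in> chosen_cone" "f - g \<notin> chosen_cone"
        "0 - h \<notin> chosen_cone"
      show "h * f - h * g \<notin> chosen_cone"
      proof
        assume "h * f - h * g \<in> chosen_cone"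
        then have "- (h * (g - f)) \<in> chosen_cone" by (simp add: algebra_simps)
        moreover have "h * (g - f) \<in> chosen_cone" using chosen_cone_mult[of h "g - f"] a by simp
        \<comment> \<open>Strict monotonicity is where primality of the support enters: a product in
          the support would need a factor in it.\<close>
        ultimately show False using chosen_cone_prime[of h "g - f"] a by simp
      qed
    qed
    ultimately show "z * x < z * y" unfolding less_residue_def by blast
  qed
  show "\<bar>x\<bar> = (if x < 0 then - x else x)" by (rule abs_residue_def)
  show "sgn x = (if x = 0 then 0 else if 0 < x then 1 else - 1)" by (rule sgn_residue_def)
qed

end

lemma is_hom_residue_class: "is_hom residue_class"
  by (simp add: is_hom_def one_residue_def plus_residue.abs_eq times_residue.abs_eq)

lemma residue_class_neg: "f \<notin> chosen_cone \<Longrightarrow> residue_class f < 0"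
  by (simp add: zero_residue_def less_eq_residue.abs_eq flip: not_le)

lemma is_hom_fract: "is_hom (\<lambda>x :: 'a::idom. Fract x 1)"
  by (simp add: is_hom_def One_fract_def)

lemma is_hom_comp: "is_hom \<phi> \<Longrightarrow> is_hom \<psi> \<Longrightarrow> is_hom (\<lambda>x. \<psi> (\<phi> x))"
  by (simp add: is_hom_def)

text \<open>A counterexample makes \<open>chosen_cone\<close> one as well. Its residue domain, the
  fraction field of that and the real closure of the latter give a homomorphism under which
  \<open>g\<close> is negative, against \<open>hom_nonneg\<close>.\<close>

theorem nonneg_in_prime_cone:
  fixes f :: "'n::finite regfun"
  assumes f: "\<And>x. 0 \<le> rapp f x" and P: "prime_cone P"
  shows "f \<in> P"
proof (rule ccontr)
  assume "f \<notin> P"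
  then have "bad_cone P" using f P by (auto simp: bad_cone_def)
  then have "bad_cone (chosen_cone :: 'n regfun set)" by (rule bad_cone_chosen_cone)
  then obtain g :: "'n regfun" where g: "\<And>x. 0 \<le> rapp g x" "g \<notin> chosen_cone"
    by (auto simp: bad_cone_def)
  define \<psi> where "\<psi> = (\<lambda>f :: 'n regfun. to_rc (Fract (residue_class f) 1))"
  have "is_hom \<psi>"
    unfolding \<psi>_def by (intro is_hom_comp[OF _ is_hom_to_rc] is_hom_comp[OF _ is_hom_fract]
      is_hom_residue_class)
  then have "0 \<le> \<psi> g" using g(1) by (rule hom_nonneg)
  moreover have "\<psi> g < 0"
    unfolding \<psi>_def
    by (rule to_rc_neg) (use residue_class_neg[OF g(2)] in \<open>simp add: Fract_less_zero_iff\<close>)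
  ultimately show False by simp
qed

lemma sum_squares_list:
  fixes s :: "'a::comm_ring_1"
  assumes "s \<in> sum_squares"
  shows "\<exists>m e. s = (\<Sum>i<m. e i * e (i :: nat))"
  using assms
proof (induction rule: sum_squares.induct)
  case zero
  then show ?case by (intro exI[of _ 0]) simp
next
  case (add s x)
  then obtain m e where s: "s = (\<Sum>i<m. e i * e (i :: nat))" by blast
  have "x * x + s = (\<Sum>i<Suc m. (e(m := x)) i * (e(m := x)) i)"
    by (simp add: s add.commute)
  then show ?case by blast
qed

theorem theorem6p2:
  fixes f :: "real ^ 'n \<Rightarrow> real"
  assumes "regulous f"
    and "\<forall>x. f x \<ge> 0"
  shows "\<exists>(m::nat) (fs :: nat \<Rightarrow> real ^ 'n \<Rightarrow> real).
           (\<forall>i<m. regulous (fs i)) \<and> (\<forall>x. f x = (\<Sum>i<m. (fs i x)\<^sup>2))"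
proof (cases "\<exists>c. f c \<noteq> 0")
  case False
  then show ?thesis by (intro exI[of _ 0]) auto
next
  case True
  \<comment> \<open>At \<open>c\<close> the common denominator \<open>D\<close> does not vanish,
    which the quotients below require.\<close>
  then obtain c where c: "f c \<noteq> 0" by blast
  define F where "F = Abs_regfun f"
  have F: "rapp F = f" using assms(1) by (simp add: F_def rapp_Abs)
  have "F \<in> P" if "prime_cone P" for P
    by (rule nonneg_in_prime_cone[OF _ that]) (use assms(2) F in simp)
  then obtain g h N where gh: "g \<in> sum_squares" "h \<in> sum_squares" "F * g = F ^ (2 * N) + h"
    using formal_positivstellensatz[of F] by blast
  define D where "D = F ^ (2 * N) + h"
  have "F ^ (2 * N) = F ^ N * F ^ N" by (simp add: mult_2 power_add)
  then have "D \<in> sum_squares"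
    unfolding D_def using sum_squares_add[OF sum_squares_square[of "F ^ N"] gh(2)] by simp
  then obtain m e where e: "g * D = (\<Sum>i<m. e i * e (i :: nat))"
    using sum_squares_list[OF sum_squares_mult[OF gh(1)]] by blast
  have h0: "0 \<le> rapp h x" for x
    using gh(2) by (induction rule: sum_squares.induct) auto
  have D: "0 < rapp D x" if "f x \<noteq> 0" for x
  proof -
    have "0 < f x ^ (2 * N)" using that by (simp add: zero_less_power_eq)
    then show ?thesis using h0[of x] by (simp add: D_def F)
  qed
  have fD: "f x * rapp g x = rapp D x" for x
    using arg_cong[OF gh(3), of "\<lambda>a. rapp a x"] by (simp add: D_def F)
  \<comment> \<open>The value \<open>0\<close> at the zeros of \<open>f\<close> is the continuous
    one, and the sum of squares holds there as well.\<close>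
  define fs where "fs = (\<lambda>i x. if f x = 0 then 0 else f x * rapp (e i) x / rapp D x)"
  have sum: "f x = (\<Sum>i<m. (fs i x)\<^sup>2)" for x
  proof (cases "f x = 0")
    case True
    then show ?thesis by (simp add: fs_def)
  next
    case False
    have "(\<Sum>i<m. (fs i x)\<^sup>2) = (f x)\<^sup>2 / (rapp D x)\<^sup>2 * (\<Sum>i<m. rapp (e i) x * rapp (e i) x)"
      using False by (simp add: fs_def power2_eq_square sum_distrib_left sum_divide_distrib mult_ac)
    also have "(\<Sum>i<m. rapp (e i) x * rapp (e i) x) = rapp g x * rapp D x"
      using arg_cong[OF e, of "\<lambda>a. rapp a x"] by simp
    also have "(f x)\<^sup>2 / (rapp D x)\<^sup>2 * (rapp g x * rapp D x) = f x * (f x * rapp g x) / rapp D x"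
      using D[OF False] by (simp add: power2_eq_square)
    also have "\<dots> = f x" using D[OF False] by (simp add: fD)
    finally show ?thesis by simp
  qed
  have cf: "continuous_on UNIV f" using assms(1) by (simp add: regulous_iff)
  have cr: "isCont (rapp a) x" for a x
    using regulous_rapp[of a] by (simp add: regulous_iff continuous_on_eq_continuous_at)
  have reg: "regulous (fs i)" if i: "i < m" for i
  proof (rule regulous_quotient)
    show "rapp D x * fs i x = rapp (F * e i) x" for x
      using D[of x] by (cases "f x = 0") (simp_all add: fs_def F)
    show "regulous (rapp (F * e i))" "regulous (rapp D)" by (rule regulous_rapp)+
    show "rapp D c \<noteq> 0" using D[OF c] by simp
    have "isCont (fs i) x" for x
    proof (cases "f x = 0")
      case True
      have bound: "norm (fs i y) \<le> sqrt (f y)" for y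
      proof -
        \<comment> \<open>One square is at most the sum of all of them, so the identity itself
          supplies the bound for continuity at zeros of \<open>f\<close>.\<close>
        have "(fs i y)\<^sup>2 \<le> f y"
          unfolding sum[of y] using i by (intro member_le_sum) auto
        then show ?thesis using real_sqrt_le_mono[of "(fs i y)\<^sup>2" "f y"] by simp
      qed
      have "isCont f x" using cf by (simp add: continuous_on_eq_continuous_at)
      then have "((\<lambda>y. sqrt (f y)) \<longlongrightarrow> sqrt (f x)) (at x)"
        by (intro tendsto_real_sqrt) (simp add: isCont_def)
      then have "(fs i \<longlongrightarrow> 0) (at x)"
        using True by (intro Lim_null_comparison[of "fs i"
          "\<lambda>y. sqrt (f y)"]) (auto simp: bound[unfolded real_norm_def])
      then show ?thesis using True by (simp add: isCont_def fs_def)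
    next
      case False
      have "open {y. f y \<noteq> 0}" using cf by (intro open_Collect_neq continuous_intros)
      then have "eventually (\<lambda>y. f y \<noteq> 0) (nhds x)" using False by (auto simp: eventually_nhds)
      then have "eventually (\<lambda>y. fs i y = f y * rapp (e i) y / rapp D y) (nhds x)"
        by eventually_elim (simp add: fs_def)
      moreover have "isCont (\<lambda>y. f y * rapp (e i) y / rapp D y) x"
        using D[OF False] cf cr by (intro continuous_intros) (auto simp:
          continuous_on_eq_continuous_at)
      ultimately show ?thesis by (simp add: isCont_cong)
    qed
    then show "continuous_on UNIV (fs i)" by (simp add: continuous_on_eq_continuous_at)
  qed
  show ?thesis using reg sum by blast
qed

end
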